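(* Let $p$ be a prime, let $K$ be a finite extension of $\mathbb{Q}_p$, and let $\phi\in K(z)$ be a rational map of degree at least $2$ such that $\infty\in F_{\mathbb{C}_p}(\phi)$. Then the following are equivalent: (1) $\phi$ is subhyperbolic, i.e. each critical point of $\phi$ lying in $J_{\mathbb{C}_p}(\phi)$ is eventually periodic; (2) for every finite extension $L$ of $K$, the map $\phi$ is expanding in $J_{\mathbb{C}_p}(\phi)\cap L$ with respect to an admissible metric.
   Context: $\mathbb{C}_p$ denotes the completion of an algebraic closure of $\mathbb{Q}_p$ with its non-archimedean absolute value $|\cdot|$, and $K$ carries the restricted absolute value. For a rational map $\phi\in K(z)$ of degree at least $2$ and a field extension $L$ of $K$ (inside $\mathbb{C}_p$), the $L$-Fatou set $F_L(\phi)$ is the set of points of $\mathbb{P}^1_L$ having a neighborhood in $\mathbb{P}^1_L$ on which the family of iterates $\{\phi^n\}_{n\ge1}$ is equicontinuous with respect to the spherical metric; the $L$-Julia set is $J_L(\phi)=\mathbb{P}^1_L\setminus F_L(\phi)$. For a finite extension $L$ of $K$, $\nu_L$ denotes the normalized Haar measure on $L$. Admissible function: let $L$ be a finite extension of $K$. A continuous extended-real-valued function $\rho=\rho_L$ defined on some neighborhood $V\subset\mathbb{C}_p$ of $J_{\mathbb{C}_p}(\phi)\cap L$ is admissible if (i) there is $C>0$ with $\rho(V)\subset[C,+\infty]$; (ii) $\rho$ (possibly) blows up only at finitely many points $z_1,\dots,z_\ell\in J_{\mathbb{C}_p}(\phi)\cap L$, called exceptional points; and (iii) there exist $B>0$ and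 $0<\beta<1$ with $\rho(z)\le\sum_{j=1}^{\ell}B/|z-z_j|^{\beta}$. The admissible metric induced by $\rho_L$ is $\rho_L(z)\,d\nu_L(z)$ on $V\cap L$. Expanding: $\phi$ is expanding in $J_{\mathbb{C}_p}(\phi)\cap L$ with respect to the admissible metric $\rho_L\,d\nu_L$ if there exists $\lambda>1$ such that for every $z\in J_L(\phi)$ for which neither $z$ nor $\phi(z)$ is an exceptional point of $\rho_L$, one has $\rho_L(\phi(z))\,|\phi'(z)|\ge\lambda\,\rho_L(z)$. *)

theory Defs
  imports "HOL-Analysis.Analysis" "HOL-Computational_Algebra.Polynomial"
begin

definition nonarch_absval :: "('a::field \<Rightarrow> real) \<Rightarrow> bool" where
  "nonarch_absval absv \<longleftrightarrow>
     (\<forall>x. 0 \<le> absv x) \<and> (\<forall>x. absv x = 0 \<longleftrightarrow> x = 0) \<and>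
     (\<forall>x y. absv (x * y) = absv x * absv y) \<and>
     (\<forall>x y. absv (x + y) \<le> max (absv x) (absv y))"

definition absv_complete :: "('a::field \<Rightarrow> real) \<Rightarrow> bool" where
  "absv_complete absv \<longleftrightarrow>
     (\<forall>s::nat \<Rightarrow> 'a. (\<forall>e>0. \<exists>N. \<forall>m\<ge>N. \<forall>n\<ge>N. absv (s m - s n) < e) \<longrightarrow>
        (\<exists>l. (\<lambda>n. absv (s n - l)) \<longlonglongrightarrow> 0))"

definition alg_closed_field :: "'a::field itself \<Rightarrow> bool" where
  "alg_closed_field T \<longleftrightarrow> (\<forall>P::'a poly. degree P \<ge> 1 \<longrightarrow> (\<exists>x. poly P x = 0))"

text \<open>(absv on 'a) is (isometrically isomorphic to) C_p: a complete, algebraically closed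
  non-archimedean valued field with |p| = 1/p in which the algebraic numbers (the algebraic
  closure of Q) are dense; it is then the completion of an algebraic closure of Q_p.\<close>
definition is_Cp :: "('a::field_char_0 \<Rightarrow> real) \<Rightarrow> nat \<Rightarrow> bool" where
  "is_Cp absv p \<longleftrightarrow> prime p \<and> nonarch_absval absv \<and> absv (of_nat p) = 1 / real p \<and>
     absv_complete absv \<and> alg_closed_field TYPE('a) \<and>
     (\<forall>x. \<forall>e>0. \<exists>y. algebraic y \<and> absv (x - y) < e)"

definition Qp_in :: "('a::field_char_0 \<Rightarrow> real) \<Rightarrow> 'a set" where
  "Qp_in absv = {x. \<forall>e>0. \<exists>q::rat. absv (x - of_rat q) < e}"

definition is_subfield :: "'a::field set \<Rightarrow> bool" where
  "is_subfield L \<longleftrightarrow> 0 \<in> L \<and> 1 \<in> L \<and> (\<forall>x\<in>L. \<forall>y\<in>L. x + y \<in> L \<and> x - y \<in> L \<and> x * y \<in> L) \<and>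
     (\<forall>x\<in>L. x \<noteq> 0 \<longrightarrow> inverse x \<in> L)"

definition finite_ext :: "'a::field set \<Rightarrow> 'a set \<Rightarrow> bool" where
  "finite_ext F L \<longleftrightarrow> is_subfield F \<and> is_subfield L \<and> F \<subseteq> L \<and>
     (\<exists>B. finite B \<and> B \<subseteq> L \<and>
        (\<forall>x\<in>L. \<exists>c. (\<forall>b\<in>B. c b \<in> F) \<and> x = (\<Sum>b\<in>B. c b * b)))"

text \<open>Points of P^1: None is \<infinity>, Some x is x. P^1_S = S \<union> {\<infinity>}.\<close>
definition P1 :: "'a set \<Rightarrow> 'a option set" where
  "P1 S = insert None (Some ` S)"

definition rat_map_over :: "'a::field set \<Rightarrow> 'a poly \<Rightarrow> 'a poly \<Rightarrow> bool" where
  "rat_map_over K P Q \<longleftrightarrow> Q \<noteq> 0 \<and> coprime P Q \<and> (\<forall>i. coeff P i \<in> K) \<and> (\<forall>i. coeff Q i \<in> K)"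

definition rat_deg :: "'a::field poly \<Rightarrow> 'a poly \<Rightarrow> nat" where
  "rat_deg P Q = max (degree P) (degree Q)"

definition rat_eval :: "'a::field poly \<Rightarrow> 'a poly \<Rightarrow> 'a option \<Rightarrow> 'a option" where
  "rat_eval P Q z = (case z of
      Some x \<Rightarrow> (if poly Q x \<noteq> 0 then Some (poly P x / poly Q x) else None)
    | None \<Rightarrow> (if degree P > degree Q then None
               else if degree P < degree Q then Some 0
               else Some (lead_coeff P / lead_coeff Q)))"

definition rat_deriv :: "'a::field poly \<Rightarrow> 'a poly \<Rightarrow> 'a \<Rightarrow> 'a" where
  "rat_deriv P Q x = (poly (pderiv P) x * poly Q x - poly P x * poly (pderiv Q) x) / (poly Q x)^2"

text \<open>z^d p(1/z).\<close>
definition hom_rev :: "nat \<Rightarrow> 'a::field poly \<Rightarrow> 'a poly" where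
  "hom_rev d p = (\<Sum>i\<le>d. monom (coeff p (d - i)) i)"

text \<open>Critical points in P^1: a finite c is critical iff the Wronskian P'Q - PQ' vanishes at c
  (i.e. phi'(c) = 0 if phi(c) finite, resp. c is a multiple pole); \<infinity> is critical iff
  0 is critical for z \<mapsto> phi(1/z).\<close>
definition critical_pt :: "'a::field poly \<Rightarrow> 'a poly \<Rightarrow> 'a option \<Rightarrow> bool" where
  "critical_pt P Q c = (case c of
      Some x \<Rightarrow> poly (pderiv P * Q - P * pderiv Q) x = 0
    | None \<Rightarrow> (let d = rat_deg P Q; Pr = hom_rev d P; Qr = hom_rev d Q in
               poly (pderiv Pr * Qr - Pr * pderiv Qr) 0 = 0))"

definition chordal :: "('a::field \<Rightarrow> real) \<Rightarrow> 'a option \<Rightarrow> 'a option \<Rightarrow> real" where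
  "chordal absv z w = (case (z, w) of
      (Some x, Some y) \<Rightarrow> absv (x - y) / (max 1 (absv x) * max 1 (absv y))
    | (Some x, None) \<Rightarrow> 1 / max 1 (absv x)
    | (None, Some y) \<Rightarrow> 1 / max 1 (absv y)
    | (None, None) \<Rightarrow> 0)"

definition equicont_on :: "('a::field \<Rightarrow> real) \<Rightarrow> ('a option \<Rightarrow> 'a option) \<Rightarrow> 'a option set \<Rightarrow> bool" where
  "equicont_on absv f U \<longleftrightarrow>
     (\<forall>w\<in>U. \<forall>e>0. \<exists>d>0. \<forall>u\<in>U. chordal absv w u < d \<longrightarrow>
        (\<forall>n\<ge>1. chordal absv ((f ^^ n) w) ((f ^^ n) u) < e))"

definition Fatou_set :: "('a::field \<Rightarrow> real) \<Rightarrow> 'a poly \<Rightarrow> 'a poly \<Rightarrow> 'a set \<Rightarrow> 'a option set" where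
  "Fatou_set absv P Q S = {z \<in> P1 S. \<exists>U. U \<subseteq> P1 S \<and> z \<in> U \<and>
      (\<exists>r>0. {w \<in> P1 S. chordal absv z w < r} \<subseteq> U) \<and> equicont_on absv (rat_eval P Q) U}"

definition Julia_set :: "('a::field \<Rightarrow> real) \<Rightarrow> 'a poly \<Rightarrow> 'a poly \<Rightarrow> 'a set \<Rightarrow> 'a option set" where
  "Julia_set absv P Q S = P1 S - Fatou_set absv P Q S"

definition eventually_periodic :: "('b \<Rightarrow> 'b) \<Rightarrow> 'b \<Rightarrow> bool" where
  "eventually_periodic f c \<longleftrightarrow> (\<exists>m n. n > 0 \<and> (f ^^ (m + n)) c = (f ^^ m) c)"

definition subhyperbolic :: "('a::field \<Rightarrow> real) \<Rightarrow> 'a poly \<Rightarrow> 'a poly \<Rightarrow> bool" where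
  "subhyperbolic absv P Q \<longleftrightarrow>
     (\<forall>c. critical_pt P Q c \<and> c \<in> Julia_set absv P Q UNIV \<longrightarrow> eventually_periodic (rat_eval P Q) c)"

definition absv_open :: "('a::field \<Rightarrow> real) \<Rightarrow> 'a set \<Rightarrow> bool" where
  "absv_open absv V \<longleftrightarrow> (\<forall>x\<in>V. \<exists>r>0. {y. absv (y - x) < r} \<subseteq> V)"

definition absv_continuous_on :: "('a::field \<Rightarrow> real) \<Rightarrow> 'a set \<Rightarrow> ('a \<Rightarrow> ereal) \<Rightarrow> bool" where
  "absv_continuous_on absv V \<rho> \<longleftrightarrow>
     (\<forall>x\<in>V. \<forall>s. (\<forall>n. s n \<in> V) \<longrightarrow> (\<lambda>n. absv (s n - x)) \<longlonglongrightarrow> 0 \<longrightarrow> (\<lambda>n. \<rho> (s n)) \<longlonglongrightarrow> \<rho> x)"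

definition admissible :: "('a::field \<Rightarrow> real) \<Rightarrow> 'a poly \<Rightarrow> 'a poly \<Rightarrow> 'a set \<Rightarrow> 'a set \<Rightarrow> ('a \<Rightarrow> ereal) \<Rightarrow> 'a set \<Rightarrow> bool" where
  "admissible absv P Q L V \<rho> Z \<longleftrightarrow>
     absv_open absv V \<and> {x \<in> L. Some x \<in> Julia_set absv P Q UNIV} \<subseteq> V \<and>
     absv_continuous_on absv V \<rho> \<and>
     (\<exists>C>0. \<forall>x\<in>V. ereal C \<le> \<rho> x) \<and>
     finite Z \<and> Z \<subseteq> {x \<in> L. Some x \<in> Julia_set absv P Q UNIV} \<and>
     (\<forall>x\<in>V - Z. \<rho> x \<noteq> \<infinity>) \<and>
     (\<exists>B>0. \<exists>\<beta>. 0 < \<beta> \<and> \<beta> < 1 \<and>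
        (\<forall>z\<in>V. \<rho> z \<le> (\<Sum>zj\<in>Z. ereal B / ereal (absv (z - zj) powr \<beta>))))"

definition expanding_wrt :: "('a::field \<Rightarrow> real) \<Rightarrow> 'a poly \<Rightarrow> 'a poly \<Rightarrow> 'a set \<Rightarrow> ('a \<Rightarrow> ereal) \<Rightarrow> 'a set \<Rightarrow> bool" where
  "expanding_wrt absv P Q L \<rho> Z \<longleftrightarrow>
     (\<exists>lam>1. \<forall>x y. Some x \<in> Julia_set absv P Q L \<longrightarrow> rat_eval P Q (Some x) = Some y \<longrightarrow>
        x \<notin> Z \<longrightarrow> y \<notin> Z \<longrightarrow> \<rho> y * ereal (absv (rat_deriv P Q x)) \<ge> ereal lam * \<rho> x)"

definition expanding_admissible :: "('a::field \<Rightarrow> real) \<Rightarrow> 'a poly \<Rightarrow> 'a poly \<Rightarrow> 'a set \<Rightarrow> bool" where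
  "expanding_admissible absv P Q L \<longleftrightarrow>
     (\<exists>V \<rho> Z. admissible absv P Q L V \<rho> Z \<and> expanding_wrt absv P Q L \<rho> Z)"

end

theory Submission imports Defs
begin

text \<open>
  Finite extensions of \<open>\<rat>\<^sub>p\<close> have the Bolzano--Weierstrass property, so compactness arguments are
  available on \<open>J \<inter> L\<close>. On a small ball around a non-critical point the map is a similarity of
  ratio \<open>\<bar>\<phi>'\<bar>\<close>. Cycles in \<open>J\<close> are repelling, and points near a preperiodic point of \<open>J\<close>
  are carried, by an iterate that is univalent on a ball of comparable size, to a definite distance from
  its orbit.

  Let \<open>\<phi>\<close> be subhyperbolic, and let \<open>S\<close> be the finite set of forward orbits of critical points
  in \<open>J \<inter> L\<close>. Exponents \<open>e(w) > 0\<close> with \<open>m(w) e(\<phi>(w)) < e(w)\<close> off the cycles, and constant on the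
  cycles (\<open>m\<close> is the local degree), make \<open>R(z) = 1 + \<Sum> \<bar>z - w\<bar>\<^bsup>e(w) - 1\<^esup>\<close> grow under some bounded
  number of iterates, by compactness at most \<open>N\<close>. The maximum over \<open>i < N\<close> of
  \<open>2\<^bsup>-i/N\<^esup> \<bar>(\<phi>\<^sup>i)'(z)\<bar> R(\<phi>\<^sup>i(z))\<close> is then an expanding metric.

  Conversely, an expanding metric on \<open>L\<close> forbids a critical point \<open>c\<close> with infinite orbit to be an
  accumulation point of \<open>J \<inter> L\<close>: along \<open>z \<rightarrow> c\<close> the derivative of an iterate tends to \<open>0\<close> while the metric
  stays bounded at an iterate of \<open>c\<close> that is not exceptional. Expansion is only required on the possibly
  smaller set \<open>J\<^sub>L\<close>; adjoining an \<open>l\<close>-th root of \<open>p\<close> for a large prime \<open>l\<close> brings \<open>J \<inter> L\<close> into it, because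
  distances with \<open>p\<close>-order outside \<open>(1/E)\<int>\<close> persist along orbits. If all non-preperiodic critical
  points of \<open>J \<inter> L\<close> are isolated there, then the tail of the orbit of \<open>c\<close> stays in a compact set without them;
  univalent images of balls of definite size and recurrence make a point of this tail
  an accumulation point of \<open>J \<inter> L\<close>, and pulling this back to \<open>c\<close> over a further finite extension
  gives a contradiction.
\<close>

subsection \<open>Non-archimedean absolute values\<close>

text \<open>The exponents are dictated by pull-back. Near w of local degree m the derivative has
  size |z - w|^(m-1), so a singularity of exponent e - 1 at phi(w) induces one of exponent m e - 1
  at w. If m e(phi(w)) < e(w), the induced singularity is stronger than the one already at w, and
  the ratio of the two is unbounded; on a cycle the exponents agree and the growth is the multiplier
  to the power e. Two obstacles shape the rest. The large field is not locally compact, so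
  compactness is used over one finite extension at a time, and the field must grow whenever a
  preimage has to be found. Moreover p may divide a local degree m; near a critical point w the map
  is then a similarity about b only up to a radius of order |m| |b - w|, and |m| enters many
  constants. Generic distances transfer equicontinuity from L to the large field: at such a distance
  no two monomials of a polynomial of degree below l have equal absolute value, so a single point of
  L realises the supremum over a whole disc.\<close>

lemma subfield_sum: "is_subfield F \<Longrightarrow> (\<And>i. i \<in> I \<Longrightarrow> g i \<in> F) \<Longrightarrow> sum g I \<in> F"
  by (induction I rule: infinite_finite_induct) (auto simp: is_subfield_def)

locale nonarch =
  fixes absv :: "'a::field_char_0 \<Rightarrow> real"
  assumes absv_nonneg [simp]: "0 \<le> absv x"
    and absv_eq_0 [simp]: "absv x = 0 \<longleftrightarrow> x = 0"
    and absv_mult: "absv (x * y) = absv x * absv y"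
    and absv_add: "absv (x + y) \<le> max (absv x) (absv y)"
begin

lemma absv_0 [simp]: "absv 0 = 0" by simp

lemma absv_pos [simp]: "0 < absv x \<longleftrightarrow> x \<noteq> 0"
  using absv_nonneg[of x] absv_eq_0[of x] by linarith

lemma absv_le_0 [simp]: "absv x \<le> 0 \<longleftrightarrow> x = 0"
  using absv_nonneg[of x] absv_eq_0[of x] by linarith

lemma absv_1 [simp]: "absv 1 = 1"
  using absv_mult[of 1 1] by simp

lemma absv_minus_1: "absv (-1) = 1"
proof -
  have "(absv (-1))^2 = 1"
    using absv_mult[of "-1" "-1"] by (simp add: power2_eq_square)
  thus ?thesis using absv_nonneg[of "-1"] by (simp add: power2_eq_1_iff)
qed

lemma absv_minus [simp]: "absv (- x) = absv x"
  using absv_mult[of "-1" x] by (simp add: absv_minus_1)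

lemma absv_commute: "absv (x - y) = absv (y - x)"
  using absv_minus[of "x - y"] by simp

lemma absv_diff: "absv (x - y) \<le> max (absv x) (absv y)"
  using absv_add[of x "- y"] by simp

lemma absv_ultra: "absv (x - z) \<le> max (absv (x - y)) (absv (y - z))"
  using absv_add[of "x - y" "y - z"] by simp

lemma absv_ultra_less: "absv (x - y) < r \<Longrightarrow> absv (y - z) < r \<Longrightarrow> absv (x - z) < r"
  using absv_ultra[of x z y] by simp

lemma absv_ultra_less': "absv (x - y) < r \<Longrightarrow> absv (z - y) < r \<Longrightarrow> absv (x - z) < r"
  using absv_ultra[of x z y] by (simp add: absv_commute)

lemma absv_add_eq: "absv y < absv x \<Longrightarrow> absv (x + y) = absv x"
  using absv_add[of x y] absv_diff[of "x + y" y] by auto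

lemma absv_eq_if_close: "absv (x - y) < absv y \<Longrightarrow> absv x = absv y"
  using absv_add_eq[of "x - y" y] by simp

lemma absv_power [simp]: "absv (x ^ n) = absv x ^ n"
  by (induction n) (auto simp: absv_mult)

lemma absv_inverse [simp]: "absv (inverse x) = inverse (absv x)"
proof (cases "x = 0")
  case False
  hence "absv x * absv (inverse x) = 1"
    using absv_mult[of x "inverse x"] by simp
  thus ?thesis by (simp add: inverse_unique)
qed auto

lemma absv_divide [simp]: "absv (x / y) = absv x / absv y"
  by (simp add: divide_inverse absv_mult)

lemma absv_sum_le:
  assumes "\<And>i. i \<in> I \<Longrightarrow> absv (g i) \<le> M" "0 \<le> M"
  shows "absv (\<Sum>i\<in>I. g i) \<le> M"
  using assms
proof (induction I rule: infinite_finite_induct)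
  case (insert i I)
  have "absv (g i) \<le> M" "absv (\<Sum>i\<in>I. g i) \<le> M" using insert by auto
  thus ?case using insert.hyps absv_add[of "g i" "\<Sum>i\<in>I. g i"] by simp
qed auto

lemma absv_of_nat_le: "absv (of_nat n) \<le> 1"
proof (induction n)
  case (Suc n)
  thus ?case using absv_add[of 1 "of_nat n"] by auto
qed auto

lemma absv_of_int_le: "absv (of_int n) \<le> 1"
  by (cases n rule: int_cases2) (use absv_of_nat_le in auto)

lemma absv_sum_dominant:
  assumes "finite I" "k \<in> I" "\<And>i. i \<in> I - {k} \<Longrightarrow> absv (g i) < absv (g k)"
  shows "absv (\<Sum>i\<in>I. g i) = absv (g k)"
proof (cases "I - {k} = {}")
  case True
  hence "I = {k}" using assms by auto
  thus ?thesis by simp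
next
  case False
  have fin: "finite (I - {k})" using assms by simp
  define M where "M = Max ((\<lambda>i. absv (g i)) ` (I - {k}))"
  have Mless: "M < absv (g k)"
    unfolding M_def using False fin assms(3) by (subst Max_less_iff) auto
  have le: "absv (g i) \<le> M" if "i \<in> I - {k}" for i
    unfolding M_def using fin that by (intro Max_ge) auto
  have "0 \<le> M" using False le absv_nonneg order_trans by blast
  hence "absv (\<Sum>i\<in>I - {k}. g i) \<le> M"
    using le by (intro absv_sum_le)
  hence "absv (g k + (\<Sum>i\<in>I - {k}. g i)) = absv (g k)"
    using Mless by (intro absv_add_eq) linarith
  thus ?thesis using assms by (simp add: sum.remove)
qed

sublocale M: Metric_space UNIV "\<lambda>x y. absv (x - y)"
proof
  fix x y z :: 'a
  show "absv (x - z) \<le> absv (x - y) + absv (y - z)"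
    using absv_ultra[of x z y] absv_nonneg[of "x - y"] absv_nonneg[of "y - z"] by linarith
qed (auto simp: absv_commute)

text \<open>The type carries no topology, so compactness is stated sequentially for the metric given
  by \<open>absv\<close>; \<open>cpt_iff\<close> identifies it with compactness in the associated
  metric topology.\<close>

definition cpt :: "'a set \<Rightarrow> bool" where
  "cpt X \<longleftrightarrow> (\<forall>s::nat \<Rightarrow> 'a. range s \<subseteq> X \<longrightarrow>
     (\<exists>l\<in>X. \<exists>r. strict_mono r \<and> (\<lambda>n. absv (s (r n) - l)) \<longlonglongrightarrow> 0))"

lemma limitin_iff: "limitin M.mtopology s l sequentially \<longleftrightarrow> (\<lambda>n. absv (s n - l)) \<longlonglongrightarrow> 0"
  unfolding M.limitin_metric tendsto_iff by (auto simp: dist_real_def)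

lemma cpt_iff: "cpt X \<longleftrightarrow> compactin M.mtopology X"
  unfolding cpt_def M.compactin_sequentially limitin_iff o_def Bex_def by simp

lemma cpt_cover:
  assumes "cpt X" "\<And>x. x \<in> X \<Longrightarrow> 0 < r x"
  obtains T where "finite T" "T \<subseteq> X" "\<And>y. y \<in> X \<Longrightarrow> \<exists>x\<in>T. absv (y - x) < r x"
proof -
  let ?U = "(\<lambda>x. M.mball x (r x)) ` X"
  have "x \<in> M.mball x (r x)" if "x \<in> X" for x using assms(2)[OF that] by simp
  hence "X \<subseteq> \<Union> ?U" by blast
  moreover have "\<And>U. U \<in> ?U \<Longrightarrow> openin M.mtopology U" by auto
  ultimately obtain F where F: "finite F" "F \<subseteq> ?U" "X \<subseteq> \<Union> F"
    using compactinD[of M.mtopology X ?U] assms(1) unfolding cpt_iff by blast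
  then obtain T where T: "T \<subseteq> X" "finite T" "F = (\<lambda>x. M.mball x (r x)) ` T"
    using finite_subset_image[OF F(1,2)] by blast
  show ?thesis
  proof
    fix y assume "y \<in> X"
    then obtain x where "x \<in> T" "y \<in> M.mball x (r x)" using F T by auto
    thus "\<exists>x\<in>T. absv (y - x) < r x" by (auto simp: absv_commute)
  qed (use T in auto)
qed

text \<open>Local constants become one global constant: take the least over the centres of a finite
  subcover, which is allowed because \<open>R\<close> survives decreasing its first argument. The
  extra 1 in the minimum covers an empty subcover.\<close>

lemma cpt_uniform:
  assumes "cpt X"
    and "\<And>x. x \<in> X \<Longrightarrow> \<exists>r>0. \<exists>k>0. \<forall>y\<in>X. absv (y - x) < r \<longrightarrow> R k y"
    and mono: "\<And>k k' y. R k y \<Longrightarrow> 0 < k' \<Longrightarrow> k' \<le> (k::real) \<Longrightarrow> R k' y"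
  obtains k where "0 < k" "\<And>y. y \<in> X \<Longrightarrow> R k y"
proof -
  from assms(2) have "\<forall>x\<in>X. \<exists>r k. 0 < r \<and> 0 < k \<and> (\<forall>y\<in>X. absv (y - x) < r \<longrightarrow> R k y)"
    by blast
  then obtain r k where rk: "\<And>x. x \<in> X \<Longrightarrow> 0 < r x \<and> 0 < k x \<and> (\<forall>y\<in>X. absv (y - x) < r x \<longrightarrow> R (k x) y)"
    by metis
  obtain T where T: "finite T" "T \<subseteq> X" "\<And>y. y \<in> X \<Longrightarrow> \<exists>x\<in>T. absv (y - x) < r x"
    using cpt_cover[OF assms(1), of r] rk by metis
  define k0 where "k0 = Min (insert 1 (k ` T))"
  have "0 < k0" unfolding k0_def using T rk by (subst Min_gr_iff) auto
  moreover have "R k0 y" if y: "y \<in> X" for y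
  proof -
    obtain x where x: "x \<in> T" "absv (y - x) < r x" using T y by blast
    have "k0 \<le> k x" unfolding k0_def using x T by (intro Min_le) auto
    thus ?thesis using mono \<open>0 < k0\<close> rk x T y by (metis subsetD)
  qed
  ultimately show ?thesis using that by blast
qed

text \<open>Pigeonhole over a finite \<open>k\<close>-net: two points assigned to the same centre
  are closer than \<open>k\<close> by the ultrametric inequality. This provides the recurrence of an
  infinite orbit in a compact set.\<close>

lemma cpt_infinite_close:
  assumes "cpt X" "infinite A" "A \<subseteq> X" "0 < k"
  obtains x y where "x \<in> A" "y \<in> A" "x \<noteq> y" "absv (x - y) < k"
proof -
  obtain T where T: "finite T" "T \<subseteq> X" "\<And>y. y \<in> X \<Longrightarrow> \<exists>x\<in>T. absv (y - x) < k"
    using cpt_cover[OF assms(1), of "\<lambda>_. k"] assms(4) by metis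
  then obtain g where g: "\<And>y. y \<in> X \<Longrightarrow> g y \<in> T \<and> absv (y - g y) < k" by metis
  have "g ` A \<subseteq> T" using g assms(3) by blast
  hence "\<not> inj_on g A"
    using T(1) assms(2) finite_subset inj_on_finite by blast
  then obtain x y where "x \<in> A" "y \<in> A" "x \<noteq> y" "g x = g y" by (auto simp: inj_on_def)
  thus ?thesis using that g assms(3) absv_ultra_less' by (metis subsetD)
qed

text \<open>The limit is required to lie in \<open>L\<close>, so the property contains closedness of
  \<open>L\<close> as well as compactness of its closed bounded subsets.\<close>

definition heine_borel :: "'a set \<Rightarrow> bool" where
  "heine_borel L \<longleftrightarrow> (\<forall>s R. (\<forall>n::nat. s n \<in> L \<and> absv (s n) \<le> R) \<longrightarrow>
     (\<exists>l\<in>L. \<exists>r. strict_mono r \<and> (\<lambda>n. absv (s (r n) - l)) \<longlonglongrightarrow> 0))"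

lemma heine_borelE:
  assumes "heine_borel L" "\<And>n::nat. s n \<in> L" "\<And>n. absv (s n) \<le> R"
  obtains l r where "l \<in> L" "strict_mono r" "(\<lambda>n. absv (s (r n) - l)) \<longlonglongrightarrow> 0"
  using assms unfolding heine_borel_def by blast

lemma absv_lim_unique:
  assumes "(\<lambda>n. absv (s n - l)) \<longlonglongrightarrow> 0" "(\<lambda>n. absv (s n - l')) \<longlonglongrightarrow> 0"
  shows "l = l'"
  using M.limitin_metric_unique[of s l sequentially l'] assms unfolding limitin_iff by simp

lemma absv_lim_subseq:
  assumes "(\<lambda>n. absv (s n - l)) \<longlonglongrightarrow> 0" "strict_mono r"
  shows "(\<lambda>n. absv (s (r n) - l)) \<longlonglongrightarrow> 0"
  using LIMSEQ_subseq_LIMSEQ[OF assms] by (simp add: o_def)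

lemma absv_lim_bounded:
  assumes "(\<lambda>n. absv (s n - l)) \<longlonglongrightarrow> 0"
  shows "\<exists>R. \<forall>n. absv (s n) \<le> R"
proof -
  have "Bseq (\<lambda>n. absv (s n - l))" using assms convergentI convergent_imp_Bseq by blast
  then obtain B where B: "\<And>n. absv (s n - l) \<le> B" unfolding Bseq_def by auto
  have "absv (s n) \<le> max B (absv l)" for n
    using absv_add[of "s n - l" l] B[of n] by auto
  thus ?thesis by blast
qed

lemma heine_borel_closed:
  assumes "heine_borel L" "\<And>n. s n \<in> L" "(\<lambda>n. absv (s n - l)) \<longlonglongrightarrow> 0"
  shows "l \<in> L"
proof -
  obtain R where "\<And>n. absv (s n) \<le> R" using absv_lim_bounded[OF assms(3)] by blast
  then obtain l' r where l': "l' \<in> L" "strict_mono r" "(\<lambda>n. absv (s (r n) - l')) \<longlonglongrightarrow> 0"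
    using heine_borelE[OF assms(1), of s R] assms(2) by blast
  have "l' = l" using absv_lim_unique[OF l'(3) absv_lim_subseq[OF assms(3) l'(2)]] .
  thus ?thesis using l' by simp
qed

lemma lim_inverse_nat: "(\<And>n. absv (s n - l) < inverse (Suc n)) \<Longrightarrow> (\<lambda>n. absv (s n - l)) \<longlonglongrightarrow> 0"
  by (rule Lim_null_comparison[OF _ LIMSEQ_inverse_real_of_nat]) (auto intro!: always_eventually less_imp_le)

lemma heine_borel_closed':
  assumes "heine_borel L" "\<And>e. 0 < e \<Longrightarrow> \<exists>y\<in>L. absv (y - l) < e"
  shows "l \<in> L"
proof -
  have "\<exists>y\<in>L. absv (y - l) < inverse (Suc n)" for n
    using assms(2)[of "inverse (Suc n)"] by simp
  then obtain s where "\<And>n. s n \<in> L \<and> absv (s n - l) < inverse (Suc n)" by metis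
  thus ?thesis using heine_borel_closed[OF assms(1), of s l] lim_inverse_nat by metis
qed

lemma cpt_heine_borel:
  assumes "heine_borel L" "X \<subseteq> L" "\<And>x. x \<in> X \<Longrightarrow> absv x \<le> R"
    and cl: "\<And>l. l \<in> L \<Longrightarrow> l \<notin> X \<Longrightarrow> \<exists>e>0. \<forall>y\<in>X. e \<le> absv (y - l)"
  shows "cpt X"
  unfolding cpt_def
proof (intro allI impI)
  fix s :: "nat \<Rightarrow> 'a" assume s: "range s \<subseteq> X"
  hence "\<forall>n. s n \<in> L \<and> absv (s n) \<le> R" using assms by blast
  then obtain l r where l: "l \<in> L" "strict_mono r" "(\<lambda>n. absv (s (r n) - l)) \<longlonglongrightarrow> 0"
    using heine_borelE[OF assms(1), of s R] by blast
  have "l \<in> X"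
  proof (rule ccontr)
    assume "l \<notin> X"
    then obtain e where e: "e > 0" "\<forall>y\<in>X. e \<le> absv (y - l)" using cl l by blast
    have "\<forall>\<^sub>F n in sequentially. absv (s (r n) - l) < e"
      using l(3) e(1) by (auto simp: order_tendsto_iff)
    then obtain n where "absv (s (r n) - l) < e" by (auto simp: eventually_sequentially)
    thus False using e s by (meson not_less range_subsetD)
  qed
  thus "\<exists>l\<in>X. \<exists>r. strict_mono r \<and> (\<lambda>n. absv (s (r n) - l)) \<longlonglongrightarrow> 0" using l by blast
qed

section \<open>Spans over a locally compact subfield\<close>

definition fspan :: "'a set \<Rightarrow> 'a set \<Rightarrow> 'a set" where
  "fspan F B = {x. \<exists>c. (\<forall>b\<in>B. c b \<in> F) \<and> x = (\<Sum>b\<in>B. c b * b)}"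

lemma fspanI: "(\<And>b. b \<in> B \<Longrightarrow> c b \<in> F) \<Longrightarrow> x = (\<Sum>b\<in>B. c b * b) \<Longrightarrow> x \<in> fspan F B"
  unfolding fspan_def by blast

lemma fspanE:
  assumes "x \<in> fspan F B"
  obtains c where "\<And>b. b \<in> B \<Longrightarrow> c b \<in> F" "x = (\<Sum>b\<in>B. c b * b)"
  using assms unfolding fspan_def by blast

lemma fspan_insert:
  assumes "finite B" "b \<notin> B"
  shows "fspan F (insert b B) = {v + c * b |v c. v \<in> fspan F B \<and> c \<in> F}" (is "_ = ?R")
proof (intro equalityI subsetI)
  fix x assume "x \<in> fspan F (insert b B)"
  then obtain c where c: "\<And>b'. b' \<in> insert b B \<Longrightarrow> c b' \<in> F" "x = (\<Sum>b\<in>insert b B. c b * b)"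
    by (rule fspanE) blast
  have "x = (\<Sum>b\<in>B. c b * b) + c b * b" using c(2) assms by (simp add: add.commute)
  moreover have "(\<Sum>b\<in>B. c b * b) \<in> fspan F B" using c(1) by (intro fspanI[of _ c]) auto
  moreover have "c b \<in> F" using c(1) by simp
  ultimately show "x \<in> ?R" by blast
next
  fix x assume "x \<in> ?R"
  then obtain v d where v: "v \<in> fspan F B" "d \<in> F" "x = v + d * b" by blast
  from v(1) obtain c where c: "\<And>b. b \<in> B \<Longrightarrow> c b \<in> F" "v = (\<Sum>b\<in>B. c b * b)"
    by (rule fspanE) blast
  have "(\<Sum>b'\<in>B. (c(b := d)) b' * b') = (\<Sum>b\<in>B. c b * b)"
    using assms by (intro sum.cong) auto
  hence "x = (\<Sum>b'\<in>insert b B. (c(b := d)) b' * b')"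
    using assms v(3) c(2) by (simp add: add.commute)
  thus "x \<in> fspan F (insert b B)"
    using c(1) v(2) by (intro fspanI[of _ "c(b := d)"]) auto
qed

lemma fspan_smult:
  assumes "is_subfield F" "c \<in> F" "v \<in> fspan F B"
  shows "c * v \<in> fspan F B"
proof -
  from assms(3) obtain a where a: "\<And>b. b \<in> B \<Longrightarrow> a b \<in> F" "v = (\<Sum>b\<in>B. a b * b)"
    by (rule fspanE) blast
  have "c * v = (\<Sum>b\<in>B. (c * a b) * b)" by (simp add: a(2) sum_distrib_left mult.assoc)
  thus ?thesis using a(1) assms(1,2) by (intro fspanI[of _ "\<lambda>b. c * a b"]) (auto simp: is_subfield_def)
qed

lemma fspan_add:
  assumes "is_subfield F" "v \<in> fspan F B" "w \<in> fspan F B"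
  shows "v + w \<in> fspan F B"
proof -
  from assms(2) obtain a where a: "\<And>b. b \<in> B \<Longrightarrow> a b \<in> F" "v = (\<Sum>b\<in>B. a b * b)"
    by (rule fspanE) blast
  from assms(3) obtain c where c: "\<And>b. b \<in> B \<Longrightarrow> c b \<in> F" "w = (\<Sum>b\<in>B. c b * b)"
    by (rule fspanE) blast
  have "v + w = (\<Sum>b\<in>B. (a b + c b) * b)" by (simp add: a(2) c(2) sum.distrib distrib_right)
  thus ?thesis using a(1) c(1) assms(1) by (intro fspanI[of _ "\<lambda>b. a b + c b"]) (auto simp: is_subfield_def)
qed

lemma fspan_0: "is_subfield F \<Longrightarrow> 0 \<in> fspan F B"
  by (intro fspanI[of _ "\<lambda>_. 0"]) (auto simp: is_subfield_def)

lemma fspan_sum: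
  "is_subfield F \<Longrightarrow> (\<And>i. i \<in> I \<Longrightarrow> g i \<in> fspan F B) \<Longrightarrow> sum g I \<in> fspan F B"
  by (induction I rule: infinite_finite_induct) (auto simp: fspan_0 fspan_add)

text \<open>Induction on the generators. A new \<open>b\<close> outside the closed span of the
  others has a positive distance \<open>e\<close> from it. Dividing \<open>v + c * b\<close> by
  \<open>c\<close> then bounds \<open>c\<close> by the size of the whole vector over
  \<open>e\<close>, so both parts are bounded separately and have convergent subsequences.\<close>

lemma heine_borel_fspan:
  assumes F: "is_subfield F" "heine_borel F" and B: "finite B"
  shows "heine_borel (fspan F B)"
  using B
proof (induction B rule: finite_induct)
  case empty
  have "fspan F {} = {0}" by (auto simp: fspan_def)
  moreover have "heine_borel {0}" unfolding heine_borel_def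
  proof (intro allI impI bexI exI conjI)
    show "strict_mono (id :: nat \<Rightarrow> nat)" by (simp add: strict_mono_def)
  qed auto
  ultimately show ?case by simp
next
  case (insert b B)
  let ?V = "fspan F B"
  note V' = fspan_insert[OF insert.hyps, of F]
  have smult: "c * v \<in> ?V" if "c \<in> F" "v \<in> ?V" for c v
    using fspan_smult[OF F(1) that] .
  show ?case
  proof (cases "b \<in> ?V")
    case True
    have "v + c * b \<in> ?V" if "c \<in> F" "v \<in> ?V" for c v
      using fspan_add[OF F(1) that(2) smult[OF that(1) True]] .
    hence "fspan F (insert b B) \<subseteq> ?V" unfolding V' by auto
    moreover have "v \<in> fspan F (insert b B)" if "v \<in> ?V" for v
    proof -
      have "v = v + 0 * b" "0 \<in> F" using F(1) by (auto simp: is_subfield_def)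
      thus ?thesis unfolding V' using that by blast
    qed
    ultimately have "fspan F (insert b B) = ?V" by blast
    thus ?thesis using insert.IH by simp
  next
    case False
    then obtain e where e: "e > 0" "\<And>y. y \<in> ?V \<Longrightarrow> e \<le> absv (y - b)"
      using heine_borel_closed'[OF insert.IH, of b] by (meson not_less)
    show ?thesis unfolding heine_borel_def
    proof (intro allI impI)
      fix s R assume s: "\<forall>n::nat. s n \<in> fspan F (insert b B) \<and> absv (s n) \<le> R"
      hence "\<forall>n. \<exists>v c. v \<in> ?V \<and> c \<in> F \<and> s n = v + c * b" unfolding V' by blast
      then obtain v c where vc: "\<And>n. v n \<in> ?V" "\<And>n. c n \<in> F" "\<And>n. s n = v n + c n * b" by metis
      have cb: "absv (c n) \<le> R / e" for n
      proof (cases "c n = 0")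
        case True
        have "0 \<le> R" using s absv_nonneg order_trans by blast
        thus ?thesis using True e by simp
      next
        case False
        have "- inverse (c n) * v n \<in> ?V"
          using smult[OF _ vc(1)[of n], of "- inverse (c n)"] vc(2)[of n] F(1) False
          by (auto simp: is_subfield_def)
        hence "e \<le> absv (- inverse (c n) * v n - b)" using e by blast
        also have "- inverse (c n) * v n - b = - (inverse (c n) * s n)"
          using False vc(3)[of n] by (simp add: field_simps)
        also have "absv \<dots> = absv (s n) / absv (c n)" by (simp add: absv_mult field_simps)
        finally have "e * absv (c n) \<le> absv (s n)" using False by (simp add: field_simps)
        thus ?thesis using s e by (smt (verit) mult.commute pos_le_divide_eq)
      qed
      then obtain d r where d: "d \<in> F" "strict_mono r" "(\<lambda>n. absv (c (r n) - d)) \<longlonglongrightarrow> 0"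
        using heine_borelE[OF F(2), of c "R / e"] vc(2) by blast
      have vb: "absv (v n) \<le> max R (R / e * absv b)" for n
      proof -
        have "absv (v n) \<le> max (absv (s n)) (absv (c n * b))"
          using absv_diff[of "s n" "c n * b"] vc(3)[of n] by simp
        moreover have "absv (c n * b) \<le> R / e * absv b"
          unfolding absv_mult by (rule mult_right_mono[OF cb absv_nonneg])
        ultimately show ?thesis using s by (smt (verit))
      qed
      then obtain w r' where w: "w \<in> ?V" "strict_mono r'" "(\<lambda>n. absv (v (r (r' n)) - w)) \<longlonglongrightarrow> 0"
        using heine_borelE[OF insert.IH, of "\<lambda>n. v (r n)" "max R (R / e * absv b)"] vb vc(1) by blast
      have c': "(\<lambda>n. absv (c (r (r' n)) - d)) \<longlonglongrightarrow> 0"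
        using absv_lim_subseq[OF d(3) w(2)] .
      have "(\<lambda>n. absv (s ((r \<circ> r') n) - (w + d * b))) \<longlonglongrightarrow> 0"
      proof (rule Lim_null_comparison)
        show "(\<lambda>n. absv (v (r (r' n)) - w) + absv (c (r (r' n)) - d) * absv b) \<longlonglongrightarrow> 0"
          using tendsto_add[OF w(3) tendsto_mult_left_zero[OF c', of "absv b"]] by simp
        show "\<forall>\<^sub>F n in sequentially. norm (absv (s ((r \<circ> r') n) - (w + d * b)))
                \<le> absv (v (r (r' n)) - w) + absv (c (r (r' n)) - d) * absv b"
        proof (intro always_eventually allI)
          fix n
          have "s ((r \<circ> r') n) - (w + d * b) = (v (r (r' n)) - w) + (c (r (r' n)) - d) * b"
            using vc(3) by (simp add: algebra_simps)
          hence "absv (s ((r \<circ> r') n) - (w + d * b)) \<le> max (absv (v (r (r' n)) - w)) (absv ((c (r (r' n)) - d) * b))"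
            using absv_add by metis
          also have "\<dots> \<le> absv (v (r (r' n)) - w) + absv ((c (r (r' n)) - d) * b)" by simp
          finally show "norm (absv (s ((r \<circ> r') n) - (w + d * b)))
                \<le> absv (v (r (r' n)) - w) + absv (c (r (r' n)) - d) * absv b"
            by (simp add: absv_mult)
        qed
      qed
      moreover have "w + d * b \<in> fspan F (insert b B)" unfolding V' using w d by blast
      ultimately show "\<exists>l\<in>fspan F (insert b B). \<exists>r. strict_mono r \<and> (\<lambda>n. absv (s (r n) - l)) \<longlonglongrightarrow> 0"
        using strict_mono_o[OF d(2) w(2)] by blast
    qed
  qed
qed

lemma heine_borel_finite_ext:
  assumes "heine_borel F" "finite_ext F L"
  shows "heine_borel L"
proof -
  obtain B where B: "finite B" "B \<subseteq> L" "\<And>x. x \<in> L \<Longrightarrow> \<exists>c. (\<forall>b\<in>B. c b \<in> F) \<and> x = (\<Sum>b\<in>B. c b * b)"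
    using assms(2) unfolding finite_ext_def by blast
  have "fspan F B \<subseteq> L"
    unfolding fspan_def using assms(2) B(2)
    by (auto simp: finite_ext_def intro!: subfield_sum) (metis is_subfield_def subsetD)
  hence "L = fspan F B" using B(3) unfolding fspan_def by blast
  thus ?thesis using heine_borel_fspan[of F B] assms B by (simp add: finite_ext_def)
qed

end

subsection \<open>Finite extensions\<close>

lemma exists_powi_between:
  fixes p y :: real
  assumes "1 < p" "0 < y"
  obtains k :: int where "1 / p < y * p powi k" "y * p powi k \<le> 1"
proof -
  define k where "k = \<lfloor>- log p y\<rfloor>"
  have "p powr (real_of_int k) \<le> p powr (- log p y)"
    using assms by (simp add: k_def)
  hence 1: "p powi k \<le> 1 / y" using assms by (simp add: powr_minus powr_real_of_int' field_simps)
  have "p powr (- log p y) < p powr (real_of_int k + 1)"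
    using assms unfolding k_def by (intro powr_less_mono) linarith+
  hence "1 / y < p powi k * p" using assms by (simp add: powr_minus powr_real_of_int' field_simps powr_add)
  thus ?thesis using 1 assms that[of k] by (simp add: field_simps)
qed

definition over :: "'a::field set \<Rightarrow> 'a poly \<Rightarrow> bool" where
  "over L q \<longleftrightarrow> (\<forall>i. coeff q i \<in> L)"

lemma subfield_simps:
  assumes "is_subfield L"
  shows "0 \<in> L" "1 \<in> L" "x \<in> L \<Longrightarrow> y \<in> L \<Longrightarrow> x + y \<in> L" "x \<in> L \<Longrightarrow> y \<in> L \<Longrightarrow> x - y \<in> L"
    "x \<in> L \<Longrightarrow> y \<in> L \<Longrightarrow> x * y \<in> L" "x \<in> L \<Longrightarrow> - x \<in> L" "x \<in> L \<Longrightarrow> inverse x \<in> L"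
    "x \<in> L \<Longrightarrow> y \<in> L \<Longrightarrow> x / y \<in> L" "x \<in> L \<Longrightarrow> x ^ n \<in> L"
proof -
  note L = assms[unfolded is_subfield_def]
  show *: "0 \<in> L" "1 \<in> L" "x \<in> L \<Longrightarrow> y \<in> L \<Longrightarrow> x + y \<in> L" "x \<in> L \<Longrightarrow> y \<in> L \<Longrightarrow> x - y \<in> L"
    "x \<in> L \<Longrightarrow> y \<in> L \<Longrightarrow> x * y \<in> L" for x y using L by auto
  show "x \<in> L \<Longrightarrow> - x \<in> L" using *(4)[of 0 x] *(1) by simp
  show inv: "x \<in> L \<Longrightarrow> inverse x \<in> L" for x using L by (cases "x = 0") auto
  show "x \<in> L \<Longrightarrow> y \<in> L \<Longrightarrow> x / y \<in> L" using inv *(5) by (simp add: divide_inverse)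
  show "x \<in> L \<Longrightarrow> x ^ n \<in> L" by (induction n) (auto simp: *)
qed

lemma subfield_of_nat: "is_subfield L \<Longrightarrow> of_nat n \<in> L"
  by (induction n) (auto simp: subfield_simps)

lemma over_poly:
  assumes "is_subfield L" "over L q" "x \<in> L"
  shows "poly q x \<in> L"
  using assms unfolding poly_altdef over_def by (auto intro!: subfield_sum simp: subfield_simps)

lemma over_simps:
  assumes "is_subfield L"
  shows "over L 0" "c \<in> L \<Longrightarrow> over L [:c:]" "over L q \<Longrightarrow> c \<in> L \<Longrightarrow> over L (pCons c q)"
    "over L q \<Longrightarrow> over L r \<Longrightarrow> over L (q + r)" "over L q \<Longrightarrow> over L r \<Longrightarrow> over L (q - r)"
    "over L q \<Longrightarrow> over L r \<Longrightarrow> over L (q * r)" "over L q \<Longrightarrow> c \<in> L \<Longrightarrow> over L (smult c q)"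
    "c \<in> L \<Longrightarrow> over L (monom c n)" "over L q \<Longrightarrow> over L (pderiv q)"
  using assms unfolding over_def
  by (auto simp: subfield_simps coeff_pCons coeff_mult coeff_pderiv subfield_of_nat
           intro!: subfield_sum split: nat.split simp del: of_nat_Suc)

lemma over_pcompose:
  assumes "is_subfield L" "over L q" "over L r"
  shows "over L (pcompose q r)"
  using assms(2)
proof (induction q)
  case (pCons a q)
  have "a \<in> L" using pCons.prems by (auto simp: over_def dest: spec[of _ 0])
  moreover have "over L q" unfolding over_def
  proof
    fix i show "coeff q i \<in> L" using pCons.prems[unfolded over_def, rule_format, of "Suc i"] by simp
  qed
  ultimately show ?case using pCons.IH assms by (simp add: pcompose_pCons over_simps)
qed (use assms in \<open>auto simp: over_simps\<close>)

text \<open>Long division only ever divides by the leading coefficient of \<open>h\<close>, so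
  quotient and remainder keep their coefficients in the subfield.\<close>

lemma over_divide:
  assumes L: "is_subfield L" and h: "over L h" "h \<noteq> 0" and m: "over L m"
  shows "\<exists>q r. over L q \<and> over L r \<and> m = q * h + r \<and> (r = 0 \<or> degree r < degree h)"
  using m
proof (induction "degree m" arbitrary: m rule: less_induct)
  case less
  show ?case
  proof (cases "m = 0 \<or> degree m < degree h")
    case True
    thus ?thesis using less.prems L by (intro exI[of _ 0] exI[of _ m]) (auto simp: over_simps)
  next
    case False
    define c where "c = monom (lead_coeff m / lead_coeff h) (degree m - degree h)"
    have c: "over L c" unfolding c_def using less.prems h L by (auto simp: over_def[of L m] over_def[of L h] over_simps subfield_simps)
    have m': "over L (m - c * h)" using c h less.prems L by (simp add: over_simps)
    show ?thesis
    proof (cases "m - c * h = 0")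
      case True
      thus ?thesis using c L by (intro exI[of _ c] exI[of _ 0]) (auto simp: over_simps)
    next
      case neq: False
      have c0: "c \<noteq> 0" using False h by (simp add: c_def monom_eq_0_iff)
      have dc: "degree (c * h) = degree m"
        using False h c0 by (subst degree_mult_eq) (auto simp: c_def degree_monom_eq)
      have lc: "coeff (c * h) (degree m) = lead_coeff m"
        using dc lead_coeff_mult[of c h] lead_coeff_monom[of "lead_coeff m / lead_coeff h"] h(2)
        by (simp add: c_def degree_monom_eq)
      show ?thesis
      proof (cases "degree h = 0")
        case True
        then obtain d where d: "h = [:d:]" using degree_eq_zeroE by blast
        have "d \<noteq> 0" "d \<in> L" using h d by (auto simp: over_def dest: spec[of _ 0])
        thus ?thesis using d less.prems L
          by (intro exI[of _ "smult (inverse d) m"] exI[of _ 0]) (auto simp: over_simps subfield_simps)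
      next
        case dh: False
        have "degree (m - c * h) \<noteq> degree m"
        proof
          assume "degree (m - c * h) = degree m"
          hence "lead_coeff (m - c * h) = coeff m (degree m) - coeff (c * h) (degree m)" by simp
          hence "lead_coeff (m - c * h) = 0" using lc by simp
          thus False using neq by (simp only: leading_coeff_0_iff)
        qed
        hence "degree (m - c * h) < degree m"
          using degree_diff_le[of m "degree m" "c * h"] dc by simp
        from less.hyps[OF this m'] obtain q r where
          qr: "over L q" "over L r" "m - c * h = q * h + r" "r = 0 \<or> degree r < degree h" by blast
        have "m = (q + c) * h + r" using qr(3) by (simp add: algebra_simps)
        thus ?thesis using qr c L by (intro exI[of _ "q + c"] exI[of _ r]) (auto simp: over_simps)
      qed
    qed
  qed
qed

lemma (in nonarch) fspan_base: 
  assumes "is_subfield F" "finite B" "b \<in> B" shows "b \<in> fspan F B"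
proof (rule fspanI[of _ "\<lambda>x. if x = b then 1 else 0"])
  have "(\<Sum>x\<in>B. (if x = b then 1 else 0) * x) = (\<Sum>x\<in>B. if x = b then b else 0)"
    by (intro sum.cong) auto
  thus "b = (\<Sum>x\<in>B. (if x = b then 1 else 0) * x)" using assms by simp
qed (use assms in \<open>auto simp: subfield_simps\<close>)

lemma (in nonarch) finite_ext_iff:
  "finite_ext (F :: 'a set) L \<longleftrightarrow> is_subfield F \<and> is_subfield L \<and> F \<subseteq> L \<and> (\<exists>B. finite B \<and> B \<subseteq> L \<and> L \<subseteq> fspan F B)"
  unfolding finite_ext_def fspan_def by blast

lemma (in nonarch) finite_ext_trans:
  assumes "finite_ext (F :: 'a set) L" "finite_ext L M"
  shows "finite_ext F M"
proof -
  obtain B where B: "finite B" "B \<subseteq> L" "L \<subseteq> fspan F B" using assms(1) unfolding finite_ext_iff by blast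
  obtain C where C: "finite C" "C \<subseteq> M" "M \<subseteq> fspan L C" using assms(2) unfolding finite_ext_iff by blast
  have sf: "is_subfield F" "is_subfield L" "is_subfield M" "F \<subseteq> L" "L \<subseteq> M"
    using assms unfolding finite_ext_iff by auto
  define D where "D = (\<lambda>(b, c). b * c) ` (B \<times> C)"
  have D: "finite D" "D \<subseteq> M" unfolding D_def using B C sf by (auto intro!: subfield_simps(5))
  have bc: "b * c \<in> D" if "b \<in> B" "c \<in> C" for b c
    unfolding D_def using that by force
  have "x \<in> fspan F D" if x: "x \<in> M" for x
  proof -
    from x C(3) have "x \<in> fspan L C" by blast
    then obtain a where a: "\<And>c. c \<in> C \<Longrightarrow> a c \<in> L" "x = (\<Sum>c\<in>C. a c * c)" by (rule fspanE) blast
    have "a c * c \<in> fspan F D" if c: "c \<in> C" for c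
    proof -
      from a(1)[OF c] B(3) have "a c \<in> fspan F B" by blast
      then obtain e where e: "\<And>b. b \<in> B \<Longrightarrow> e b \<in> F" "a c = (\<Sum>b\<in>B. e b * b)" by (rule fspanE) blast
      have "a c * c = (\<Sum>b\<in>B. e b * (b * c))" by (simp add: e(2) sum_distrib_right mult.assoc)
      also have "\<dots> \<in> fspan F D"
        using e(1) bc[OF _ c] D(1) sf(1) by (intro fspan_sum fspan_smult fspan_base) auto
      finally show ?thesis .
    qed
    thus ?thesis unfolding a(2) by (intro fspan_sum sf)
  qed
  thus ?thesis unfolding finite_ext_iff using D sf by blast
qed

lemma (in nonarch) finite_ext_refl:
  assumes "is_subfield (F :: 'a set)"
  shows "finite_ext F F"
  unfolding finite_ext_iff
proof (intro conjI exI[of _ "{1}"] subsetI)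
  fix x assume "x \<in> F"
  thus "x \<in> fspan F {1}" using assms fspan_smult[of F x 1 "{1}"] fspan_base[of F "{1}" 1] by simp
qed (use assms in \<open>auto simp: subfield_simps\<close>)

text \<open>A polynomial \<open>m\<close> of least degree vanishing at \<open>x\<close> serves as
  minimal polynomial. Inverses come from a Euclidean descent: \<open>m = q * h + r\<close> gives
  \<open>poly r x = - poly q x * poly h x\<close>, so an inverse of \<open>poly r x\<close> yields
  one of \<open>poly h x\<close>.\<close>

lemma (in nonarch) finite_ext_adjoin:
  assumes L: "is_subfield (L :: 'a set)" and m: "over L m0" "m0 \<noteq> 0" "poly m0 x = 0"
  obtains M where "finite_ext L M" "x \<in> M"
proof -
  define S where "S = {m. over L m \<and> m \<noteq> 0 \<and> poly m x = 0}"
  have "m0 \<in> S" using m by (simp add: S_def)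
  then obtain m where m: "m \<in> S" and min: "\<And>q. q \<in> S \<Longrightarrow> degree m \<le> degree q"
    using arg_min_natI[of "\<lambda>m. m \<in> S" m0 degree] arg_min_nat_le[of "\<lambda>m. m \<in> S" _ degree] by blast
  have mS: "over L m" "m \<noteq> 0" "poly m x = 0" using m by (auto simp: S_def)
  define M where "M = {poly h x |h. over L h}"
  have red: "\<exists>r. over L r \<and> poly h x = poly r x \<and> (r = 0 \<or> degree r < degree m)" if h: "over L h" for h
  proof -
    obtain q r where "over L q" "over L r" "h = q * m + r" "r = 0 \<or> degree r < degree m"
      using over_divide[OF L mS(1,2) h] by blast
    thus ?thesis using mS(3) by (intro exI[of _ r]) auto
  qed
  have inv: "\<exists>g. over L g \<and> poly g x * poly h x = 1" if "over L h" "poly h x \<noteq> 0" "degree h < degree m" for h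
    using that
  proof (induction "degree h" arbitrary: h rule: less_induct)
    case less
    have "h \<noteq> 0" using less.prems by auto
    then obtain q r where qr: "over L q" "over L r" "m = q * h + r" "r = 0 \<or> degree r < degree h"
      using over_divide[OF L less.prems(1) _ mS(1)] by blast
    have eq: "poly r x = - poly q x * poly h x"
      using mS(3) unfolding qr(3) by (simp add: add_eq_0_iff)
    show ?case
    proof (cases "poly r x = 0")
      case True
      hence qx: "poly q x = 0" using eq less.prems(2) by simp
      show ?thesis
      proof (cases "degree h = 0")
        case True
        then obtain d where d: "h = [:d:]" using degree_eq_zeroE by blast
        have "d \<noteq> 0" "d \<in> L" using less.prems d by (auto simp: over_def dest: spec[of _ 0])
        thus ?thesis using d L by (intro exI[of _ "[:inverse d:]"]) (auto simp: over_simps subfield_simps)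
      next
        \<comment> \<open>With \<open>h\<close> not constant, \<open>q\<close> would have smaller
          degree than \<open>m\<close>, so its vanishing at \<open>x\<close> contradicts
          minimality.\<close>
        case dh: False
        have "q \<noteq> 0"
        proof
          assume "q = 0"
          hence "m = r" using qr by simp
          thus False using qr(4) mS(2) less.prems(3) by auto
        qed
        hence le: "degree m \<le> degree q" using min qx qr(1) by (auto simp: S_def)
        have "degree (q * h) = degree q + degree h" using \<open>q \<noteq> 0\<close> \<open>h \<noteq> 0\<close> by (simp add: degree_mult_eq)
        hence "degree r < degree (q * h)" if "r \<noteq> 0" using that qr(4) dh by auto
        hence "degree m = degree (q * h)"
          unfolding qr(3) by (cases "r = 0") (auto simp: degree_add_eq_left)
        thus ?thesis using le dh \<open>degree (q * h) = _\<close> by simp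
      qed
    next
      case False
      hence "r \<noteq> 0" by auto
      hence "degree r < degree h" using qr by auto
      from less.hyps[OF this qr(2) False] this less.prems(3) obtain g
        where g: "over L g" "poly g x * poly r x = 1" by auto
      have "poly ((- g) * q) x * poly h x = 1" using g(2) eq by (simp add: algebra_simps)
      moreover have "over L (- g * q)"
        using over_simps(5)[OF L over_simps(1)[OF L] g(1)] qr(1) L over_simps(6)[OF L] by fastforce
      ultimately show ?thesis by blast
    qed
  qed
  have "0 \<in> M" unfolding M_def using L over_simps(1)[OF L] by (auto intro!: exI[of _ 0])
  have "is_subfield M" unfolding is_subfield_def
  proof (intro conjI ballI impI)
    show "0 \<in> M" by fact
    show "1 \<in> M" unfolding M_def using L by (auto intro!: exI[of _ "[:1:]"] simp: over_simps subfield_simps)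
    fix y assume "y \<in> M"
    then obtain h where h: "over L h" "y = poly h x" by (auto simp: M_def)
    { assume "y \<noteq> 0"
      obtain r where r: "over L r" "poly h x = poly r x" "r = 0 \<or> degree r < degree m" using red[OF h(1)] by blast
      have "poly r x \<noteq> 0" "degree r < degree m" using r h \<open>y \<noteq> 0\<close> by auto
      then obtain g where "over L g" "poly g x * poly r x = 1" using inv r(1) by blast
      moreover from this have "inverse y = poly g x"
        using r h by (metis inverse_unique mult.commute)
      ultimately show "inverse y \<in> M" by (auto simp: M_def) }
    fix z assume "z \<in> M"
    then obtain k where k: "over L k" "z = poly k x" by (auto simp: M_def)
    show "y + z \<in> M" unfolding M_def using h k L by (auto intro!: exI[of _ "h + k"] simp: over_simps)
    show "y - z \<in> M" unfolding M_def using h k L by (auto intro!: exI[of _ "h - k"] simp: over_simps)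
    show "y * z \<in> M" unfolding M_def using h k L by (auto intro!: exI[of _ "h * k"] simp: over_simps)
  qed
  moreover have "L \<subseteq> M"
  proof
    fix c assume "c \<in> L"
    thus "c \<in> M" unfolding M_def using L by (auto intro!: exI[of _ "[:c:]"] simp: over_simps)
  qed
  moreover have pw: "x ^ i \<in> M" for i
    unfolding M_def using L by (auto intro!: exI[of _ "monom 1 i"] simp: over_simps poly_monom subfield_simps)
  define B where "B = (\<lambda>i. x ^ i) ` {..degree m}"
  have "finite B" "B \<subseteq> M" unfolding B_def using pw by auto
  moreover have "M \<subseteq> fspan L B"
  proof
    fix y assume "y \<in> M"
    then obtain h where "over L h" "y = poly h x" by (auto simp: M_def)
    then obtain r where r: "over L r" "y = poly r x" "r = 0 \<or> degree r < degree m" using red by metis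
    have "y = (\<Sum>i\<le>degree r. coeff r i * x ^ i)" using r by (simp add: poly_altdef)
    also have "\<dots> \<in> fspan L B"
      using r L \<open>finite B\<close> by (intro fspan_sum fspan_smult fspan_base) (auto simp: over_def B_def)
    finally show "y \<in> fspan L B" .
  qed
  ultimately have "finite_ext L M" unfolding finite_ext_iff using L by blast
  thus ?thesis using that pw[of 1] by simp
qed

lemma (in nonarch) finite_ext_adjoin_set:
  assumes "finite C" "is_subfield (L :: 'a set)" and "\<And>x. x \<in> C \<Longrightarrow> \<exists>m. over L m \<and> m \<noteq> 0 \<and> poly m x = 0"
  shows "\<exists>M. finite_ext L M \<and> C \<subseteq> M"
  using assms(1,3)
proof (induction C rule: finite_induct)
  case empty
  show ?case using finite_ext_refl[OF assms(2)] by blast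
next
  case (insert x C)
  then obtain M where M: "finite_ext L M" "C \<subseteq> M" by auto
  obtain m where m: "over L m" "m \<noteq> 0" "poly m x = 0" using insert.prems by blast
  have "over M m" using m(1) M by (auto simp: over_def finite_ext_iff)
  then obtain M' where "finite_ext M M'" "x \<in> M'"
    using finite_ext_adjoin[of M m x] m M by (auto simp: finite_ext_iff)
  thus ?case using M finite_ext_trans by (meson finite_ext_iff insert_subset subset_trans)
qed

section \<open>The p-adic numbers: local compactness and value groups\<close>

locale Cp = nonarch absv for absv :: "'a::field_char_0 \<Rightarrow> real" +
  fixes p :: nat
  assumes prime_p: "prime p"
    and absv_p: "absv (of_nat p) = 1 / real p"
    and complete: "\<And>s::nat \<Rightarrow> 'a. (\<And>e. 0 < e \<Longrightarrow> \<exists>N. \<forall>m\<ge>N. \<forall>n\<ge>N. absv (s m - s n) < e)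
          \<Longrightarrow> \<exists>l. (\<lambda>n. absv (s n - l)) \<longlonglongrightarrow> 0"
    and alg_closed: "\<And>q::'a poly. 1 \<le> degree q \<Longrightarrow> \<exists>x. poly q x = 0"
begin

lemma p_gt_1: "1 < real p" using prime_gt_1_nat[OF prime_p] by simp

lemma of_nat_p_neq_0 [simp]: "(of_nat p :: 'a) \<noteq> 0" using prime_p by auto

lemma absv_coprime:
  assumes "coprime k (int p)"
  shows "absv (of_int k) = 1"
proof (rule antisym[OF absv_of_int_le], rule ccontr)
  assume "\<not> 1 \<le> absv (of_int k)"
  hence lt: "absv (of_int k) < 1" by simp
  obtain u v where "u * k + v * int p = 1"
    using bezout_int[of k "int p"] assms by auto
  hence "of_int u * of_int k + of_int v * of_nat p = (1::'a)"
    by (metis of_int_1 of_int_add of_int_mult of_int_of_nat_eq)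
  hence "1 \<le> max (absv (of_int u * of_int k)) (absv (of_int v * of_nat p))"
    by (metis absv_1 absv_add)
  moreover have "absv (of_int u * of_int k) < 1"
    using lt absv_of_int_le[of u] by (simp add: absv_mult) (meson absv_nonneg le_less_trans mult_left_le_one_le)
  moreover have "absv (of_int v * of_nat p) < 1"
    using p_gt_1 absv_of_int_le[of v] by (simp add: absv_mult absv_p divide_simps)
  ultimately show False by simp
qed

text \<open>The denominator \<open>b\<close> is prime to \<open>p\<close>, hence invertible modulo
  \<open>p ^ n\<close>; \<open>j\<close> is the residue of \<open>a\<close> times that inverse. This
  gives finite nets in the unit ball.\<close>

lemma rat_near_nat:
  assumes "absv (of_rat q) \<le> 1"
  shows "\<exists>j<p ^ n. absv (of_rat q - of_nat j) \<le> (1 / p) ^ n"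
proof -
  obtain a b where ab: "quotient_of q = (a, b)" by force
  have b: "b > 0" "coprime a b" and q: "q = of_int a / of_int b"
    using quotient_of_denom_pos[OF ab] quotient_of_coprime[OF ab] quotient_of_div[OF ab] by auto
  have oq: "of_rat q = (of_int a / of_int b :: 'a)" by (simp add: q of_rat_divide)
  have cop: "coprime b (int p)"
  proof (rule ccontr)
    assume "\<not> coprime b (int p)"
    hence "int p dvd b" using prime_p prime_imp_coprime_int[of "int p" b] by (auto simp: coprime_commute)
    hence "coprime a (int p)" using b(2) by (meson coprime_divisors dvd_refl)
    hence a1: "absv (of_int a) = 1" by (rule absv_coprime)
    obtain c where "b = int p * c" using \<open>int p dvd b\<close> by blast
    hence "absv (of_int b) = absv (of_int c) / p" by (simp add: absv_mult absv_p)
    also have "\<dots> \<le> 1 / p" using absv_of_int_le[of c] by (simp add: divide_right_mono)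
    also have "\<dots> < 1" using p_gt_1 by simp
    finally have "absv (of_int b) < 1" .
    moreover have "absv (of_int b) > 0" using b by simp
    ultimately show False using assms by (simp add: oq a1 field_simps)
  qed
  hence b1: "absv (of_int b) = 1" by (rule absv_coprime)
  have "coprime b (int p ^ n)" using cop by simp
  then obtain u v where uv: "u * b + v * int p ^ n = 1"
    using bezout_int[of b "int p ^ n"] by auto
  define j where "j = nat ((a * u) mod int p ^ n)"
  have pp: "int p ^ n > 0" using prime_gt_0_nat[OF prime_p] by simp
  have j: "int j = (a * u) mod int p ^ n" using pp by (simp add: j_def)
  have "int j < int p ^ n" unfolding j using pp by simp
  hence jl: "j < p ^ n" by (metis of_nat_less_iff of_nat_power)
  have "a * u = int j + int p ^ n * (a * u div int p ^ n)" unfolding j by simp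
  hence "a - b * int j = int p ^ n * (a * v + b * (a * u div int p ^ n))"
  proof -
    assume *: "a * u = int j + int p ^ n * (a * u div int p ^ n)"
    have "a = a * (u * b + v * int p ^ n)" using uv by simp
    also have "\<dots> = b * (a * u) + a * v * int p ^ n" by (simp add: algebra_simps)
    also have "\<dots> = b * (int j + int p ^ n * (a * u div int p ^ n)) + a * v * int p ^ n" using * by simp
    finally show ?thesis by (simp add: algebra_simps)
  qed
  hence "of_int (a - b * int j) = (of_int (int p ^ n * (a * v + b * (a * u div int p ^ n))) :: 'a)" by simp
  hence eq: "absv (of_int (a - b * int j)) = (1 / p) ^ n * absv (of_int (a * v + b * (a * u div int p ^ n)))"
    by (simp only: of_int_mult of_int_power of_int_of_nat_eq absv_mult absv_power absv_p)
  have "absv (of_int (a - b * int j)) \<le> (1 / p) ^ n"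
    unfolding eq by (intro mult_left_le absv_of_int_le) auto
  moreover have "of_rat q - of_nat j = (of_int (a - b * int j) / of_int b :: 'a)"
    using b by (simp add: oq field_simps)
  ultimately show ?thesis using jl b1 by (intro exI[of _ j]) auto
qed

lemma Qp_mult_p: "x \<in> Qp_in absv \<Longrightarrow> x * of_nat p ^ k \<in> Qp_in absv"
  unfolding Qp_in_def
proof clarify
  fix e :: real assume x: "\<forall>e>0. \<exists>q. absv (x - of_rat q) < e" "0 < e"
  then obtain q where q: "absv (x - of_rat q) < e" by blast
  have "x * of_nat p ^ k - of_rat (q * of_nat p ^ k) = (x - of_rat q) * of_nat p ^ k"
    by (simp add: of_rat_mult of_rat_power algebra_simps)
  moreover have "absv (of_nat p ^ k) \<le> 1" using p_gt_1 by (simp add: absv_p power_le_one)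
  ultimately have "absv (x * of_nat p ^ k - of_rat (q * of_nat p ^ k)) \<le> absv (x - of_rat q)"
    unfolding absv_mult by (simp add: mult_left_le absv_mult del: absv_power)
  thus "\<exists>q. absv (x * of_nat p ^ k - of_rat q) < e" using q by (meson le_less_trans)
qed

lemma Qp_closed:
  assumes "\<And>n. s n \<in> Qp_in absv" "(\<lambda>n. absv (s n - l)) \<longlonglongrightarrow> 0"
  shows "l \<in> Qp_in absv"
  unfolding Qp_in_def
proof clarify
  fix e :: real assume e: "0 < e"
  have "\<forall>\<^sub>F n in sequentially. absv (s n - l) < e"
    using assms(2) e by (auto simp: order_tendsto_iff)
  then obtain n where n: "absv (s n - l) < e" by (auto simp: eventually_sequentially)
  moreover obtain q where "absv (s n - of_rat q) < e" using assms(1)[of n] e unfolding Qp_in_def by blast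
  ultimately have "absv (l - of_rat q) < e" using absv_ultra_less[of l "s n" e "of_rat q"] by (simp add: absv_commute)
  thus "\<exists>q. absv (l - of_rat q) < e" by blast
qed

text \<open>The unit ball is totally bounded by \<open>rat_near_nat\<close>, so sequences in it have
  Cauchy subsequences, which converge by completeness; multiplication by a power of \<open>p\<close>
  moves any bounded sequence into the unit ball.\<close>

lemma heine_borel_Qp: "heine_borel (Qp_in absv)"
proof -
  define Z where "Z = {x \<in> Qp_in absv. absv x \<le> 1}"
  have tb: "M.mtotally_bounded Z"
    unfolding M.mtotally_bounded_def
  proof (intro allI impI)
    fix e :: real assume e: "0 < e"
    obtain n where n: "(1 / p) ^ n < e" using real_arch_pow_inv[of e "1 / p"] e p_gt_1 by auto
    define T where "T = (of_nat :: nat \<Rightarrow> 'a) ` {..<p ^ n}"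
    have "of_nat j \<in> Qp_in absv" for j
    proof -
      have "absv (of_nat j - of_rat (of_nat j)) = 0" by simp
      thus ?thesis unfolding Qp_in_def by (smt (verit) mem_Collect_eq)
    qed
    hence "T \<subseteq> Z" unfolding T_def Z_def using absv_of_nat_le by auto
    moreover have "\<exists>t\<in>T. absv (t - x) < e" if "x \<in> Z" for x
    proof -
      have "0 < min ((1 / p) ^ n) 1" using p_gt_1 by simp
      then obtain q where q: "absv (x - of_rat q) < min ((1 / p) ^ n) 1"
        using \<open>x \<in> Z\<close> unfolding Z_def Qp_in_def by blast
      have "absv (of_rat q) \<le> 1"
        using absv_diff[of x "x - of_rat q"] q that by (auto simp: Z_def)
      then obtain j where j: "j < p ^ n" "absv (of_rat q - of_nat j) \<le> (1 / p) ^ n"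
        using rat_near_nat by blast
      have "absv (x - of_nat j) \<le> (1 / p) ^ n"
        using absv_ultra[of x "of_nat j" "of_rat q"] q j(2) by (smt (verit))
      thus ?thesis using j(1) n by (auto simp: T_def absv_commute intro!: bexI[of _ j])
    qed
    ultimately show "\<exists>T. finite T \<and> T \<subseteq> Z \<and> Z \<subseteq> (\<Union>x\<in>T. M.mball x e)"
      by (intro exI[of _ T]) (auto simp: T_def)
  qed
  show ?thesis unfolding heine_borel_def
  proof (intro allI impI)
    fix s R assume s: "\<forall>n::nat. s n \<in> Qp_in absv \<and> absv (s n) \<le> R"
    obtain k where k: "R < real p ^ k" using real_arch_pow[of "real p" R] p_gt_1 by blast
    define t where "t n = s n * of_nat p ^ k" for n
    have "t n \<in> Z" for n
    proof -
      have "absv (t n) = absv (s n) / real p ^ k" by (simp add: t_def absv_mult absv_p power_divide)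
      also have "\<dots> \<le> 1" using s[rule_format, of n] k p_gt_1 by (simp add: divide_le_eq_1)
      finally show ?thesis using s Qp_mult_p by (simp add: Z_def t_def)
    qed
    then obtain r where r: "strict_mono r" "M.MCauchy (t \<circ> r)"
      using tb unfolding M.mtotally_bounded_sequentially by blast
    have "\<exists>l. (\<lambda>n. absv ((t \<circ> r) n - l)) \<longlonglongrightarrow> 0"
      using r(2) unfolding M.MCauchy_def by (intro complete) metis
    then obtain l where l: "(\<lambda>n. absv (t (r n) - l)) \<longlonglongrightarrow> 0" by auto
    have "(\<lambda>n. absv (t (r n) - l) * real p ^ k) \<longlonglongrightarrow> 0"
      using tendsto_mult_left_zero[OF l] by simp
    moreover have "absv (s (r n) - l / of_nat p ^ k) = absv (t (r n) - l) * real p ^ k" for n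
    proof -
      have "s (r n) - l / of_nat p ^ k = (t (r n) - l) / of_nat p ^ k"
        using p_gt_1 by (simp add: t_def diff_divide_distrib)
      thus ?thesis by (simp add: absv_p power_divide)
    qed
    ultimately have lim: "(\<lambda>n. absv (s (r n) - l / of_nat p ^ k)) \<longlonglongrightarrow> 0" by simp
    moreover have "l / of_nat p ^ k \<in> Qp_in absv" using s by (intro Qp_closed[OF _ lim]) auto
    ultimately show "\<exists>l\<in>Qp_in absv. \<exists>r. strict_mono r \<and> (\<lambda>n. absv (s (r n) - l)) \<longlonglongrightarrow> 0"
      using r(1) by blast
  qed
qed

text \<open>Discreteness of the value group, read off from local compactness.\<close>
lemma heine_borel_values:
  assumes "heine_borel L" "is_subfield L"
  obtains E :: nat where "0 < E" "\<And>x. x \<in> L \<Longrightarrow> x \<noteq> 0 \<Longrightarrow> \<exists>k::int. absv x ^ E = real p powi k"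
proof -
  define X where "X = {x \<in> L. 1 / p < absv x \<and> absv x \<le> 1}"
  have pp: "0 < 1 / real p" using p_gt_1 by simp
  have "cpt X"
  proof (rule cpt_heine_borel[OF assms(1), of X 1])
    fix l assume l: "l \<in> L" "l \<notin> X"
    show "\<exists>e>0. \<forall>y\<in>X. e \<le> absv (y - l)"
    proof (cases "l = 0")
      case True
      thus ?thesis using pp by (intro exI[of _ "1 / p"]) (auto simp: X_def)
    next
      case False
      have "absv l \<le> absv (y - l)" if "y \<in> X" for y
        using that l absv_eq_if_close[of y l] by (force simp: X_def)
      thus ?thesis using False by (intro exI[of _ "absv l"]) auto
    qed
  qed (auto simp: X_def)
  moreover have "\<And>x. x \<in> X \<Longrightarrow> 0 < absv x" by (auto simp: X_def intro: less_trans[OF pp])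
  \<comment> \<open>Every point within \<open>absv x\<close> of \<open>x\<close> has the absolute
    value of \<open>x\<close>, so a finite subcover leaves only finitely many values in the interval
    from 1/p to 1.\<close>
  ultimately obtain T where T: "finite T" "T \<subseteq> X" "\<And>y. y \<in> X \<Longrightarrow> \<exists>x\<in>T. absv (y - x) < absv x"
    using cpt_cover[of X absv] by metis
  have sub: "absv ` X \<subseteq> absv ` T" using T(3) absv_eq_if_close by blast
  define n where "n = card (absv ` T)"
  show ?thesis
  \<comment> \<open>Normalised powers of \<open>x\<close> take at most \<open>n\<close> values, so
    two exponents \<open>i < j\<close> up to \<open>n\<close> collide and
    \<open>absv x ^ (j - i)\<close> is a power of \<open>p\<close>; the factorial is a common
    multiple of all possible differences.\<close>
  proof (rule that[of "fact n"])
    fix x assume x: "x \<in> L" "x \<noteq> 0"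
    have "\<exists>k::int. 1 / p < absv x ^ i * real p powi k \<and> absv x ^ i * real p powi k \<le> 1" for i
      using exists_powi_between[OF p_gt_1, of "absv x ^ i"] x by (metis absv_pos zero_less_power)
    then obtain k where k: "\<And>i. 1 / p < absv x ^ i * real p powi k i \<and> absv x ^ i * real p powi k i \<le> 1" by metis
    define g where "g i = absv x ^ i * real p powi k i" for i
    have pw: "\<exists>u\<in>L. absv u = real p powi j" for j :: int
    proof (cases "0 \<le> j")
      case True
      have "absv (inverse (of_nat p ^ nat j)) = real p powi j"
        using True by (simp add: absv_p power_int_def power_divide)
      thus ?thesis using assms(2) by (meson subfield_simps subfield_of_nat)
    next
      case False
      have "absv (of_nat p ^ nat (- j)) = real p powi j"
        using False by (simp add: absv_p power_int_def power_divide inverse_eq_divide)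
      thus ?thesis using assms(2) by (meson subfield_simps subfield_of_nat)
    qed
    have gX: "g i \<in> absv ` X" for i
    proof -
      obtain u where u: "u \<in> L" "absv u = real p powi k i" using pw by blast
      have "x ^ i * u \<in> X" using u x k[of i] assms(2) by (auto simp: X_def absv_mult subfield_simps)
      moreover have "absv (x ^ i * u) = g i" by (simp add: g_def absv_mult u)
      ultimately show ?thesis by force
    qed
    have "\<not> inj_on g {..n}"
    proof
      assume "inj_on g {..n}"
      moreover have "g ` {..n} \<subseteq> absv ` T" using gX sub by blast
      ultimately have "card {..n} \<le> n" unfolding n_def using T(1) by (meson card_inj_on_le finite_imageI)
      thus False by simp
    qed
    then obtain i j where ij: "i < j" "j \<le> n" "g i = g j"
      unfolding inj_on_def by (metis atMost_iff nat_neq_iff)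
    have px: "absv x > 0" "real p > 0" using x p_gt_1 by auto
    have "absv x ^ j = absv x ^ (j - i) * absv x ^ i" using ij by (simp flip: power_add)
    hence "absv x ^ (j - i) * real p powi k j = real p powi k i"
      using ij(3) px unfolding g_def by simp
    hence "absv x ^ (j - i) = real p powi (k i - k j)"
      using px by (simp add: power_int_diff field_simps)
    moreover have "(j - i) dvd fact n" using ij by (intro dvd_fact) auto
    then obtain c where "fact n = (j - i) * c" by blast
    ultimately have "absv x ^ fact n = real p powi ((k i - k j) * int c)"
      by (simp add: power_mult power_int_mult)
    thus "\<exists>k::int. absv x ^ fact n = real p powi k" by blast
  qed (simp add: fact_gt_zero)
qed

end

subsection \<open>Local behaviour of a rational map\<close>

context nonarch
begin

lemma absv_leI: "absv x \<le> M \<Longrightarrow> absv y \<le> M \<Longrightarrow> absv (x + y) \<le> M"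
  using absv_add[of x y] by simp

lemma poly_bounded: "\<exists>M\<ge>0. \<forall>z. absv z \<le> R \<longrightarrow> absv (poly q z) \<le> M"
proof (induction q)
  case (pCons a q)
  then obtain M where M: "M \<ge> 0" "\<forall>z. absv z \<le> R \<longrightarrow> absv (poly q z) \<le> M" by blast
  show ?case
  proof (intro exI[of _ "max (absv a) (max R 0 * M)"] conjI allI impI)
    fix z assume z: "absv z \<le> R"
    have "absv (z * poly q z) \<le> max R 0 * M"
      unfolding absv_mult using z M by (intro mult_mono) auto
    thus "absv (poly (pCons a q) z) \<le> max (absv a) (max R 0 * M)"
      using absv_add[of a "z * poly q z"] by simp
  qed (simp add: M le_max_iff_disj)
qed (intro exI[of _ 0], auto)

lemma poly_lipschitz:
  "\<exists>H\<ge>0. \<forall>z z'. absv z \<le> R \<longrightarrow> absv z' \<le> R \<longrightarrow> absv (poly q z - poly q z') \<le> H * absv (z - z')"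
proof (induction q)
  case (pCons a q)
  then obtain H where H: "H \<ge> 0" "\<forall>z z'. absv z \<le> R \<longrightarrow> absv z' \<le> R \<longrightarrow> absv (poly q z - poly q z') \<le> H * absv (z - z')"
    by blast
  obtain M where M: "M \<ge> 0" "\<forall>z. absv z \<le> R \<longrightarrow> absv (poly q z) \<le> M" using poly_bounded by blast
  show ?case
  proof (intro exI[of _ "max M (max R 0 * H)"] conjI allI impI)
    fix z z' assume z: "absv z \<le> R" "absv z' \<le> R"
    have eq: "poly (pCons a q) z - poly (pCons a q) z' = (z - z') * poly q z + z' * (poly q z - poly q z')"
      by (simp add: algebra_simps)
    have "absv ((z - z') * poly q z) \<le> max M (max R 0 * H) * absv (z - z')"
      using M z unfolding absv_mult by (subst mult.commute) (intro mult_mono, auto simp: le_max_iff_disj)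
    moreover have "absv (z' * (poly q z - poly q z')) \<le> max M (max R 0 * H) * absv (z - z')"
    proof -
      have "absv z' * absv (poly q z - poly q z') \<le> max R 0 * (H * absv (z - z'))"
        using z H by (intro mult_mono) auto
      also have "\<dots> \<le> max M (max R 0 * H) * absv (z - z')"
        by (simp add: mult.assoc[symmetric] mult_right_mono)
      finally show ?thesis unfolding absv_mult .
    qed
    ultimately show "absv (poly (pCons a q) z - poly (pCons a q) z') \<le> max M (max R 0 * H) * absv (z - z')"
      unfolding eq by (rule absv_leI)
  qed (simp add: M le_max_iff_disj)
qed (intro exI[of _ 0], auto)

lemma absv_power_diff:
  assumes "absv x \<le> r" "absv y \<le> r"
  shows "absv (x ^ Suc n - y ^ Suc n) \<le> r ^ n * absv (x - y)"
proof (induction n)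
  case (Suc n)
  have r: "0 \<le> r" using assms absv_nonneg order_trans by blast
  have eq: "x ^ Suc (Suc n) - y ^ Suc (Suc n) = x * (x ^ Suc n - y ^ Suc n) + y ^ Suc n * (x - y)"
    by (simp add: algebra_simps)
  have "absv (x * (x ^ Suc n - y ^ Suc n)) \<le> r * (r ^ n * absv (x - y))"
    unfolding absv_mult using assms Suc r by (intro mult_mono) auto
  moreover have "absv (y ^ Suc n * (x - y)) \<le> r ^ Suc n * absv (x - y)"
    unfolding absv_mult absv_power using assms by (intro mult_right_mono power_mono) auto
  ultimately show ?case unfolding eq by (intro absv_leI) (simp_all add: mult.assoc)
qed simp

text \<open>Linearisation of the power map at \<open>y\<close>. The error is measured against
  \<open>absv y ^ n\<close> and not against the derivative, so it is small relative to the
  derivative only if \<open>k\<close> is below the absolute value of \<open>Suc n\<close>, which may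
  itself be less than 1. The radii in \<open>local_mono\<close> come from here.\<close>

lemma absv_power_diff_linear:
  assumes "absv (x - y) \<le> k * absv y" "absv (x' - y) \<le> k * absv y" "0 \<le> k" "k < 1"
  shows "absv (x ^ Suc n - x' ^ Suc n - of_nat (Suc n) * y ^ n * (x - x')) \<le> k * absv y ^ n * absv (x - x')"
proof (cases "y = 0")
  case True
  hence "x = 0" "x' = 0" using assms by auto
  thus ?thesis by simp
next
  case y: False
  have k: "k * absv y < absv y" using assms y by simp
  have ax: "absv x = absv y" "absv x' = absv y"
    using k assms absv_eq_if_close le_less_trans by blast+
  show ?thesis
  proof (induction n)
    case (Suc n)
    have eq: "x ^ Suc (Suc n) - x' ^ Suc (Suc n) - of_nat (Suc (Suc n)) * y ^ Suc n * (x - x')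
       = x * (x ^ Suc n - x' ^ Suc n - of_nat (Suc n) * y ^ n * (x - x'))
         + (of_nat (Suc n) * y ^ n * (x - y) * (x - x') + (x' ^ Suc n - y ^ Suc n) * (x - x'))"
      by (simp add: algebra_simps)
    have 1: "absv (x * (x ^ Suc n - x' ^ Suc n - of_nat (Suc n) * y ^ n * (x - x'))) \<le> k * absv y ^ Suc n * absv (x - x')"
      using mult_left_mono[OF Suc absv_nonneg[of x]] by (simp only: absv_mult ax power_Suc) (simp add: mult_ac)
    have "absv (of_nat (Suc n) * y ^ n * (x - y) * (x - x')) \<le> 1 * absv y ^ n * (k * absv y) * absv (x - x')"
      unfolding absv_mult absv_power using assms by (intro mult_mono absv_of_nat_le) auto
    hence 2: "absv (of_nat (Suc n) * y ^ n * (x - y) * (x - x')) \<le> k * absv y ^ Suc n * absv (x - x')"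
      by (simp add: mult_ac)
    have "absv (x' ^ Suc n - y ^ Suc n) \<le> absv y ^ n * absv (x' - y)"
      using ax by (intro absv_power_diff) auto
    also have "\<dots> \<le> absv y ^ n * (k * absv y)" using assms by (intro mult_left_mono) auto
    finally have "absv ((x' ^ Suc n - y ^ Suc n) * (x - x')) \<le> absv y ^ n * (k * absv y) * absv (x - x')"
      unfolding absv_mult by (rule mult_right_mono) simp
    hence 3: "absv ((x' ^ Suc n - y ^ Suc n) * (x - x')) \<le> k * absv y ^ Suc n * absv (x - x')"
      by (simp add: mult_ac)
    show ?case unfolding eq by (intro absv_leI 1 2 3)
  qed (use assms in simp)
qed

text \<open>Completeness of a subset. It holds for the whole field and for every locally compact
  subfield, so the Newton iteration in \<open>lin_surj\<close> can be run in either.\<close>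

definition cauchy_closed :: "'a set \<Rightarrow> bool" where
  "cauchy_closed L \<longleftrightarrow> (\<forall>s. (\<forall>n. s n \<in> L) \<longrightarrow> (\<forall>e>0. \<exists>N. \<forall>m\<ge>N. \<forall>n\<ge>N. absv (s m - s n) < e)
     \<longrightarrow> (\<exists>l\<in>L. (\<lambda>n. absv (s n - l)) \<longlonglongrightarrow> 0))"

end

locale rat_map = Cp absv p for absv :: "'a::field_char_0 \<Rightarrow> real" and p +
  fixes P Q :: "'a poly"
  assumes Q_neq_0: "Q \<noteq> 0" and coprime_PQ: "coprime P Q" and deg_ge_2: "2 \<le> rat_deg P Q"
begin

lemma exists_close: "0 < e \<Longrightarrow> \<exists>k. absv (of_nat p ^ k) < e"
  using real_arch_pow_inv[of e "1 / p"] p_gt_1 by (auto simp: absv_p)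

lemma cauchy_closed_UNIV: "cauchy_closed UNIV"
  unfolding cauchy_closed_def using complete by simp

lemma cauchy_closed_heine_borel:
  assumes "heine_borel L" shows "cauchy_closed L"
  unfolding cauchy_closed_def
proof (intro allI impI)
  fix s :: "nat \<Rightarrow> 'a" assume s: "\<forall>n. s n \<in> L" "\<forall>e>0. \<exists>N. \<forall>m\<ge>N. \<forall>n\<ge>N. absv (s m - s n) < e"
  obtain l where l: "(\<lambda>n. absv (s n - l)) \<longlonglongrightarrow> 0" using complete[of s] s by blast
  thus "\<exists>l\<in>L. (\<lambda>n. absv (s n - l)) \<longlonglongrightarrow> 0" using heine_borel_closed[OF assms _ l] s by blast
qed

text \<open>At a pole this is the default value 0 of division and not the point at infinity;
  agreement with \<open>rat_eval\<close> requires that \<open>Q\<close> not vanish along the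
  orbit.\<close>

definition f :: "'a \<Rightarrow> 'a" where "f x = poly P x / poly Q x"
definition df :: "'a \<Rightarrow> 'a" where "df x = rat_deriv P Q x"
text \<open>Local degree at \<open>w\<close>: the order to which the value \<open>f w\<close> is
  taken there, meaningful away from the poles.\<close>

definition mult :: "'a \<Rightarrow> nat" where "mult w = order w (P - smult (f w) Q)"

lemma fiber_neq_0: "P - smult c Q \<noteq> 0"
proof
  assume *: "P - smult c Q = 0"
  hence P: "P = smult c Q" by simp
  have "Q dvd P" unfolding P by (rule dvd_smult) simp
  hence "Q dvd 1" using coprime_PQ by (meson coprime_def dvd_refl)
  hence "degree Q = 0" using Q_neq_0 by (simp add: is_unit_iff_degree)
  moreover have "degree P \<le> degree Q" using * by (simp add: degree_smult_le)
  ultimately show False using deg_ge_2 by (simp add: rat_deg_def)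
qed

lemma mult_pos: "poly Q w \<noteq> 0 \<Longrightarrow> 0 < mult w"
  using order_root[of "P - smult (f w) Q" w] fiber_neq_0 by (simp add: mult_def f_def)

lemma rat_eval_Some [simp]: "poly Q x \<noteq> 0 \<Longrightarrow> rat_eval P Q (Some x) = Some (f x)"
  by (simp add: rat_eval_def f_def)

text \<open>The factor \<open>(z - w) ^ mult w\<close> is split off the numerator of
  \<open>f z - f w\<close>; the cofactor \<open>h\<close> is the remaining polynomial over
  \<open>Q\<close>, and it is Lipschitz because \<open>Q\<close> has constant absolute value on a
  small ball.\<close>

lemma local_form:
  assumes "poly Q w \<noteq> 0"
  obtains h \<delta> H where "0 < \<delta>" "\<delta> \<le> 1" "0 \<le> H" "h w \<noteq> 0"
    "\<And>z. absv (z - w) < \<delta> \<Longrightarrow> poly Q z \<noteq> 0"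
    "\<And>z. absv (z - w) < \<delta> \<Longrightarrow> f z = f w + (z - w) ^ mult w * h z"
    "\<And>z z'. absv (z - w) < \<delta> \<Longrightarrow> absv (z' - w) < \<delta> \<Longrightarrow> absv (h z - h z') \<le> H * absv (z - z')"
    "mult w = 1 \<Longrightarrow> df w = h w" "mult w \<noteq> 1 \<Longrightarrow> df w = 0"
proof -
  define p\<^sub>w where "p\<^sub>w = P - smult (f w) Q"
  have "p\<^sub>w \<noteq> 0" unfolding p\<^sub>w_def by (rule fiber_neq_0)
  then obtain q where q: "p\<^sub>w = [:- w, 1:] ^ mult w * q" "\<not> [:- w, 1:] dvd q"
    using order_decomp[of p\<^sub>w w] unfolding mult_def p\<^sub>w_def by blast
  have qw: "poly q w \<noteq> 0" using q(2) by (simp add: poly_eq_0_iff_dvd)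
  define h where "h z = poly q z / poly Q z" for z
  define R where "R = max (absv w) 1"
  obtain Hq where Hq: "Hq \<ge> 0" "\<And>z z'. absv z \<le> R \<Longrightarrow> absv z' \<le> R \<Longrightarrow> absv (poly q z - poly q z') \<le> Hq * absv (z - z')"
    using poly_lipschitz[of R q] by blast
  obtain HQ where HQ: "HQ \<ge> 0" "\<And>z z'. absv z \<le> R \<Longrightarrow> absv z' \<le> R \<Longrightarrow> absv (poly Q z - poly Q z') \<le> HQ * absv (z - z')"
    using poly_lipschitz[of R Q] by blast
  obtain Mq where Mq: "Mq \<ge> 0" "\<And>z. absv z \<le> R \<Longrightarrow> absv (poly q z) \<le> Mq"
    using poly_bounded[of R q] by blast
  define \<delta> where "\<delta> = min 1 (absv (poly Q w) / (HQ + 1))"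
  define H where "H = max (Hq / absv (poly Q w)) (Mq * HQ / absv (poly Q w) ^ 2)"
  have Qpos: "0 < absv (poly Q w)" using assms by simp
  have \<delta>: "0 < \<delta>" "\<delta> \<le> 1" using Qpos HQ by (auto simp: \<delta>_def)
  have zR: "absv z \<le> R" if "absv (z - w) < \<delta>" for z
    using absv_add[of "z - w" w] that \<delta> by (simp add: R_def)
  have Qz: "absv (poly Q z) = absv (poly Q w)" if z: "absv (z - w) < \<delta>" for z
  proof (rule absv_eq_if_close)
    have "absv (poly Q z - poly Q w) \<le> HQ * absv (z - w)"
      using HQ(2)[of z w] zR[OF z] by (simp add: R_def)
    also have "\<dots> \<le> HQ * (absv (poly Q w) / (HQ + 1))"
      using z HQ(1) by (intro mult_left_mono) (auto simp: \<delta>_def)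
    also have "\<dots> < absv (poly Q w)" using HQ(1) Qpos by (simp add: field_simps)
    finally show "absv (poly Q z - poly Q w) < absv (poly Q w)" .
  qed
  have Q0: "poly Q z \<noteq> 0" if "absv (z - w) < \<delta>" for z using Qz[OF that] assms by auto
  show ?thesis
  proof (rule that[of \<delta> H h])
    show "0 < \<delta>" "\<delta> \<le> 1" by fact+
    show "0 \<le> H" using Hq by (auto simp: H_def le_max_iff_disj)
    show "h w \<noteq> 0" using qw assms by (simp add: h_def)
    show "poly Q z \<noteq> 0" if "absv (z - w) < \<delta>" for z using Q0[OF that] .
    show "f z = f w + (z - w) ^ mult w * h z" if "absv (z - w) < \<delta>" for z
    proof -
      have "poly p\<^sub>w z = poly P z - f w * poly Q z" by (simp add: p\<^sub>w_def)
      moreover have "poly p\<^sub>w z = (z - w) ^ mult w * poly q z" unfolding q(1) by (simp add: poly_power)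
      ultimately show ?thesis using Q0[OF that] by (simp add: f_def[of z] h_def field_simps)
    qed
    show "absv (h z - h z') \<le> H * absv (z - z')" if z: "absv (z - w) < \<delta>" "absv (z' - w) < \<delta>" for z z'
    proof -
      have "a / b - c / d = (a - c) / b + c * (d - b) / (b * d)" if "b \<noteq> 0" "d \<noteq> 0" for a b c d :: 'a
        using that by (simp add: field_simps)
      from this[OF Q0[OF z(1)] Q0[OF z(2)]]
      have eq: "h z - h z' = (poly q z - poly q z') / poly Q z + poly q z' * (poly Q z' - poly Q z) / (poly Q z * poly Q z')"
        unfolding h_def .
      have 1: "absv ((poly q z - poly q z') / poly Q z) \<le> H * absv (z - z')"
      proof -
        have "absv ((poly q z - poly q z') / poly Q z) \<le> Hq * absv (z - z') / absv (poly Q w)"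
          using Hq(2)[OF zR zR] z Qpos by (simp add: Qz divide_right_mono)
        also have "\<dots> = Hq / absv (poly Q w) * absv (z - z')" by simp
        also have "\<dots> \<le> H * absv (z - z')" by (intro mult_right_mono) (auto simp: H_def)
        finally show ?thesis .
      qed
      have 2: "absv (poly q z' * (poly Q z' - poly Q z) / (poly Q z * poly Q z')) \<le> H * absv (z - z')"
      proof -
        have "absv (poly q z') * absv (poly Q z' - poly Q z) \<le> Mq * (HQ * absv (z - z'))"
          using HQ(2)[of z' z] Mq zR z by (intro mult_mono) (auto simp: absv_commute)
        hence "absv (poly q z' * (poly Q z' - poly Q z) / (poly Q z * poly Q z')) \<le> Mq * (HQ * absv (z - z')) / absv (poly Q w) ^ 2"
          using z Qpos by (simp add: absv_mult Qz power2_eq_square divide_right_mono)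
        also have "\<dots> = Mq * HQ / absv (poly Q w) ^ 2 * absv (z - z')" by simp
        also have "\<dots> \<le> H * absv (z - z')" by (intro mult_right_mono) (auto simp: H_def)
        finally show ?thesis .
      qed
      show ?thesis unfolding eq by (rule absv_leI[OF 1 2])
    qed
    have "a - c / b * d = (a * b - c * d) / b ^ 2 * b" if "b \<noteq> 0" for a b c d :: 'a
    proof -
      have "(a * b - c * d) / b ^ 2 * b = (a * b - c * d) / b"
        using that by (simp add: power2_eq_square)
      thus ?thesis using that by (simp add: diff_divide_distrib)
    qed
    from this[OF assms] have pd: "poly (pderiv p\<^sub>w) w = df w * poly Q w"
      by (simp add: p\<^sub>w_def pderiv_diff pderiv_smult df_def rat_deriv_def f_def)
    show "df w = h w" if "mult w = 1"
    proof -
      have "pderiv p\<^sub>w = [:- w, 1:] * pderiv q + q * pderiv [:- w, 1:]"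
        unfolding q(1) that by (simp only: power_one_right pderiv_mult)
      hence "poly (pderiv p\<^sub>w) w = poly q w" by (simp add: pderiv_pCons)
      thus ?thesis using pd assms by (simp add: h_def field_simps)
    qed
    show "df w = 0" if "mult w \<noteq> 1"
    proof -
      define n where "n = mult w - 2"
      have "mult w = Suc (Suc n)" using that mult_pos[OF assms] by (simp add: n_def)
      define r where "r = [:- w, 1:] ^ Suc n * q"
      have "p\<^sub>w = [:- w, 1:] * r"
        unfolding q(1) r_def \<open>mult w = _\<close> by (simp only: power_Suc mult.assoc)
      hence "pderiv p\<^sub>w = [:- w, 1:] * pderiv r + r * pderiv [:- w, 1:]"
        by (simp only: pderiv_mult)
      moreover have "poly r w = 0" unfolding r_def by (simp only: poly_mult poly_power) simp
      ultimately have "poly (pderiv p\<^sub>w) w = 0" by (simp only: poly_add poly_mult) simp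
      thus ?thesis using pd assms by simp
    qed
  qed
qed

text \<open>A relative error \<open>\<theta>\<close> below 1 against the affine map of slope
  \<open>df b\<close>. By the ultrametric inequality \<open>f\<close> then multiplies every distance
  in the ball by exactly \<open>absv (df b)\<close>; one \<open>\<theta>\<close> for the whole ball,
  and not merely a strict inequality for each pair, makes Newton iteration converge
  geometrically.\<close>

definition lin :: "'a \<Rightarrow> real \<Rightarrow> bool" where
  "lin b r \<longleftrightarrow> 0 < r \<and> df b \<noteq> 0 \<and> (\<exists>\<theta>. 0 \<le> \<theta> \<and> \<theta> < 1 \<and> (\<forall>z z'. absv (z - b) < r \<longrightarrow> absv (z' - b) < r \<longrightarrow>
     poly Q z \<noteq> 0 \<and> absv (f z - f z' - df b * (z - z')) \<le> \<theta> * absv (df b) * absv (z - z')))"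

text \<open>Any slope \<open>a\<close> will do: testing at \<open>b + x\<close> with
  \<open>x\<close> a high power of \<open>p\<close> shows that \<open>b\<close> has local degree 1
  and that \<open>df b\<close> lies within \<open>t * absv a\<close> of \<open>a\<close>, so that
  \<open>df b\<close> may replace \<open>a\<close>.\<close>

lemma lin_intro:
  assumes r: "0 < r" and a: "a \<noteq> 0" and \<theta>: "\<theta> < 1"
    and *: "\<And>z z'. absv (z - b) < r \<Longrightarrow> absv (z' - b) < r \<Longrightarrow>
       poly Q z \<noteq> 0 \<and> absv (f z - f z' - a * (z - z')) \<le> \<theta> * absv a * absv (z - z')"
  shows "lin b r" "absv (df b) = absv a"
proof -
  \<comment> \<open>Positive whatever \<open>\<theta>\<close> is, so that a small enough
    \<open>x\<close> satisfies \<open>H * absv x \<le> t * absv a\<close>.\<close>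
  define t where "t = max \<theta> (1 / 2)"
  have t: "0 < t" "t < 1" "\<theta> \<le> t" using \<theta> by (auto simp: t_def)
  have apos: "0 < absv a" using a by simp
  have "poly Q b \<noteq> 0" using *[of b b] r by simp
  then obtain h \<delta> H where h: "0 < \<delta>" "\<delta> \<le> 1" "0 \<le> H" "h b \<noteq> 0"
    "\<And>z. absv (z - b) < \<delta> \<Longrightarrow> f z = f b + (z - b) ^ mult b * h z"
    "\<And>z z'. absv (z - b) < \<delta> \<Longrightarrow> absv (z' - b) < \<delta> \<Longrightarrow> absv (h z - h z') \<le> H * absv (z - z')"
    "mult b = 1 \<Longrightarrow> df b = h b" "mult b \<noteq> 1 \<Longrightarrow> df b = 0"
    by (rule local_form) blast
  have mb: "0 < mult b" using mult_pos \<open>poly Q b \<noteq> 0\<close> by blast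
  \<comment> \<open>The bound containing \<open>1 - t\<close> excludes local degree at least 2, for
    which \<open>f (b + x) - f b\<close> would be quadratically small in \<open>x\<close>.\<close>
  define e where "e = min (min r \<delta>) (min (t * absv a / (H + 1)) ((1 - t) * absv a / (H + absv (h b) + 1)))"
  have hb0: "0 < H + absv (h b) + 1" "0 < H + 1" using h(3) absv_nonneg[of "h b"] by linarith+
  have "0 < e" using r h(1) t apos hb0 by (simp add: e_def)
  then obtain k where k: "absv (of_nat p ^ k) < e" using exists_close by blast
  define x where "x = (of_nat p :: 'a) ^ k"
  have x: "x \<noteq> 0" "0 < absv x" "absv x < r" "absv x < \<delta>" "absv x < t * absv a / (H + 1)" "absv x < (1 - t) * absv a / (H + absv (h b) + 1)"
    using k p_gt_1 by (auto simp: x_def e_def)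
  have eqx: "f (b + x) - f b = x ^ mult b * h (b + x)" using h(5)[of "b + x"] x by simp
  have hx: "absv (h (b + x) - h b) \<le> H * absv x" using h(6)[of "b + x" b] x h(1) by simp
  have "absv (f (b + x) - f b - a * x) \<le> \<theta> * absv a * absv x" using *[of "b + x" b] x r by simp
  also have "\<dots> \<le> t * absv a * absv x" using t by (intro mult_right_mono) auto
  finally have fx: "absv (f (b + x) - f b - a * x) \<le> t * absv a * absv x" .
  have m1: "mult b = 1"
  proof (rule ccontr)
    assume "mult b \<noteq> 1"
    define n where "n = mult b - 2"
    have n: "mult b = Suc (Suc n)" using mb \<open>mult b \<noteq> 1\<close> by (simp add: n_def)
    have "absv (f (b + x) - f b) = absv x * (absv x * absv x ^ n * absv (h (b + x)))"
      by (simp add: eqx n absv_mult)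
    also have "absv (h (b + x)) \<le> H + absv (h b)"
      using absv_add[of "h (b + x) - h b" "h b", unfolded diff_add_cancel] hx mult_left_mono[of "absv x" 1 H] x(4) h(2,3) absv_nonneg[of "h b"] by linarith
    hence "absv x * (absv x * absv x ^ n * absv (h (b + x))) \<le> absv x * (absv x * 1 * (H + absv (h b)))"
      using x h(2,3) by (intro mult_left_mono mult_mono power_le_one) auto
    also have "\<dots> \<le> absv x * (absv x * (H + absv (h b) + 1))" using x by (intro mult_left_mono) auto
    also have "\<dots> < absv x * ((1 - t) * absv a)"
    proof (rule mult_strict_left_mono)
      show "absv x * (H + absv (h b) + 1) < (1 - t) * absv a"
        using x(6) hb0 by (simp only: pos_less_divide_eq)
    qed (rule x)
    finally have "absv (f (b + x) - f b) < absv x * ((1 - t) * absv a)" .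
    moreover have "absv (a * x) \<le> max (absv (f (b + x) - f b)) (absv (f (b + x) - f b - a * x))"
      using absv_diff[of "f (b + x) - f b" "f (b + x) - f b - a * x"] by simp
    moreover have "t * absv a * absv x < absv a * absv x" "absv x * ((1 - t) * absv a) < absv a * absv x"
      using t x apos by (auto simp: algebra_simps)
    ultimately show False using fx by (simp add: absv_mult)
  qed
  have "f (b + x) - f b - a * x = x * (h (b + x) - a)" by (simp add: eqx m1 algebra_simps)
  hence "absv (h (b + x) - a) \<le> t * absv a" using fx x by (simp add: absv_mult)
  moreover have "H * absv x \<le> t * absv a"
  proof -
    have "H * absv x \<le> (H + 1) * absv x" using x by (intro mult_right_mono) auto
    also have "\<dots> \<le> t * absv a" using x hb0 by (simp add: field_simps)
    finally show ?thesis .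
  qed
  ultimately have dfa: "absv (df b - a) \<le> t * absv a"
    using absv_ultra[of "df b" a "h (b + x)"] hx h(7)[OF m1] by (simp add: absv_commute)
  also have "\<dots> < absv a" using t apos by simp
  finally show eq: "absv (df b) = absv a" by (rule absv_eq_if_close)
  show "lin b r" unfolding lin_def
  proof (intro conjI exI[of _ t] allI impI)
    show "df b \<noteq> 0" using eq a by (metis absv_eq_0)
    fix z z' assume z: "absv (z - b) < r" "absv (z' - b) < r"
    show "poly Q z \<noteq> 0" using *[OF z] by blast
    have "\<theta> * absv a * absv (z - z') \<le> t * absv a * absv (z - z')"
      using t by (intro mult_right_mono) auto
    hence 1: "absv (f z - f z' - a * (z - z')) \<le> t * absv a * absv (z - z')"
      using *[OF z] by linarith
    have 2: "absv ((a - df b) * (z - z')) \<le> t * absv a * absv (z - z')"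
      unfolding absv_mult using dfa by (intro mult_right_mono) (auto simp: absv_commute)
    have eq': "f z - f z' - df b * (z - z') = (f z - f z' - a * (z - z')) + (a - df b) * (z - z')"
      by (simp add: algebra_simps)
    show "absv (f z - f z' - df b * (z - z')) \<le> t * absv (df b) * absv (z - z')"
      unfolding eq' eq by (rule absv_leI[OF 1 2])
  qed (use t r in auto)
qed

text \<open>Every point of an ultrametric ball is a centre of it, and by \<open>lin_intro\<close>
  the old slope may serve at the new centre.\<close>

lemma lin_recenter:
  assumes "lin b r" "absv (z - b) < r" "0 < r'" "r' \<le> r"
  shows "lin z r'" "absv (df z) = absv (df b)"
proof -
  obtain \<theta> where t: "0 \<le> \<theta>" "\<theta> < 1" "\<And>z z'. absv (z - b) < r \<Longrightarrow> absv (z' - b) < r \<Longrightarrow>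
     poly Q z \<noteq> 0 \<and> absv (f z - f z' - df b * (z - z')) \<le> \<theta> * absv (df b) * absv (z - z')"
    using assms(1) unfolding lin_def by blast
  have in_ball: "absv (u - b) < r" if "absv (u - z) < r'" for u
    using absv_ultra_less[of u z r b] that assms by simp
  have "df b \<noteq> 0" using assms(1) by (simp add: lin_def)
  from lin_intro[OF assms(3) this t(2), of z] in_ball t(3)
  show "lin z r'" "absv (df z) = absv (df b)" by blast+
qed

lemma lin_shrink: "lin b r \<Longrightarrow> 0 < r' \<Longrightarrow> r' \<le> r \<Longrightarrow> lin b r'"
  using lin_recenter(1)[of b r b r'] by (simp add: lin_def)

lemma linD:
  assumes "lin b r"
  shows "0 < r" "0 < absv (df b)" "absv (z - b) < r \<Longrightarrow> poly Q z \<noteq> 0"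
  using assms unfolding lin_def by auto

lemma lin_isometry:
  assumes "lin b r" "absv (z - b) < r" "absv (z' - b) < r"
  shows "absv (f z - f z') = absv (df b) * absv (z - z')"
proof (cases "z = z'")
  case False
  obtain \<theta> where t: "0 \<le> \<theta>" "\<theta> < 1" "absv (f z - f z' - df b * (z - z')) \<le> \<theta> * absv (df b) * absv (z - z')"
    using assms unfolding lin_def by blast
  have "\<theta> * absv (df b) * absv (z - z') < 1 * absv (df b) * absv (z - z')"
    using False t linD(2)[OF assms(1)] by (intro mult_strict_right_mono) auto
  hence "absv (f z - f z' - df b * (z - z')) < absv (df b * (z - z'))"
    using t(3) by (simp add: absv_mult)
  from absv_eq_if_close[OF this] show ?thesis by (simp add: absv_mult)
qed auto

text \<open>Newton iteration with the fixed slope \<open>df b\<close>: each step multiplies the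
  defect by at most \<open>\<theta>\<close> and keeps the iterates within \<open>\<rho> < r\<close>
  of \<open>b\<close>. Slope and values lie in \<open>L\<close>, so the solution is found in
  \<open>L\<close> itself.\<close>

lemma lin_surj:
  assumes lin: "lin b r" and L: "is_subfield L" "cauchy_closed L" "over L P" "over L Q"
    and b: "b \<in> L" and y: "y \<in> L" "absv (y - f b) < absv (df b) * r"
  obtains z where "z \<in> L" "absv (z - b) < r" "f z = y"
proof -
  obtain \<theta> where t: "0 \<le> \<theta>" "\<theta> < 1" "\<And>z z'. absv (z - b) < r \<Longrightarrow> absv (z' - b) < r \<Longrightarrow>
     poly Q z \<noteq> 0 \<and> absv (f z - f z' - df b * (z - z')) \<le> \<theta> * absv (df b) * absv (z - z')"
    using lin unfolding lin_def by blast
  have d: "0 < absv (df b)" "0 < r" using linD[OF lin] by auto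
  have fL: "f z \<in> L" if "z \<in> L" for z
    using that L by (auto simp: f_def intro!: subfield_simps over_poly)
  have dL: "df b \<in> L"
    using b L by (auto simp: df_def rat_deriv_def intro!: subfield_simps over_poly over_simps)
  define \<rho> where "\<rho> = absv (y - f b) / absv (df b)"
  have \<rho>: "0 \<le> \<rho>" "\<rho> < r" using y d by (auto simp: \<rho>_def field_simps)
  define s where "s = rec_nat b (\<lambda>_ z. z - (f z - y) / df b)"
  have s0: "s 0 = b" and sS: "s (Suc n) = s n - (f (s n) - y) / df b" for n by (auto simp: s_def)
  have main: "s n \<in> L \<and> absv (s n - b) \<le> \<rho> \<and> absv (f (s n) - y) \<le> \<theta> ^ n * (absv (df b) * \<rho>)" for n
  proof (induction n)
    case 0
    thus ?case using b d \<rho> by (simp add: s0 \<rho>_def absv_commute)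
  next
    case (Suc n)
    have step: "absv (s (Suc n) - s n) \<le> \<theta> ^ n * \<rho>"
      using Suc d by (simp add: sS field_simps absv_commute[of y])
    have "\<theta> ^ n * \<rho> \<le> \<rho>" using t \<rho> by (simp add: mult_le_cancel_right1 power_le_one mult_left_le_one_le)
    hence inb: "absv (s (Suc n) - b) \<le> \<rho>"
      using absv_ultra[of "s (Suc n)" b "s n"] step Suc by linarith
    have "f (s (Suc n)) - y = f (s (Suc n)) - f (s n) - df b * (s (Suc n) - s n)"
      using d by (simp add: sS)
    moreover have "absv (f (s (Suc n)) - f (s n) - df b * (s (Suc n) - s n)) \<le> \<theta> * absv (df b) * absv (s (Suc n) - s n)"
      using t(3)[of "s (Suc n)" "s n"] Suc \<open>absv (s (Suc n) - b) \<le> \<rho>\<close> \<rho> by simp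
    ultimately have "absv (f (s (Suc n)) - y) \<le> \<theta> * absv (df b) * absv (s (Suc n) - s n)"
      by (simp only:)
    hence "absv (f (s (Suc n)) - y) \<le> \<theta> * absv (df b) * (\<theta> ^ n * \<rho>)"
      using step t(1) by (meson absv_nonneg mult_left_mono mult_nonneg_nonneg order_trans)
    moreover have "s (Suc n) \<in> L" using Suc fL dL y L unfolding sS by (auto intro!: subfield_simps)
    ultimately show ?case using inb by (simp add: mult_ac)
  qed
  have step: "absv (s (Suc n) - s n) \<le> \<theta> ^ n * \<rho>" for n
    using main[of n] d by (simp add: sS field_simps absv_commute[of y])
  have far: "absv (s (n + k) - s n) \<le> \<theta> ^ n * \<rho>" for n k
  proof (induction k)
    case (Suc k)
    have "\<theta> ^ (n + k) * \<rho> \<le> \<theta> ^ n * \<rho>"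
      using t \<rho> by (intro mult_right_mono power_decreasing) auto
    thus ?case using absv_ultra[of "s (n + Suc k)" "s n" "s (n + k)"] step[of "n + k"] Suc by simp
  qed (use t \<rho> in auto)
  have lim: "(\<lambda>n. \<theta> ^ n * c) \<longlonglongrightarrow> 0" for c
    using tendsto_mult_left_zero[OF LIMSEQ_realpow_zero[OF t(1,2)]] .
  have "\<exists>N. \<forall>m\<ge>N. \<forall>n\<ge>N. absv (s m - s n) < e" if e: "0 < e" for e
  proof -
    obtain N where N: "\<theta> ^ N * \<rho> < e"
      using lim[of \<rho>] e unfolding order_tendsto_iff eventually_sequentially by blast
    have "absv (s m - s N) < e" if "m \<ge> N" for m
      using far[of N "m - N"] that N by simp
    thus ?thesis using absv_ultra_less' by blast
  qed
  then obtain l where l: "l \<in> L" "(\<lambda>n. absv (s n - l)) \<longlonglongrightarrow> 0"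
    using L(2) main unfolding cauchy_closed_def by blast
  have near: "\<exists>n. absv (s n - l) < e \<and> \<theta> ^ n * c < e" if "0 < e" for e c
  proof -
    have "\<forall>\<^sub>F n in sequentially. absv (s n - l) < e" "\<forall>\<^sub>F n in sequentially. \<theta> ^ n * c < e"
      using l(2) lim[of c] that by (auto simp: order_tendsto_iff)
    hence "\<forall>\<^sub>F n in sequentially. absv (s n - l) < e \<and> \<theta> ^ n * c < e" by eventually_elim simp
    thus ?thesis by (auto simp: eventually_sequentially)
  qed
  have lb: "absv (l - b) < r"
  proof -
    obtain n where "absv (s n - l) < r" using near[OF d(2)] by blast
    thus ?thesis using main[of n] \<rho> absv_ultra_less[of l "s n" r b] by (simp add: absv_commute)
  qed
  have "f l = y"
  proof (rule ccontr)
    assume "f l \<noteq> y"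
    hence pos: "0 < absv (f l - y)" by simp
    define e where "e = min (absv (f l - y)) (absv (f l - y) / absv (df b))"
    have "0 < e" using pos d by (simp add: e_def)
    then obtain n where n: "absv (s n - l) < e" "\<theta> ^ n * (absv (df b) * \<rho>) < e" using near by blast
    have "absv (f (s n) - f l) = absv (df b) * absv (s n - l)"
      using lin_isometry[OF lin] main[of n] \<rho> lb by (simp add: le_less_trans)
    also have "\<dots> < absv (f l - y)" using n d by (simp add: e_def field_simps)
    finally have "absv (f l - f (s n)) < absv (f l - y)" by (simp add: absv_commute)
    moreover have "absv (f (s n) - y) < absv (f l - y)" using main[of n] n by (simp add: e_def)
    ultimately show False using absv_ultra_less by blast
  qed
  thus ?thesis using that l(1) lb by blast
qed

text \<open>Near \<open>w\<close> the difference \<open>f b - f w\<close> follows the monomial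
  \<open>a * (b - w) ^ mult w\<close>. The radius of linearity at \<open>b\<close> is proportional
  to the distance from \<open>w\<close>; its factor \<open>absv (of_nat (mult w)) / 2\<close> drops
  below 1/2 when \<open>p\<close> divides the local degree.\<close>

lemma local_mono:
  assumes "poly Q w \<noteq> 0"
  obtains a \<delta> H where "0 < \<delta>" "\<delta> \<le> 1" "a \<noteq> 0" "0 \<le> H"
    "\<And>b. absv (b - w) < \<delta> \<Longrightarrow> poly Q b \<noteq> 0"
    "\<And>b. absv (b - w) < \<delta> \<Longrightarrow> absv (f b - f w - a * (b - w) ^ mult w) \<le> H * absv (b - w) ^ Suc (mult w)"
    "\<And>b. absv (b - w) < \<delta> \<Longrightarrow> absv (f b - f w) = absv a * absv (b - w) ^ mult w"
    "\<And>b. b \<noteq> w \<Longrightarrow> absv (b - w) < \<delta> \<Longrightarrow> absv (df b) = absv (of_nat (mult w)) * absv a * absv (b - w) ^ (mult w - 1)"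
    "\<And>b. b \<noteq> w \<Longrightarrow> absv (b - w) < \<delta> \<Longrightarrow> lin b (absv (of_nat (mult w)) / 2 * absv (b - w))"
proof -
  obtain h \<delta>\<^sub>0 H where h: "0 < \<delta>\<^sub>0" "\<delta>\<^sub>0 \<le> 1" "0 \<le> H" "h w \<noteq> 0"
    "\<And>z. absv (z - w) < \<delta>\<^sub>0 \<Longrightarrow> poly Q z \<noteq> 0"
    "\<And>z. absv (z - w) < \<delta>\<^sub>0 \<Longrightarrow> f z = f w + (z - w) ^ mult w * h z"
    "\<And>z z'. absv (z - w) < \<delta>\<^sub>0 \<Longrightarrow> absv (z' - w) < \<delta>\<^sub>0 \<Longrightarrow> absv (h z - h z') \<le> H * absv (z - z')"
    "mult w = 1 \<Longrightarrow> df w = h w" "mult w \<noteq> 1 \<Longrightarrow> df w = 0"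
    by (rule local_form[OF assms], rule that; assumption)
  obtain n where n: "mult w = Suc n" using mult_pos[OF assms] gr0_conv_Suc by blast
  define a where "a = h w"
  define M where "M = absv (of_nat (mult w))"
  have M: "0 < M" "M \<le> 1" unfolding M_def using absv_of_nat_le n by (auto simp del: of_nat_Suc)
  have a: "a \<noteq> 0" "0 < absv a" using h by (auto simp: a_def)
  define \<delta> where "\<delta> = min \<delta>\<^sub>0 (absv a * M / (2 * (H + 1)))"
  have \<delta>: "0 < \<delta>" "\<delta> \<le> \<delta>\<^sub>0" using h a M by (auto simp: \<delta>_def)
  have Hb: "H * absv (b - w) \<le> absv a * M / 2" if "absv (b - w) < \<delta>" for b
  proof -
    have "H * absv (b - w) \<le> (H + 1) * (absv a * M / (2 * (H + 1)))"
      using that h(3) by (intro mult_mono) (auto simp: \<delta>_def)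
    also have "\<dots> = absv a * M / 2" using h(3) by (simp add: field_simps)
    finally show ?thesis .
  qed
  have ha: "absv (h b - a) \<le> H * absv (b - w)" if "absv (b - w) < \<delta>" for b
    using h(7)[of b w] that \<delta> h(1) by (simp add: a_def)
  have linb: "lin b (M / 2 * absv (b - w)) \<and> absv (df b) = M * absv a * absv (b - w) ^ (mult w - 1)"
    if b: "b \<noteq> w" "absv (b - w) < \<delta>" for b
  proof -
    define y where "y = b - w"
    have y: "0 < absv y" "absv y < \<delta>" using b by (auto simp: y_def)
    \<comment> \<open>The derivative at \<open>b\<close> of the model monomial.\<close>
    define a' where "a' = a * of_nat (Suc n) * y ^ n"
    have a': "a' \<noteq> 0" "absv a' = M * absv a * absv y ^ n"
      using a y by (auto simp: a'_def absv_mult M_def n simp del: of_nat_Suc)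
    have *: "poly Q z \<noteq> 0 \<and> absv (f z - f z' - a' * (z - z')) \<le> 1 / 2 * absv a' * absv (z - z')"
      if z: "absv (z - b) < M / 2 * absv y" "absv (z' - b) < M / 2 * absv y" for z z'
    proof -
      define x where "x = z - w"
      define x' where "x' = z' - w"
      have xy: "absv (x - y) \<le> M / 2 * absv y" "absv (x' - y) \<le> M / 2 * absv y"
        using z by (auto simp: x_def x'_def y_def)
      have "M / 2 * absv y < absv y" using M y by simp
      hence ax: "absv x = absv y" "absv x' = absv y"
        using xy absv_eq_if_close le_less_trans by blast+
      have zw: "absv (z - w) < \<delta>" "absv (z' - w) < \<delta>" using ax y by (auto simp: x_def x'_def)
      have zw0: "absv (z - w) < \<delta>\<^sub>0" "absv (z' - w) < \<delta>\<^sub>0" using zw \<delta> by auto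
      \<comment> \<open>Three errors: the deviation of \<open>h\<close> from \<open>a\<close>, the
        variation of \<open>h\<close> between the two points, and the nonlinearity of the power map.
        Each is at most half of \<open>absv a' * absv (z - z')\<close>.\<close>
      have eq: "f z - f z' - a' * (z - z') = (x ^ Suc n - x' ^ Suc n) * (h z - a) + (x' ^ Suc n * (h z - h z')
          + a * (x ^ Suc n - x' ^ Suc n - of_nat (Suc n) * y ^ n * (x - x')))"
        unfolding h(6)[OF zw0(1)] h(6)[OF zw0(2)] n a'_def by (simp add: x_def x'_def algebra_simps)
      have hz: "absv (h z - a) \<le> absv a * M / 2"
        using ha[OF zw(1)] Hb[OF zw(1)] by linarith
      have bd: "1 / 2 * absv a' * absv (z - z') = absv y ^ n * absv (x - x') * (absv a * M / 2)"
        by (simp add: a' x_def x'_def)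
      have "absv (x ^ Suc n - x' ^ Suc n) \<le> absv y ^ n * absv (x - x')"
        using ax by (intro absv_power_diff) auto
      hence 1: "absv ((x ^ Suc n - x' ^ Suc n) * (h z - a)) \<le> 1 / 2 * absv a' * absv (z - z')"
        unfolding bd absv_mult[of _ "h z - a"] using hz by (intro mult_mono) auto
      have "absv (x' ^ Suc n * (h z - h z')) \<le> absv y ^ Suc n * (H * absv (z - z'))"
        unfolding absv_mult absv_power ax using h(7)[OF zw0] by (intro mult_left_mono) auto
      also have "\<dots> = absv y ^ n * absv (x - x') * (H * absv (b - w))" by (simp add: x_def x'_def y_def)
      also have "\<dots> \<le> 1 / 2 * absv a' * absv (z - z')"
        unfolding bd using Hb[OF b(2)] by (intro mult_left_mono) auto
      finally have 2: "absv (x' ^ Suc n * (h z - h z')) \<le> 1 / 2 * absv a' * absv (z - z')" .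
      have "absv (x ^ Suc n - x' ^ Suc n - of_nat (Suc n) * y ^ n * (x - x')) \<le> M / 2 * absv y ^ n * absv (x - x')"
        using M by (intro absv_power_diff_linear xy) auto
      hence "absv (a * (x ^ Suc n - x' ^ Suc n - of_nat (Suc n) * y ^ n * (x - x'))) \<le> absv a * (M / 2 * absv y ^ n * absv (x - x'))"
        unfolding absv_mult[of a] by (intro mult_left_mono) auto
      hence 3: "absv (a * (x ^ Suc n - x' ^ Suc n - of_nat (Suc n) * y ^ n * (x - x'))) \<le> 1 / 2 * absv a' * absv (z - z')"
        unfolding bd by (simp add: mult_ac)
      show ?thesis using h(5)[OF zw0(1)] absv_leI[OF 1 absv_leI[OF 2 3]] unfolding eq by blast
    qed
    have "0 < M / 2 * absv y" using M y by simp
    from lin_intro[OF this a'(1) _ *] a'(2) n show ?thesis by (simp add: y_def)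
  qed
  show ?thesis
  proof (rule that[of \<delta> a H])
    show "0 < \<delta>" "\<delta> \<le> 1" "a \<noteq> 0" "0 \<le> H" using \<delta> h a by auto
    fix b assume b: "absv (b - w) < \<delta>"
    show "poly Q b \<noteq> 0" using b h(5) \<delta> by simp
    have fb: "f b - f w = (b - w) ^ mult w * h b" using h(6)[of b] less_le_trans[OF b \<delta>(2)] by simp
    have "f b - f w - a * (b - w) ^ mult w = (b - w) ^ mult w * (h b - a)"
      unfolding fb by (simp add: algebra_simps)
    hence "absv (f b - f w - a * (b - w) ^ mult w) = absv (b - w) ^ mult w * absv (h b - a)"
      by (simp add: absv_mult)
    also have "\<dots> \<le> absv (b - w) ^ mult w * (H * absv (b - w))"
      using ha[OF b] by (intro mult_left_mono) auto
    finally show "absv (f b - f w - a * (b - w) ^ mult w) \<le> H * absv (b - w) ^ Suc (mult w)"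
      by (simp add: mult_ac)
    have "absv a * M \<le> absv a * 1" using a M by (intro mult_left_mono) auto
    hence "absv a * M / 2 < absv a" using a(2) by simp
    hence "absv (h b - a) < absv a" using ha[OF b] Hb[OF b] by linarith
    hence "absv (h b) = absv a" by (rule absv_eq_if_close)
    thus "absv (f b - f w) = absv a * absv (b - w) ^ mult w" unfolding fb by (simp add: absv_mult)
  qed (use linb in \<open>auto simp: M_def\<close>)
qed

lemma mult_eq_1_iff:
  assumes "poly Q w \<noteq> 0"
  shows "mult w = 1 \<longleftrightarrow> df w \<noteq> 0"
  by (rule local_form[OF assms]) metis

lemma lin_noncritical:
  assumes "poly Q w \<noteq> 0" "df w \<noteq> 0"
  obtains r where "0 < r" "lin w r"
proof -
  obtain h \<delta> H where h: "0 < \<delta>" "\<delta> \<le> 1" "0 \<le> H" "h w \<noteq> 0"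
    "\<And>z. absv (z - w) < \<delta> \<Longrightarrow> poly Q z \<noteq> 0"
    "\<And>z. absv (z - w) < \<delta> \<Longrightarrow> f z = f w + (z - w) ^ mult w * h z"
    "\<And>z z'. absv (z - w) < \<delta> \<Longrightarrow> absv (z' - w) < \<delta> \<Longrightarrow> absv (h z - h z') \<le> H * absv (z - z')"
    "mult w = 1 \<Longrightarrow> df w = h w" "mult w \<noteq> 1 \<Longrightarrow> df w = 0"
    by (rule local_form[OF assms(1)], rule that; assumption)
  have m: "mult w = 1" using mult_eq_1_iff assms by blast
  define r where "r = min \<delta> (absv (h w) / (2 * (H + 1)))"
  have r: "0 < r" "r \<le> \<delta>" using h by (auto simp: r_def)
  have Hr: "H * c \<le> 1 / 2 * absv (h w)" if "c < r" "0 \<le> c" for c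
  proof -
    have "H * c \<le> (H + 1) * (absv (h w) / (2 * (H + 1)))"
      using that h(3) by (intro mult_mono) (auto simp: r_def)
    also have "\<dots> = 1 / 2 * absv (h w)" using h(3) by (simp add: field_simps)
    finally show ?thesis .
  qed
  have "lin w r"
  proof (rule lin_intro(1)[OF r(1) h(4), of "1 / 2"], goal_cases)
    case (2 z z')
    hence z: "absv (z - w) < \<delta>" "absv (z' - w) < \<delta>" using r by auto
    have eq: "f z - f z' - h w * (z - z') = (z - z') * (h z - h w) + (z' - w) * (h z - h z')"
      unfolding h(6)[OF z(1)] h(6)[OF z(2)] m by (simp add: algebra_simps)
    have 1: "absv ((z - z') * (h z - h w)) \<le> 1 / 2 * absv (h w) * absv (z - z')"
    proof -
      have "absv (h z - h w) \<le> 1 / 2 * absv (h w)"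
        using h(7)[OF z(1), of w] Hr[of "absv (z - w)"] h(1) 2 by simp
      hence "absv (z - z') * absv (h z - h w) \<le> absv (z - z') * (1 / 2 * absv (h w))"
        by (intro mult_left_mono) auto
      thus ?thesis unfolding absv_mult by (simp only: mult_ac)
    qed
    have 2: "absv ((z' - w) * (h z - h z')) \<le> 1 / 2 * absv (h w) * absv (z - z')"
    proof -
      have "absv ((z' - w) * (h z - h z')) \<le> absv (z' - w) * (H * absv (z - z'))"
        unfolding absv_mult using h(7)[OF z] by (intro mult_left_mono) auto
      also have "\<dots> = H * absv (z' - w) * absv (z - z')" by simp
      also have "\<dots> \<le> 1 / 2 * absv (h w) * absv (z - z')"
        using Hr[of "absv (z' - w)"] 2 by (intro mult_right_mono) auto
      finally show ?thesis .
    qed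
    show ?case unfolding eq using h(5)[OF z(1)] absv_leI[OF 1 2] by blast
  qed simp
  thus ?thesis using that r by blast
qed

end

subsection \<open>Fatou and Julia sets\<close>

context rat_map
begin

lemma chordal_le: "chordal absv (Some x) (Some y) \<le> absv (x - y)"
proof -
  have "1 * 1 \<le> max 1 (absv x) * max 1 (absv y)" by (intro mult_mono) auto
  hence "absv (x - y) / (max 1 (absv x) * max 1 (absv y)) \<le> absv (x - y) / 1"
    by (intro divide_left_mono) auto
  thus ?thesis by (simp add: chordal_def)
qed

text \<open>Below the chordal distance from \<open>x\<close> to infinity the chordal and the
  ordinary metric are comparable, with a factor depending only on \<open>absv x\<close>.\<close>

lemma chordal_small:
  assumes "chordal absv (Some x) z < c" "c \<le> 1 / max 1 (absv x)"
  obtains u where "z = Some u" "absv u \<le> max 1 (absv x)" "absv (x - u) < c * (max 1 (absv x))\<^sup>2"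
proof (cases z)
  case None
  thus ?thesis using assms by (simp add: chordal_def)
next
  case (Some u)
  define M where "M = max 1 (absv x)"
  have M: "1 \<le> M" "absv x \<le> M" by (auto simp: M_def)
  have ch: "absv (x - u) / (M * max 1 (absv u)) < c" using assms(1) Some by (simp add: chordal_def M_def)
  have le: "absv u \<le> M"
  proof (rule ccontr)
    assume "\<not> absv u \<le> M"
    hence u: "absv x < absv u" "1 < absv u" using M by auto
    have "absv (x - u) = absv u" using absv_add_eq[of x "- u"] u absv_add_eq[of "x" "-u"]
      by (metis absv_add_eq absv_minus add.commute diff_conv_add_uminus)
    hence "absv (x - u) / (M * max 1 (absv u)) = 1 / M" using u by auto
    thus False using ch assms(2) by (simp add: M_def)
  qed
  have "absv (x - u) < c * (M * max 1 (absv u))"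
  proof -
    have "0 < M * max 1 (absv u)" using M by simp
    thus ?thesis using ch by (simp only: pos_divide_less_eq)
  qed
  also have "\<dots> \<le> c * (M * M)"
  proof (intro mult_left_mono)
    have "0 \<le> absv (x - u) / (M * max 1 (absv u))" using M by simp
    thus "0 \<le> c" using ch by linarith
  qed (use M le in auto)
  finally show ?thesis using that Some le by (simp add: M_def power2_eq_square)
qed

text \<open>Neighbourhoods are balls of the field, while images are still compared chordally because
  orbits may pass through infinity. By \<open>Fatou_iff\<close> this describes the finite Fatou
  points over \<open>S\<close>.\<close>

definition equicont_ball :: "'a set \<Rightarrow> 'a \<Rightarrow> real \<Rightarrow> bool" where
  "equicont_ball S x r \<longleftrightarrow> (\<forall>w\<in>S. absv (w - x) < r \<longrightarrow> (\<forall>e>0. \<exists>d>0. \<forall>u\<in>S. absv (u - x) < r \<longrightarrow> absv (w - u) < d \<longrightarrow>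
     (\<forall>n\<ge>1. chordal absv ((rat_eval P Q ^^ n) (Some w)) ((rat_eval P Q ^^ n) (Some u)) < e)))"

lemma equicont_ballD:
  assumes "equicont_ball S x r" "w \<in> S" "absv (w - x) < r" "0 < e"
  obtains d where "0 < d" "\<And>u n. u \<in> S \<Longrightarrow> absv (u - x) < r \<Longrightarrow> absv (w - u) < d \<Longrightarrow> 1 \<le> n \<Longrightarrow>
     chordal absv ((rat_eval P Q ^^ n) (Some w)) ((rat_eval P Q ^^ n) (Some u)) < e"
proof -
  have "\<exists>d>0. \<forall>u\<in>S. absv (u - x) < r \<longrightarrow> absv (w - u) < d \<longrightarrow>
     (\<forall>n\<ge>1. chordal absv ((rat_eval P Q ^^ n) (Some w)) ((rat_eval P Q ^^ n) (Some u)) < e)"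
    using assms(1)[unfolded equicont_ball_def, THEN bspec, OF assms(2), THEN mp, OF assms(3), THEN spec, THEN mp, OF assms(4)] .
  then obtain d where d: "0 < d" "\<forall>u\<in>S. absv (u - x) < r \<longrightarrow> absv (w - u) < d \<longrightarrow>
     (\<forall>n\<ge>1. chordal absv ((rat_eval P Q ^^ n) (Some w)) ((rat_eval P Q ^^ n) (Some u)) < e)" by (elim exE conjE)
  show ?thesis
    by (rule that[OF d(1)]) (use d(2) in simp)
qed

lemma equicont_ball_recenter:
  assumes "equicont_ball S x r" "absv (y - x) < r" "r' \<le> r"
  shows "equicont_ball S y r'"
proof -
  have *: "absv (u - x) < r" if "absv (u - y) < r'" for u
    using that absv_ultra_less[of u y r x] assms by simp
  show ?thesis unfolding equicont_ball_def
  proof (intro ballI impI allI)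
    fix w e assume w: "w \<in> S" "absv (w - y) < r'" "(0::real) < e"
    obtain d where d: "0 < d" "\<And>u n. u \<in> S \<Longrightarrow> absv (u - x) < r \<Longrightarrow> absv (w - u) < d \<Longrightarrow> 1 \<le> n \<Longrightarrow>
     chordal absv ((rat_eval P Q ^^ n) (Some w)) ((rat_eval P Q ^^ n) (Some u)) < e"
      by (rule equicont_ballD[OF assms(1) w(1) *[OF w(2)] w(3)]) (rule that; assumption)
    show "\<exists>d>0. \<forall>u\<in>S. absv (u - y) < r' \<longrightarrow> absv (w - u) < d \<longrightarrow>
     (\<forall>n\<ge>1. chordal absv ((rat_eval P Q ^^ n) (Some w)) ((rat_eval P Q ^^ n) (Some u)) < e)"
      using d * by blast
  qed
qed

lemma Fatou_iff:
  assumes "x \<in> S"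
  shows "Some x \<in> Fatou_set absv P Q S \<longleftrightarrow> (\<exists>r>0. equicont_ball S x r)"
proof
  assume "Some x \<in> Fatou_set absv P Q S"
  then obtain U r where U: "0 < r" "{w \<in> P1 S. chordal absv (Some x) w < r} \<subseteq> U" "equicont_on absv (rat_eval P Q) U"
    unfolding Fatou_set_def by blast
  have inU: "Some u \<in> U" if "u \<in> S" "absv (u - x) < r" for u
    using that U(2) chordal_le[of x u] by (force simp: P1_def absv_commute[of x])
  have "equicont_ball S x r" unfolding equicont_ball_def
  proof (intro ballI impI allI)
    fix w e assume w: "w \<in> S" "absv (w - x) < r" "(0::real) < e"
    then obtain d where d: "d > 0" "\<And>u. u \<in> U \<Longrightarrow> chordal absv (Some w) u < d \<Longrightarrow>
        (\<forall>n\<ge>1. chordal absv ((rat_eval P Q ^^ n) (Some w)) ((rat_eval P Q ^^ n) u) < e)"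
      using U(3) inU unfolding equicont_on_def by meson
    have "chordal absv (Some w) (Some u) < d" if "absv (w - u) < d" for u
      using that chordal_le[of w u] by simp
    thus "\<exists>d>0. \<forall>u\<in>S. absv (u - x) < r \<longrightarrow> absv (w - u) < d \<longrightarrow>
       (\<forall>n\<ge>1. chordal absv ((rat_eval P Q ^^ n) (Some w)) ((rat_eval P Q ^^ n) (Some u)) < e)"
      using d inU by blast
  qed
  thus "\<exists>r>0. equicont_ball S x r" using U(1) by blast
next
  assume "\<exists>r>0. equicont_ball S x r"
  then obtain r where r: "0 < r" "equicont_ball S x r" by blast
  define M where "M = max 1 (absv x)"
  have M: "1 \<le> M" by (simp add: M_def)
  define U where "U = Some ` {u \<in> S. absv (u - x) < r}"
  have "{w \<in> P1 S. chordal absv (Some x) w < min (1 / M) (r / M\<^sup>2)} \<subseteq> U"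
  proof
    fix w assume w: "w \<in> {w \<in> P1 S. chordal absv (Some x) w < min (1 / M) (r / M\<^sup>2)}"
    hence "chordal absv (Some x) w < min (1 / M) (r / M\<^sup>2)" by simp
    then obtain u where u: "w = Some u" "absv (x - u) < min (1 / M) (r / M\<^sup>2) * M\<^sup>2"
      using chordal_small[of x w "min (1 / M) (r / M\<^sup>2)"] unfolding M_def[symmetric] by auto
    have "min (1 / M) (r / M\<^sup>2) * M\<^sup>2 \<le> r / M\<^sup>2 * M\<^sup>2" by (intro mult_right_mono) auto
    hence "absv (u - x) < r" using u(2) M by (simp add: absv_commute)
    thus "w \<in> U" using w u(1) by (auto simp: U_def P1_def)
  qed
  moreover have "0 < min (1 / M) (r / M\<^sup>2)" using M r by simp
  moreover have "equicont_on absv (rat_eval P Q) U"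
    unfolding equicont_on_def
  proof (intro ballI allI impI)
    fix w e assume w: "w \<in> U" "(0::real) < e"
    then obtain w' where w': "w = Some w'" "w' \<in> S" "absv (w' - x) < r" by (auto simp: U_def)
    obtain d where d: "0 < d" "\<And>u n. u \<in> S \<Longrightarrow> absv (u - x) < r \<Longrightarrow> absv (w' - u) < d \<Longrightarrow> 1 \<le> n \<Longrightarrow>
     chordal absv ((rat_eval P Q ^^ n) (Some w')) ((rat_eval P Q ^^ n) (Some u)) < e"
      by (rule equicont_ballD[OF r(2) w'(2,3) w(2)]) (rule that; assumption)
    define N where "N = M + r"
    have N: "1 \<le> N" using M r by (simp add: N_def)
    have bd: "max 1 (absv u) \<le> N" if "absv (u - x) < r" for u
      using absv_add[of "u - x" x] that r by (simp add: N_def M_def max_def split: if_splits)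
    show "\<exists>d>0. \<forall>u\<in>U. chordal absv w u < d \<longrightarrow>
        (\<forall>n\<ge>1. chordal absv ((rat_eval P Q ^^ n) w) ((rat_eval P Q ^^ n) u) < e)"
    proof (intro exI[of _ "d / (N * N)"] conjI ballI impI allI)
      show "0 < d / (N * N)" using d N by simp
      fix u and n :: nat assume u: "u \<in> U" "chordal absv w u < d / (N * N)" "1 \<le> n"
      then obtain u' where u': "u = Some u'" "u' \<in> S" "absv (u' - x) < r" by (auto simp: U_def)
      have pos: "0 < max 1 (absv w') * max 1 (absv u')" by simp
      have "absv (w' - u') / (max 1 (absv w') * max 1 (absv u')) < d / (N * N)"
        using u(2) u'(1) w'(1) by (simp add: chordal_def)
      hence "absv (w' - u') < d / (N * N) * (max 1 (absv w') * max 1 (absv u'))"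
        using pos by (simp only: pos_divide_less_eq)
      also have "\<dots> \<le> d / (N * N) * (N * N)"
        using d N bd[OF w'(3)] bd[OF u'(3)] by (intro mult_left_mono mult_mono) auto
      also have "\<dots> = d" using N by simp
      finally show "chordal absv ((rat_eval P Q ^^ n) w) ((rat_eval P Q ^^ n) u) < e"
        using d(2)[OF u'(2,3) _ u(3)] w'(1) u'(1) by simp
    qed
  qed
  moreover have "U \<subseteq> P1 S" "Some x \<in> U" "Some x \<in> P1 S" using assms r by (auto simp: U_def P1_def)
  ultimately show "Some x \<in> Fatou_set absv P Q S" unfolding Fatou_set_def by blast
qed

definition Jc :: "'a set" where "Jc = {x. Some x \<in> Julia_set absv P Q UNIV}"

lemma Jc_iff: "x \<in> Jc \<longleftrightarrow> (\<forall>r>0. \<not> equicont_ball UNIV x r)"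
  using Fatou_iff[of x UNIV] unfolding Jc_def Julia_set_def by (auto simp: P1_def)

lemma Julia_iff: "Some x \<in> Julia_set absv P Q L \<longleftrightarrow> x \<in> L \<and> (\<forall>r>0. \<not> equicont_ball L x r)"
  using Fatou_iff[of x L] unfolding Julia_set_def by (auto simp: P1_def)

text \<open>Restricting centre and competitor to \<open>L\<close> only weakens the demand of
  equicontinuity, so a Fatou point over the whole field is one over \<open>L\<close>.\<close>

lemma Julia_subset:
  assumes "Some x \<in> Julia_set absv P Q L"
  shows "x \<in> L" "x \<in> Jc"
proof -
  show "x \<in> L" using assms by (simp add: Julia_iff)
  have "equicont_ball L x r" if "equicont_ball UNIV x r" for r
    unfolding equicont_ball_def
  proof (intro ballI impI allI)
    fix w e assume w: "w \<in> L" "absv (w - x) < r" "(0::real) < e"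
    show "\<exists>d>0. \<forall>u\<in>L. absv (u - x) < r \<longrightarrow> absv (w - u) < d \<longrightarrow>
     (\<forall>n\<ge>1. chordal absv ((rat_eval P Q ^^ n) (Some w)) ((rat_eval P Q ^^ n) (Some u)) < e)"
      by (rule equicont_ballD[OF that UNIV_I w(2,3)]) (intro exI conjI ballI impI allI; simp)
  qed
  thus "x \<in> Jc" using assms unfolding Jc_iff Julia_iff by blast
qed

lemma Jc_closed:
  assumes "x \<notin> Jc"
  obtains r where "0 < r" "\<And>y. absv (y - x) < r \<Longrightarrow> y \<notin> Jc"
proof -
  obtain r where r: "0 < r" "equicont_ball UNIV x r" using assms by (auto simp: Jc_iff)
  have "y \<notin> Jc" if "absv (y - x) < r" for y
    using equicont_ball_recenter[OF r(2) that order_refl] r(1) by (auto simp: Jc_iff)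
  thus ?thesis using that r by blast
qed

lemma poly_cont:
  assumes "0 < e"
  obtains d where "0 < d" "\<And>u. absv (u - x) < d \<Longrightarrow> absv (poly q u - poly q x) < e"
proof -
  obtain H where H: "H \<ge> 0" "\<And>z z'. absv z \<le> max 1 (absv x) \<Longrightarrow> absv z' \<le> max 1 (absv x) \<Longrightarrow> absv (poly q z - poly q z') \<le> H * absv (z - z')"
    using poly_lipschitz by blast
  show ?thesis
  proof (rule that[of "min 1 (e / (H + 1))"])
    show "0 < min 1 (e / (H + 1))" using assms H(1) by simp
    fix u assume u: "absv (u - x) < min 1 (e / (H + 1))"
    have "absv u \<le> max 1 (absv x)" using absv_add[of "u - x" x] u by (auto simp: le_max_iff_disj)
    hence "absv (poly q u - poly q x) \<le> H * absv (u - x)" using H(2) by simp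
    also have "\<dots> \<le> (H + 1) * absv (u - x)" by (simp add: algebra_simps)
    also have "\<dots> < e" using u H(1) by (simp add: field_simps)
    finally show "absv (poly q u - poly q x) < e" .
  qed
qed

lemma rat_eval_cont:
  assumes "0 < e"
  obtains d where "0 < d" "\<And>u. absv (u - x) < d \<Longrightarrow> chordal absv (rat_eval P Q (Some x)) (rat_eval P Q (Some u)) < e"
proof (cases "poly Q x = 0")
  case False
  obtain a \<delta> where a: "0 < \<delta>" "\<delta> \<le> 1" "a \<noteq> 0" "\<And>b. absv (b - x) < \<delta> \<Longrightarrow> poly Q b \<noteq> 0"
    "\<And>b. absv (b - x) < \<delta> \<Longrightarrow> absv (f b - f x) = absv a * absv (b - x) ^ mult x"
    by (rule local_mono[OF False]) blast
  have ap: "0 < absv a" using a by simp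
  show ?thesis
  proof (rule that[of "min \<delta> (e / absv a)"])
    show "0 < min \<delta> (e / absv a)" using a ap assms by simp
    fix u assume u: "absv (u - x) < min \<delta> (e / absv a)"
    have "absv (u - x) ^ mult x \<le> absv (u - x) ^ 1"
      using mult_pos[OF False] u a(2) by (intro power_decreasing) auto
    hence "absv (f u - f x) \<le> absv a * absv (u - x)" using a(5)[of u] u ap by (simp add: mult_left_mono)
    also have "\<dots> < e" using u ap by (simp add: field_simps)
    finally have "chordal absv (Some (f x)) (Some (f u)) < e"
      using chordal_le[of "f x" "f u"] by (simp add: absv_commute)
    thus "chordal absv (rat_eval P Q (Some x)) (rat_eval P Q (Some u)) < e"
      using False a(4)[of u] u by simp
  qed
next
  case True
  have Px: "poly P x \<noteq> 0"
  proof
    assume "poly P x = 0"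
    hence "[:- x, 1:] dvd P" "[:- x, 1:] dvd Q" using True by (auto simp: poly_eq_0_iff_dvd)
    hence "[:- x, 1:] dvd 1" using coprime_PQ coprime_common_divisor by blast
    thus False by (simp add: is_unit_iff_degree)
  qed
  obtain d1 where d1: "0 < d1" "\<And>u. absv (u - x) < d1 \<Longrightarrow> absv (poly P u - poly P x) < absv (poly P x)"
    using poly_cont[of "absv (poly P x)" x P] Px by auto
  have "0 < e * absv (poly P x)" using assms Px by simp
  then obtain d2 where d2: "0 < d2" "\<And>u. absv (u - x) < d2 \<Longrightarrow> absv (poly Q u - poly Q x) < e * absv (poly P x)"
    by (rule poly_cont[of _ x Q]) blast
  show ?thesis
  proof (rule that[of "min d1 d2"])
    show "0 < min d1 d2" using d1 d2 by simp
    fix u assume u: "absv (u - x) < min d1 d2"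
    have Pu: "absv (poly P u) = absv (poly P x)" using absv_eq_if_close[OF d1(2)[of u]] u by simp
    have Qu: "absv (poly Q u) < e * absv (poly P x)" using d2(2) u True by simp
    show "chordal absv (rat_eval P Q (Some x)) (rat_eval P Q (Some u)) < e"
    proof (cases "poly Q u = 0")
      case False
      have "1 / max 1 (absv (poly P u / poly Q u)) \<le> 1 / absv (poly P u / poly Q u)"
        using False Pu Px by (intro divide_left_mono) auto
      also have "\<dots> < e" using Qu Pu Px False by (simp add: field_simps)
      finally show ?thesis using True False by (simp add: rat_eval_def chordal_def)
    qed (use True assms in \<open>simp add: rat_eval_def chordal_def\<close>)
  qed
qed

text \<open>A chordal neighbourhood of the image pulls back to a ball by continuity, and
  equicontinuity carries over with the index shifted by one.\<close>

lemma Fatou_backward: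
  assumes "rat_eval P Q (Some x) \<in> Fatou_set absv P Q UNIV"
  shows "x \<notin> Jc"
proof -
  obtain U r where U: "0 < r" "{w \<in> P1 UNIV. chordal absv (rat_eval P Q (Some x)) w < r} \<subseteq> U" "equicont_on absv (rat_eval P Q) U"
    using assms unfolding Fatou_set_def by blast
  have all: "w \<in> P1 UNIV" for w :: "'a option" by (cases w) (auto simp: P1_def)
  obtain r0 where r0: "0 < r0" "\<And>u. absv (u - x) < r0 \<Longrightarrow> chordal absv (rat_eval P Q (Some x)) (rat_eval P Q (Some u)) < r"
    using rat_eval_cont[OF U(1)] by blast
  have inU: "rat_eval P Q (Some u) \<in> U" if "absv (u - x) < r0" for u
    using U(2) r0(2)[OF that] all by blast
  have "equicont_ball UNIV x r0" unfolding equicont_ball_def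
  proof (intro ballI impI allI)
    fix w e assume w: "absv (w - x) < r0" "(0::real) < e"
    then obtain d where d: "d > 0" "\<And>u. u \<in> U \<Longrightarrow> chordal absv (rat_eval P Q (Some w)) u < d \<Longrightarrow>
        (\<forall>n\<ge>1. chordal absv ((rat_eval P Q ^^ n) (rat_eval P Q (Some w))) ((rat_eval P Q ^^ n) u) < e)"
      using U(3) inU[OF w(1)] unfolding equicont_on_def by meson
    \<comment> \<open>The bound \<open>e\<close> settles the first iterate; \<open>d\<close> feeds
      the equicontinuity at the image, which covers the later ones.\<close>
    have "0 < min d e" using d w by simp
    then obtain d' where d': "0 < d'" "\<And>u. absv (u - w) < d' \<Longrightarrow> chordal absv (rat_eval P Q (Some w)) (rat_eval P Q (Some u)) < min d e"
      using rat_eval_cont by blast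
    show "\<exists>d>0. \<forall>u\<in>UNIV. absv (u - x) < r0 \<longrightarrow> absv (w - u) < d \<longrightarrow>
       (\<forall>n\<ge>1. chordal absv ((rat_eval P Q ^^ n) (Some w)) ((rat_eval P Q ^^ n) (Some u)) < e)"
    proof (intro exI[of _ d'] conjI ballI impI allI)
      fix u and n :: nat assume u: "absv (u - x) < r0" "absv (w - u) < d'" "1 \<le> n"
      have c: "chordal absv (rat_eval P Q (Some w)) (rat_eval P Q (Some u)) < min d e"
        using d'(2)[of u] u(2) by (simp add: absv_commute)
      obtain k where k: "n = Suc k" using u(3) by (cases n) auto
      show "chordal absv ((rat_eval P Q ^^ n) (Some w)) ((rat_eval P Q ^^ n) (Some u)) < e"
      proof (cases "k = 0")
        case False
        thus ?thesis using d(2)[OF inU[OF u(1)]] c unfolding k funpow_Suc_right by simp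
      qed (use c k in simp)
    qed (rule d'(1))
  qed
  thus ?thesis using r0(1) by (auto simp: Jc_iff)
qed

lemma rat_eval_iterate:
  assumes "\<And>i. i < n \<Longrightarrow> poly Q ((f ^^ i) x) \<noteq> 0"
  shows "(rat_eval P Q ^^ n) (Some x) = Some ((f ^^ n) x)"
  using assms by (induction n) auto

lemma Fatou_criterion:
  assumes r: "0 < r" and Q: "\<And>n u. absv (u - x) < r \<Longrightarrow> poly Q ((f ^^ n) u) \<noteq> 0"
    and A: "\<And>n u w. absv (u - x) < r \<Longrightarrow> absv (w - x) < r \<Longrightarrow> absv ((f ^^ n) u - (f ^^ n) w) \<le> A * absv (u - w)"
  shows "x \<notin> Jc"
proof -
  have "equicont_ball UNIV x r" unfolding equicont_ball_def
  proof (intro ballI impI allI)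
    fix w e assume w: "absv (w - x) < r" "(0::real) < e"
    show "\<exists>d>0. \<forall>u\<in>UNIV. absv (u - x) < r \<longrightarrow> absv (w - u) < d \<longrightarrow>
       (\<forall>n\<ge>1. chordal absv ((rat_eval P Q ^^ n) (Some w)) ((rat_eval P Q ^^ n) (Some u)) < e)"
    proof (intro exI[of _ "e / (\<bar>A\<bar> + 1)"] conjI ballI impI allI)
      show "0 < e / (\<bar>A\<bar> + 1)" using w by simp
      fix u and n :: nat assume u: "absv (u - x) < r" "absv (w - u) < e / (\<bar>A\<bar> + 1)"
      have "chordal absv ((rat_eval P Q ^^ n) (Some w)) ((rat_eval P Q ^^ n) (Some u)) \<le> absv ((f ^^ n) w - (f ^^ n) u)"
        using Q[OF w(1)] Q[OF u(1)] chordal_le by (simp add: rat_eval_iterate)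
      also have "\<dots> \<le> A * absv (w - u)" using A w u by blast
      also have "\<dots> \<le> (\<bar>A\<bar> + 1) * absv (w - u)" by (intro mult_right_mono) auto
      also have "\<dots> < e"
      proof -
        have "0 < \<bar>A\<bar> + 1" by linarith
        thus ?thesis using u(2) by (simp only: pos_less_divide_eq mult.commute)
      qed
      finally show "chordal absv ((rat_eval P Q ^^ n) (Some w)) ((rat_eval P Q ^^ n) (Some u)) < e" .
    qed
  qed
  thus ?thesis using r by (auto simp: Jc_iff)
qed

text \<open>The map is a similarity from a ball about \<open>z\<close> onto a ball about
  \<open>f z\<close>. Were \<open>z\<close> a Fatou point, equicontinuity could be pushed forward,
  since every point near \<open>f z\<close> has a preimage near \<open>z\<close> at proportional
  distance.\<close>

lemma lin_Jc:
  assumes lin: "lin b r" and z: "absv (z - b) < r" and fz: "f z \<in> Jc"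
  shows "z \<in> Jc"
proof (rule ccontr)
  assume "z \<notin> Jc"
  then obtain r1 where r1: "0 < r1" "equicont_ball UNIV z r1" by (auto simp: Jc_iff)
  define s where "s = min r1 r"
  have s: "0 < s" "s \<le> r1" "s \<le> r" using r1 linD(1)[OF lin] by (auto simp: s_def)
  have ls: "lin z s" using lin_recenter(1)[OF lin z s(1,3)] .
  have d0: "0 < absv (df z)" using linD(2)[OF ls] .
  have pre: "\<exists>w. absv (w - z) < s \<and> f w = y" if "absv (y - f z) < absv (df z) * s" for y
    using lin_surj[OF ls _ cauchy_closed_UNIV _ _ UNIV_I UNIV_I that] by (auto simp: is_subfield_def over_def)
  have "equicont_ball UNIV (f z) (absv (df z) * s)" unfolding equicont_ball_def
  proof (intro ballI impI allI)
    fix y e assume y: "absv (y - f z) < absv (df z) * s" "(0::real) < e"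
    obtain w where w: "absv (w - z) < s" "f w = y" using pre[OF y(1)] by blast
    have wr: "absv (w - z) < r1" using w s by simp
    obtain d where d: "0 < d" "\<And>u n. absv (u - z) < r1 \<Longrightarrow> absv (w - u) < d \<Longrightarrow> 1 \<le> n \<Longrightarrow>
     chordal absv ((rat_eval P Q ^^ n) (Some w)) ((rat_eval P Q ^^ n) (Some u)) < e"
      by (rule equicont_ballD[OF r1(2) UNIV_I wr y(2)]) (rule that; simp)
    show "\<exists>d>0. \<forall>u\<in>UNIV. absv (u - f z) < absv (df z) * s \<longrightarrow> absv (y - u) < d \<longrightarrow>
       (\<forall>n\<ge>1. chordal absv ((rat_eval P Q ^^ n) (Some y)) ((rat_eval P Q ^^ n) (Some u)) < e)"
    proof (intro exI[of _ "absv (df z) * d"] conjI ballI impI allI)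
      show "0 < absv (df z) * d" using d d0 by simp
      fix y' and n :: nat assume y': "absv (y' - f z) < absv (df z) * s" "absv (y - y') < absv (df z) * d" "1 \<le> n"
      obtain u where u: "absv (u - z) < s" "f u = y'" using pre[OF y'(1)] by blast
      have "absv (w - u) < d" using lin_isometry[OF ls w(1) u(1)] y'(2) d0 w u by simp
      hence "chordal absv ((rat_eval P Q ^^ Suc n) (Some w)) ((rat_eval P Q ^^ Suc n) (Some u)) < e"
        using d(2)[of u "Suc n"] u s by simp
      thus "chordal absv ((rat_eval P Q ^^ n) (Some y)) ((rat_eval P Q ^^ n) (Some y')) < e"
        using w u linD(3)[OF ls] unfolding funpow_Suc_right by simp
    qed
  qed
  moreover have "0 < absv (df z) * s" using d0 s by simp
  ultimately show False using fz by (auto simp: Jc_iff)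
qed

section \<open>Derivatives along orbits and univalent iterates\<close>

definition D :: "nat \<Rightarrow> 'a \<Rightarrow> real" where "D n x = (\<Prod>i<n. absv (df ((f ^^ i) x)))"

lemma D_0 [simp]: "D 0 x = 1" by (simp add: D_def)
lemma D_Suc: "D (Suc n) x = D n x * absv (df ((f ^^ n) x))" by (simp add: D_def)
lemma D_nonneg: "0 \<le> D n x" by (simp add: D_def prod_nonneg)
lemma D_add: "D (n + m) x = D n x * D m ((f ^^ n) x)"
proof (induction m)
  case (Suc m)
  have "(f ^^ (n + m)) x = (f ^^ m) ((f ^^ n) x)" by (simp add: add.commute[of n] funpow_add)
  thus ?case using Suc by (simp add: D_Suc)
qed simp
lemma D_Suc': "D (Suc n) x = absv (df x) * D n (f x)"
  using D_add[of 1 n x] by (simp add: D_Suc)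

text \<open>\<open>s * D i v\<close> is the radius of the \<open>i\<close>-th image of the ball of
  radius \<open>s\<close> about \<open>v\<close>; each such image must allow one more linear step.
  The iterate is then a similarity of ratio \<open>D n v\<close> on the ball, by
  \<open>univalent_main\<close>.\<close>

definition univalent :: "nat \<Rightarrow> 'a \<Rightarrow> real \<Rightarrow> bool" where
  "univalent n v s \<longleftrightarrow> 0 < s \<and> (\<forall>i<n. lin ((f ^^ i) v) (s * D i v))"

lemma univalentD: "univalent n v s \<Longrightarrow> 0 < s" "univalent n v s \<Longrightarrow> i < n \<Longrightarrow> lin ((f ^^ i) v) (s * D i v)"
  by (auto simp: univalent_def)

lemma univalent_0 [simp]: "univalent 0 v s \<longleftrightarrow> 0 < s" by (simp add: univalent_def)
lemma univalent_Suc: "univalent (Suc n) v s \<longleftrightarrow> univalent n v s \<and> lin ((f ^^ n) v) (s * D n v)"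
  by (auto simp: univalent_def less_Suc_eq)

lemma univalent_main:
  assumes "univalent n v s"
  shows "0 < D n v" "\<And>z z'. absv (z - v) < s \<Longrightarrow> absv (z' - v) < s \<Longrightarrow> absv ((f ^^ n) z - (f ^^ n) z') = D n v * absv (z - z')"
    "\<And>z. absv (z - v) < s \<Longrightarrow> D n z = D n v"
    "\<And>z i. absv (z - v) < s \<Longrightarrow> i < n \<Longrightarrow> poly Q ((f ^^ i) z) \<noteq> 0"
proof -
  have "0 < D n v \<and> (\<forall>z z'. absv (z - v) < s \<longrightarrow> absv (z' - v) < s \<longrightarrow> absv ((f ^^ n) z - (f ^^ n) z') = D n v * absv (z - z')) \<and>
     (\<forall>z. absv (z - v) < s \<longrightarrow> D n z = D n v \<and> (\<forall>i<n. poly Q ((f ^^ i) z) \<noteq> 0))"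
    using assms
  proof (induction n)
    case (Suc n)
    have IH: "0 < D n v" "\<And>z z'. absv (z - v) < s \<Longrightarrow> absv (z' - v) < s \<Longrightarrow> absv ((f ^^ n) z - (f ^^ n) z') = D n v * absv (z - z')"
     "\<And>z. absv (z - v) < s \<Longrightarrow> D n z = D n v \<and> (\<forall>i<n. poly Q ((f ^^ i) z) \<noteq> 0)"
      using Suc by (auto simp: univalent_Suc)
    have lin: "lin ((f ^^ n) v) (s * D n v)" using Suc.prems by (simp add: univalent_Suc)
    have s: "0 < s" using univalentD(1)[OF Suc.prems] .
    have inb: "absv ((f ^^ n) z - (f ^^ n) v) < s * D n v" if "absv (z - v) < s" for z
      using IH(2)[OF that, of v] that s IH(1) by (simp add: mult.commute)
    have dz: "absv (df ((f ^^ n) z)) = absv (df ((f ^^ n) v))" if "absv (z - v) < s" for z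
      using lin_recenter(2)[OF lin inb[OF that] linD(1)[OF lin] order_refl] .
    show ?case
    proof (intro conjI allI impI)
      show "0 < D (Suc n) v" using IH(1) linD(2)[OF lin] by (simp add: D_Suc)
      fix z assume z: "absv (z - v) < s"
      show "D (Suc n) z = D (Suc n) v" using IH(3)[OF z] dz[OF z] by (simp add: D_Suc)
      show "poly Q ((f ^^ i) z) \<noteq> 0" if "i < Suc n" for i
        using IH(3)[OF z] linD(3)[OF lin inb[OF z]] that by (auto simp: less_Suc_eq)
      fix z' assume z': "absv (z' - v) < s"
      show "absv ((f ^^ Suc n) z - (f ^^ Suc n) z') = D (Suc n) v * absv (z - z')"
        using lin_isometry[OF lin inb[OF z] inb[OF z']] IH(2)[OF z z'] by (simp add: D_Suc)
    qed
  qed simp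
  thus "0 < D n v" "\<And>z z'. absv (z - v) < s \<Longrightarrow> absv (z' - v) < s \<Longrightarrow> absv ((f ^^ n) z - (f ^^ n) z') = D n v * absv (z - z')"
    "\<And>z. absv (z - v) < s \<Longrightarrow> D n z = D n v"
    "\<And>z i. absv (z - v) < s \<Longrightarrow> i < n \<Longrightarrow> poly Q ((f ^^ i) z) \<noteq> 0" by blast+
qed

lemma univalent_mono: "univalent n v s \<Longrightarrow> m \<le> n \<Longrightarrow> univalent m v s"
  by (auto simp: univalent_def)

lemma univalent_recenter:
  assumes "univalent n v s" "absv (b - v) < s" "0 < s'" "s' \<le> s"
  shows "univalent n b s'"
  unfolding univalent_def
proof (intro conjI allI impI)
  fix i assume i: "i < n"
  have oki: "univalent i v s" using univalent_mono assms(1) i by simp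
  have s: "0 < s" using assms by simp
  have "absv ((f ^^ i) b - (f ^^ i) v) < s * D i v"
    using univalent_main(2)[OF oki assms(2), of v] s univalent_main(1)[OF oki] assms(2) by (simp add: mult.commute)
  thus "lin ((f ^^ i) b) (s' * D i b)"
    using univalent_main(1)[OF oki] univalent_main(3)[OF oki assms(2)] assms
    by (intro lin_recenter(1)[OF univalentD(2)[OF assms(1) i]]) auto
qed (rule assms)

lemma univalent_shrink: "univalent n v s \<Longrightarrow> 0 < s' \<Longrightarrow> s' \<le> s \<Longrightarrow> univalent n v s'"
  using univalent_recenter[of n v s v s'] by (simp add: univalent_def)

lemma univalent_append:
  assumes "univalent n b s" "univalent m ((f ^^ n) b) (s * D n b)"
  shows "univalent (n + m) b s"
  unfolding univalent_def
proof (intro conjI allI impI)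
  fix i assume i: "i < n + m"
  show "lin ((f ^^ i) b) (s * D i b)"
  proof (cases "i < n")
    case False
    then obtain j where j: "i = n + j" "j < m" using i le_Suc_ex by (metis add_less_cancel_left not_less)
    have "lin ((f ^^ j) ((f ^^ n) b)) (s * D n b * D j ((f ^^ n) b))" using univalentD(2)[OF assms(2) j(2)] .
    moreover have "(f ^^ j) ((f ^^ n) b) = (f ^^ i) b" unfolding j by (simp add: add.commute[of n] funpow_add)
    ultimately show ?thesis unfolding j D_add by (simp add: mult.assoc)
  qed (use univalentD(2)[OF assms(1)] in blast)
qed (use assms in \<open>auto simp: univalent_def\<close>)

lemma univalent_surj:
  assumes "univalent n v s" and L: "is_subfield L" "cauchy_closed L" "over L P" "over L Q"
    and "v \<in> L" "y \<in> L" "absv (y - (f ^^ n) v) < s * D n v"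
  shows "\<exists>z\<in>L. absv (z - v) < s \<and> (f ^^ n) z = y"
  using assms(1,7,8)
proof (induction n arbitrary: y)
  case (Suc n)
  have univalent: "univalent n v s" and lin: "lin ((f ^^ n) v) (s * D n v)" using Suc.prems(1) by (auto simp: univalent_Suc)
  have vL: "(f ^^ n) v \<in> L"
  proof (induction n)
    case (Suc n)
    thus ?case using L by (auto simp: f_def[of "(f ^^ n) v"] intro!: subfield_simps over_poly)
  qed (use assms in simp)
  have "absv (y - f ((f ^^ n) v)) < absv (df ((f ^^ n) v)) * (s * D n v)"
    using Suc.prems(3) by (simp add: D_Suc mult_ac)
  then obtain y' where y': "y' \<in> L" "absv (y' - (f ^^ n) v) < s * D n v" "f y' = y"
    using lin_surj[OF lin L vL Suc.prems(2)] by blast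
  obtain z where "z \<in> L" "absv (z - v) < s" "(f ^^ n) z = y'" using Suc.IH[OF univalent y'(1,2)] by blast
  thus ?case using y'(3) by auto
qed auto

lemma univalent_Jc:
  assumes "univalent n v s" "absv (z - v) < s" "(f ^^ n) z \<in> Jc"
  shows "z \<in> Jc"
  using assms
proof (induction n)
  case (Suc n)
  have univalent: "univalent n v s" and lin: "lin ((f ^^ n) v) (s * D n v)" using Suc.prems(1) by (auto simp: univalent_Suc)
  have "absv ((f ^^ n) z - (f ^^ n) v) < s * D n v"
    using univalent_main(2)[OF univalent Suc.prems(2), of v] Suc.prems(2) univalentD(1)[OF univalent] univalent_main(1)[OF univalent] by (simp add: mult.commute)
  hence "(f ^^ n) z \<in> Jc" using lin_Jc[OF lin] Suc.prems(3) by simp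
  thus ?case using Suc.IH[OF univalent Suc.prems(2)] by blast
qed simp

end

locale dyn = rat_map +
  assumes infinity_Fatou: "None \<in> Fatou_set absv P Q UNIV"
begin

lemma Jc_forward:
  assumes "x \<in> Jc"
  shows "poly Q x \<noteq> 0" "f x \<in> Jc"
proof -
  show Q: "poly Q x \<noteq> 0"
  proof
    assume "poly Q x = 0"
    hence "rat_eval P Q (Some x) = None" by (simp add: rat_eval_def)
    thus False using Fatou_backward[of x] infinity_Fatou assms by simp
  qed
  show "f x \<in> Jc"
  proof (rule ccontr)
    assume "f x \<notin> Jc"
    hence "Some (f x) \<in> Fatou_set absv P Q UNIV" by (auto simp: Jc_def Julia_set_def P1_def)
    thus False using Fatou_backward[of x] assms Q by simp
  qed
qed

lemma Jc_iterate: "x \<in> Jc \<Longrightarrow> (f ^^ n) x \<in> Jc"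
  by (induction n) (auto simp: Jc_forward)

lemma Jc_rat_eval: "x \<in> Jc \<Longrightarrow> (rat_eval P Q ^^ n) (Some x) = Some ((f ^^ n) x)"
  by (intro rat_eval_iterate Jc_forward(1) Jc_iterate)

text \<open>Once \<open>absv x\<close> exceeds 1, the unit ball about \<open>x\<close> has constant
  absolute value, so for large \<open>x\<close> it lies entirely in the chordal neighbourhood of
  infinity on which the iterates are equicontinuous.\<close>

lemma Jc_bounded: "\<exists>R\<ge>1. \<forall>x\<in>Jc. absv x \<le> R"
proof -
  obtain U r where U: "0 < r" "{w \<in> P1 UNIV. chordal absv None w < r} \<subseteq> U" "equicont_on absv (rat_eval P Q) U"
    using infinity_Fatou unfolding Fatou_set_def by blast
  define R where "R = max 1 (1 / r)"
  have "absv x \<le> R" if x: "x \<in> Jc" for x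
  proof (rule ccontr)
    assume "\<not> absv x \<le> R"
    hence xR: "1 < absv x" "1 / r < absv x" by (auto simp: R_def)
    have inU: "Some u \<in> U" if "absv (u - x) < 1" for u
    proof -
      have "absv u = absv x" using that xR by (intro absv_eq_if_close) simp
      moreover have "1 / absv x < r" using xR U(1) by (simp only: divide_less_eq) (simp add: mult.commute)
      ultimately have "chordal absv None (Some u) < r" using xR(1) by (simp add: chordal_def)
      thus ?thesis using U(2) by (auto simp: P1_def)
    qed
    have "equicont_ball UNIV x 1" unfolding equicont_ball_def
    proof (intro ballI impI allI)
      fix w e assume w: "absv (w - x) < 1" "(0::real) < e"
      then obtain d where d: "d > 0" "\<And>u. u \<in> U \<Longrightarrow> chordal absv (Some w) u < d \<Longrightarrow>
          (\<forall>n\<ge>1. chordal absv ((rat_eval P Q ^^ n) (Some w)) ((rat_eval P Q ^^ n) u) < e)"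
        using U(3) inU unfolding equicont_on_def by meson
      have "chordal absv (Some w) (Some u) < d" if "absv (w - u) < d" for u
        using that chordal_le[of w u] by simp
      thus "\<exists>d>0. \<forall>u\<in>UNIV. absv (u - x) < 1 \<longrightarrow> absv (w - u) < d \<longrightarrow>
         (\<forall>n\<ge>1. chordal absv ((rat_eval P Q ^^ n) (Some w)) ((rat_eval P Q ^^ n) (Some u)) < e)"
        using d inU by blast
    qed
    thus False using x by (auto simp: Jc_iff)
  qed
  thus ?thesis by (intro exI[of _ R]) (auto simp: R_def)
qed

lemma cpt_Jc:
  assumes "heine_borel L"
  shows "cpt (Jc \<inter> L)"
proof -
  obtain R where R: "\<And>x. x \<in> Jc \<Longrightarrow> absv x \<le> R" using Jc_bounded by blast
  show ?thesis
  proof (rule cpt_heine_borel[OF assms, of _ R])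
    fix l assume "l \<in> L" "l \<notin> Jc \<inter> L"
    hence "l \<notin> Jc" by blast
    then obtain r where "0 < r" "\<And>y. absv (y - l) < r \<Longrightarrow> y \<notin> Jc" using Jc_closed by blast
    thus "\<exists>e>0. \<forall>y\<in>Jc \<inter> L. e \<le> absv (y - l)" by (meson IntD1 not_less)
  qed (use R in auto)
qed

subsection \<open>Univalent iterates near cycles\<close>

text \<open>At a critical point every positive \<open>c\<close> is allowed, because the local form
  makes difference quotients tend to 0; at a noncritical point \<open>absv (df w)\<close> itself is
  a Lipschitz constant.\<close>

lemma local_lipschitz:
  assumes Q: "poly Q w \<noteq> 0" and c: "0 < c" "absv (df w) \<le> c"
  obtains r where "0 < r" "\<And>z. absv (z - w) < r \<Longrightarrow> poly Q z \<noteq> 0"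
    "\<And>z z'. absv (z - w) < r \<Longrightarrow> absv (z' - w) < r \<Longrightarrow> absv (f z - f z') \<le> c * absv (z - z')"
proof (cases "df w = 0")
  case False
  obtain r where r: "0 < r" "lin w r" using lin_noncritical[OF Q False] by blast
  show ?thesis
  proof (rule that[OF r(1) linD(3)[OF r(2)]])
    fix z z' assume "absv (z - w) < r" "absv (z' - w) < r"
    hence "absv (f z - f z') = absv (df w) * absv (z - z')" by (rule lin_isometry[OF r(2)])
    also have "\<dots> \<le> c * absv (z - z')" using c by (intro mult_right_mono) auto
    finally show "absv (f z - f z') \<le> c * absv (z - z')" .
  qed
next
  case True
  obtain h \<delta> H where h: "0 < \<delta>" "\<delta> \<le> 1" "0 \<le> H" "h w \<noteq> 0"
    "\<And>z. absv (z - w) < \<delta> \<Longrightarrow> poly Q z \<noteq> 0"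
    "\<And>z. absv (z - w) < \<delta> \<Longrightarrow> f z = f w + (z - w) ^ mult w * h z"
    "\<And>z z'. absv (z - w) < \<delta> \<Longrightarrow> absv (z' - w) < \<delta> \<Longrightarrow> absv (h z - h z') \<le> H * absv (z - z')"
    "mult w = 1 \<Longrightarrow> df w = h w" "mult w \<noteq> 1 \<Longrightarrow> df w = 0"
    by (rule local_form[OF Q], rule that; assumption)
  have "mult w \<noteq> 1" using mult_eq_1_iff[OF Q] True by blast
  define n where "n = mult w - 2"
  have n: "mult w = Suc (Suc n)" using mult_pos[OF Q] \<open>mult w \<noteq> 1\<close> by (simp add: n_def)
  define B where "B = absv (h w) + H + 1"
  have B: "0 < B" "absv (h w) \<le> B" "H \<le> B" using h(3) absv_nonneg[of "h w"] unfolding B_def by linarith+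
  define r where "r = min \<delta> (c / B)"
  have r: "0 < r" "r \<le> \<delta>" "r \<le> 1" "r * B \<le> c"
  proof -
    have "r * B \<le> c / B * B" unfolding r_def using B by (intro mult_right_mono) auto
    thus "r * B \<le> c" using B by simp
  qed (use h B c in \<open>auto simp: r_def\<close>)
  show ?thesis
  proof (rule that[of r])
    fix z z' assume z: "absv (z - w) < r" "absv (z' - w) < r"
    have zd: "absv (z - w) < \<delta>" "absv (z' - w) < \<delta>" using z r by auto
    have rn: "r ^ n \<le> 1" using r by (intro power_le_one) auto
    have hz: "absv (h z) \<le> B"
    proof -
      have "absv (h z - h w) \<le> H * absv (z - w)" using h(7)[OF zd(1), of w] h(1) by simp
      also have "\<dots> \<le> H * 1" using zd(1) h(2,3) by (intro mult_left_mono) auto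
      finally show ?thesis using absv_add[of "h z - h w" "h w"] B by (simp add: max_def split: if_splits)
    qed
    have eq: "f z - f z' = ((z - w) ^ Suc (Suc n) - (z' - w) ^ Suc (Suc n)) * h z + (z' - w) ^ Suc (Suc n) * (h z - h z')"
      unfolding h(6)[OF zd(1)] h(6)[OF zd(2)] n by (simp add: algebra_simps)
    have "absv ((z - w) ^ Suc (Suc n) - (z' - w) ^ Suc (Suc n)) \<le> r ^ Suc n * absv (z - w - (z' - w))"
      using z by (intro absv_power_diff) auto
    also have "\<dots> \<le> r * absv (z - z')" using rn r by (simp add: mult_right_mono mult_left_le)
    finally have "absv (((z - w) ^ Suc (Suc n) - (z' - w) ^ Suc (Suc n)) * h z) \<le> (r * absv (z - z')) * B"
      unfolding absv_mult using hz r by (intro mult_mono) auto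
    also have "\<dots> = (r * B) * absv (z - z')" by simp
    also have "\<dots> \<le> c * absv (z - z')" using r by (intro mult_right_mono) auto
    finally have 1: "absv (((z - w) ^ Suc (Suc n) - (z' - w) ^ Suc (Suc n)) * h z) \<le> c * absv (z - z')" .
    have "absv (z' - w) ^ Suc (Suc n) \<le> r ^ Suc (Suc n)" using z by (intro power_mono) auto
    also have "\<dots> \<le> r ^ 1" using r by (intro power_decreasing) auto
    finally have "absv ((z' - w) ^ Suc (Suc n) * (h z - h z')) \<le> r * (B * absv (z - z'))"
      unfolding absv_mult absv_power using h(7)[OF zd] B(3) r(1)
      by (intro mult_mono order_trans[OF h(7)[OF zd]] mult_right_mono) auto
    also have "\<dots> = (r * B) * absv (z - z')" by simp
    also have "\<dots> \<le> c * absv (z - z')" using r by (intro mult_right_mono) auto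
    finally have 2: "absv ((z' - w) ^ Suc (Suc n) * (h z - h z')) \<le> c * absv (z - z')" .
    show "absv (f z - f z') \<le> c * absv (z - z')" unfolding eq by (rule absv_leI[OF 1 2])
  qed (use h(5) r in auto)
qed

lemma iterate_lipschitz:
  assumes "\<And>i. i < n \<Longrightarrow> poly Q ((f ^^ i) w) \<noteq> 0 \<and> 0 < c i \<and> absv (df ((f ^^ i) w)) \<le> c i"
  shows "\<exists>r>0. \<forall>i\<le>n. \<forall>z z'. absv (z - w) < r \<longrightarrow> absv (z' - w) < r \<longrightarrow>
     (\<forall>j<i. poly Q ((f ^^ j) z) \<noteq> 0) \<and> absv ((f ^^ i) z - (f ^^ i) z') \<le> (\<Prod>j<i. c j) * absv (z - z')"
  using assms
proof (induction n)
  case 0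
  show ?case by (intro exI[of _ 1]) auto
next
  case (Suc n)
  let ?C = "\<lambda>i. \<Prod>j<i. c j"
  have "\<And>i. i < n \<Longrightarrow> poly Q ((f ^^ i) w) \<noteq> 0 \<and> 0 < c i \<and> absv (df ((f ^^ i) w)) \<le> c i" using Suc.prems by simp
  from Suc.IH[OF this] obtain r where r: "0 < r" "\<And>i z z'. i \<le> n \<Longrightarrow> absv (z - w) < r \<Longrightarrow> absv (z' - w) < r \<Longrightarrow>
     (\<forall>j<i. poly Q ((f ^^ j) z) \<noteq> 0) \<and> absv ((f ^^ i) z - (f ^^ i) z') \<le> ?C i * absv (z - z')" by blast
  have n: "poly Q ((f ^^ n) w) \<noteq> 0" "0 < c n" "absv (df ((f ^^ n) w)) \<le> c n" using Suc.prems by auto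
  obtain t where t: "0 < t" "\<And>z. absv (z - (f ^^ n) w) < t \<Longrightarrow> poly Q z \<noteq> 0"
    "\<And>z z'. absv (z - (f ^^ n) w) < t \<Longrightarrow> absv (z' - (f ^^ n) w) < t \<Longrightarrow> absv (f z - f z') \<le> c n * absv (z - z')"
    using local_lipschitz[OF n] by blast
  have Cpos: "0 < ?C n" using Suc.prems by (intro prod_pos) auto
  define r' where "r' = min r (t / ?C n)"
  have r': "0 < r'" "r' \<le> r" using r t Cpos by (auto simp: r'_def)
  have near: "absv ((f ^^ n) z - (f ^^ n) w) < t" if "absv (z - w) < r'" for z
  proof -
    have "absv ((f ^^ n) z - (f ^^ n) w) \<le> ?C n * absv (z - w)" using r(2)[of n z w] that r' r(1) by simp
    also have "\<dots> < ?C n * (t / ?C n)" using that Cpos by (intro mult_strict_left_mono) (auto simp: r'_def)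
    also have "\<dots> = t" using less_imp_neq[OF Cpos, symmetric]
      by (simp only: times_divide_eq_right nonzero_mult_div_cancel_left not_False_eq_True)
    finally show ?thesis .
  qed
  show ?case
  proof (intro exI[of _ r'] conjI allI impI r'(1))
    fix i z z' assume i: "i \<le> Suc n" and z: "absv (z - w) < r'" "absv (z' - w) < r'"
    have zr: "absv (z - w) < r" "absv (z' - w) < r" using z r' by auto
    show "poly Q ((f ^^ j) z) \<noteq> 0" if "j < i" for j
      using r(2)[OF order_refl zr] t(2)[OF near[OF z(1)]] that i by (cases "j = n") auto
    show "absv ((f ^^ i) z - (f ^^ i) z') \<le> ?C i * absv (z - z')"
    proof (cases "i = Suc n")
      case True
      have "absv (f ((f ^^ n) z) - f ((f ^^ n) z')) \<le> c n * absv ((f ^^ n) z - (f ^^ n) z')"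
        using t(3)[OF near near] z by blast
      also have "\<dots> \<le> c n * (?C n * absv (z - z'))"
        using r(2)[OF order_refl zr] n(2) by (intro mult_left_mono) auto
      finally show ?thesis using True by (simp add: mult_ac)
    next
      case False
      hence "i \<le> n" using i by simp
      thus ?thesis using r(2)[OF _ zr] by blast
    qed
  qed
qed

text \<open>A multiplier of absolute value at most 1 gives a return map that does not increase
  distances on a ball about \<open>w\<close> and hence maps the ball to itself. All iterates are
  then Lipschitz with a common constant, and \<open>w\<close> would be a Fatou point.\<close>

lemma periodic_repelling:
  assumes w: "w \<in> Jc" and n: "0 < n" "(f ^^ n) w = w"
  shows "1 < D n w"
proof (rule ccontr)
  assume "\<not> 1 < D n w"
  hence D1: "D n w \<le> 1" by simp
  define d where "d i = absv (df ((f ^^ i) w))" for i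
  \<comment> \<open>A vanishing derivative is replaced by \<open>1 / C\<close>, since
    \<open>local_lipschitz\<close> needs positive constants; as \<open>C\<close> bounds the product
    of the other factors, the whole product stays at most 1.\<close>
  define C where "C = (\<Prod>i<n. max 1 (d i))"
  have C1: "1 \<le> C" unfolding C_def by (intro prod_ge_1) auto
  define c where "c i = (if d i = 0 then 1 / C else d i)" for i
  have c: "0 < c i" "d i \<le> c i" for i
    using C1 by (auto simp: c_def d_def)
  have prodle: "(\<Prod>i<n. c i) \<le> 1"
  proof (cases "\<exists>i<n. d i = 0")
    case True
    then obtain i where i: "i < n" "d i = 0" by blast
    have "(\<Prod>i<n. c i) = c i * (\<Prod>j\<in>{..<n} - {i}. c j)" using i by (simp add: prod.remove)
    also have "\<dots> \<le> 1 / C * (\<Prod>j\<in>{..<n} - {i}. max 1 (d j))"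
    proof (rule mult_mono)
      show "(\<Prod>j\<in>{..<n} - {i}. c j) \<le> (\<Prod>j\<in>{..<n} - {i}. max 1 (d j))"
      proof (rule prod_mono)
        fix j show "0 \<le> c j \<and> c j \<le> max 1 (d j)" using c(1)[of j] C1 by (auto simp: c_def)
      qed
    qed (use i C1 in \<open>auto simp: c_def[of i] intro!: prod_nonneg less_imp_le[OF c(1)]\<close>)
    also have "(\<Prod>j\<in>{..<n} - {i}. max 1 (d j)) = C"
      unfolding C_def using i prod.remove[of "{..<n}" i "\<lambda>j. max 1 (d j)"] by simp
    also have "1 / C * C = 1" using C1 by simp
    finally show ?thesis .
  next
    case False
    hence "(\<Prod>i<n. c i) = D n w" unfolding D_def by (intro prod.cong) (auto simp: c_def d_def)
    thus ?thesis using D1 by simp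
  qed
  have "poly Q ((f ^^ i) w) \<noteq> 0 \<and> 0 < c i \<and> absv (df ((f ^^ i) w)) \<le> c i" for i
    using Jc_forward(1)[OF Jc_iterate[OF w]] c[of i] by (simp add: d_def)
  from iterate_lipschitz[OF this, of n] obtain r where r: "0 < r"
    "\<And>i z z'. i \<le> n \<Longrightarrow> absv (z - w) < r \<Longrightarrow> absv (z' - w) < r \<Longrightarrow>
     (\<forall>j<i. poly Q ((f ^^ j) z) \<noteq> 0) \<and> absv ((f ^^ i) z - (f ^^ i) z') \<le> (\<Prod>j<i. c j) * absv (z - z')" by blast
  define A where "A = (\<Sum>i\<le>n. \<Prod>j<i. c j)"
  have A: "(\<Prod>j<i. c j) \<le> A" if "i \<le> n" for i
    unfolding A_def using that by (intro member_le_sum) (auto intro!: prod_nonneg less_imp_le[OF c(1)])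
  have mul: "absv ((f ^^ (n * k)) z - (f ^^ (n * k)) z') \<le> absv (z - z') \<and> absv ((f ^^ (n * k)) z - w) < r"
    if "absv (z - w) < r" "absv (z' - w) < r" for k z z'
    using that
  proof (induction k arbitrary: z z')
    case (Suc k)
    have one: "absv ((f ^^ n) u - (f ^^ n) u') \<le> absv (u - u')" if "absv (u - w) < r" "absv (u' - w) < r" for u u'
    proof -
      have "absv ((f ^^ n) u - (f ^^ n) u') \<le> (\<Prod>j<n. c j) * absv (u - u')" using r(2)[OF order_refl that] by blast
      also have "\<dots> \<le> 1 * absv (u - u')" using prodle by (intro mult_right_mono) auto
      finally show ?thesis by simp
    qed
    have b: "absv ((f ^^ n) u - w) < r" if "absv (u - w) < r" for u
      using one[OF that, of w] that r(1) n(2) by simp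
    have eq: "(f ^^ (n * Suc k)) u = (f ^^ (n * k)) ((f ^^ n) u)" for u
      by (simp add: funpow_add add.commute[of n])
    show ?case using Suc.IH[OF b[OF Suc.prems(1)] b[OF Suc.prems(2)]] one[OF Suc.prems] unfolding eq by linarith
  qed simp
  have split: "(f ^^ N) u = (f ^^ (N mod n)) ((f ^^ (n * (N div n))) u)" for N u
    using funpow_add[of "N mod n" "n * (N div n)" f] by (simp add: fun_eq_iff)
  have "w \<notin> Jc"
  proof (rule Fatou_criterion[OF r(1), of _ A])
    fix N u assume u: "absv (u - w) < r"
    show "poly Q ((f ^^ N) u) \<noteq> 0" unfolding split[of N]
      using r(2)[OF order_refl conjunct2[OF mul[OF u u]] conjunct2[OF mul[OF u u]]] n(1) by simp
    fix v assume v: "absv (v - w) < r"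
    let ?u = "(f ^^ (n * (N div n))) u" and ?v = "(f ^^ (n * (N div n))) v"
    have le: "N mod n \<le> n" using n(1) by (simp add: less_imp_le)
    have "absv ((f ^^ N) u - (f ^^ N) v) \<le> (\<Prod>j<N mod n. c j) * absv (?u - ?v)"
      unfolding split[of N] using r(2)[OF le conjunct2[OF mul[OF u u]] conjunct2[OF mul[OF v v]]] by blast
    also have "\<dots> \<le> A * absv (u - v)"
      using A[OF le] mul[OF u v] by (intro mult_mono) (auto simp: A_def intro!: sum_nonneg prod_nonneg less_imp_le[OF c(1)])
    finally show "absv ((f ^^ N) u - (f ^^ N) v) \<le> A * absv (u - v)" .
  qed
  thus False using w by simp
qed

lemma univalent_exists:
  assumes "\<And>i. i < n \<Longrightarrow> poly Q ((f ^^ i) w) \<noteq> 0 \<and> df ((f ^^ i) w) \<noteq> 0"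
  shows "\<exists>r>0. univalent n w r"
  using assms
proof (induction n)
  case 0
  show ?case by (intro exI[of _ 1]) auto
next
  case (Suc n)
  then obtain r where r: "0 < r" "univalent n w r" by auto
  obtain t where t: "0 < t" "lin ((f ^^ n) w) t"
    using lin_noncritical[of "(f ^^ n) w"] Suc.prems[of n] by auto
  have D: "0 < D n w" using univalent_main(1)[OF r(2)] .
  define r' where "r' = min r (t / D n w)"
  have r': "0 < r'" "r' \<le> r" using r t D by (auto simp: r'_def)
  have "r' * D n w \<le> t / D n w * D n w" using D by (intro mult_right_mono) (auto simp: r'_def)
  hence "r' * D n w \<le> t" using D by simp
  hence "lin ((f ^^ n) w) (r' * D n w)" using r' D by (intro lin_shrink[OF t(2)]) auto
  thus ?case using univalent_shrink[OF r(2) r'] r' by (auto simp: univalent_Suc)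
qed

text \<open>Points close to \<open>w\<close> are carried away, injectively on a ball of comparable size, to a definite distance.\<close>
definition escapes :: "'a \<Rightarrow> bool" where
  "escapes w \<longleftrightarrow> (\<exists>\<delta>>0. \<exists>\<kappa>>0. \<exists>\<eta>>0. \<forall>b. b \<noteq> w \<longrightarrow> absv (b - w) < \<delta> \<longrightarrow>
     (\<exists>k. univalent k b (\<kappa> * absv (b - w)) \<and> \<eta> \<le> D k b * absv (b - w)))"

text \<open>The return map multiplies the distance to \<open>w\<close> by \<open>M > 1\<close> as
  long as it stays below \<open>r\<close>. The ball of radius \<open>absv (b - w)\<close> about
  \<open>b\<close> grows at the same rate, so the iterate remains univalent on it until the distance
  first reaches \<open>r\<close>; hence the constant 1 in the radius.\<close>

lemma escapes_periodic:
  assumes w: "w \<in> Jc" and n: "0 < n" "(f ^^ n) w = w"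
  shows "escapes w"
proof -
  define M where "M = D n w"
  have M: "1 < M" unfolding M_def by (rule periodic_repelling[OF assms])
  have "df ((f ^^ i) w) \<noteq> 0" if "i < n" for i
  proof
    assume "df ((f ^^ i) w) = 0"
    hence "D n w = 0" unfolding D_def using that by (intro prod_zero) auto
    thus False using M by (simp add: M_def)
  qed
  then obtain r where r: "0 < r" "univalent n w r"
    using univalent_exists[of n w] Jc_forward(1)[OF Jc_iterate[OF w]] by blast
  have key: "(\<forall>i<j. M ^ i * absv (b - w) < r) \<Longrightarrow>
      univalent (n * j) b (absv (b - w)) \<and> D (n * j) b = M ^ j \<and> absv ((f ^^ (n * j)) b - w) = M ^ j * absv (b - w)"
    if b: "b \<noteq> w" for b j
  proof (induction j)
    case (Suc j)
    define b' where "b' = (f ^^ (n * j)) b"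
    have IH: "univalent (n * j) b (absv (b - w))" "D (n * j) b = M ^ j" "absv (b' - w) = M ^ j * absv (b - w)"
      using Suc by (auto simp: b'_def)
    have b'r: "absv (b' - w) < r" using Suc.prems IH(3) by simp
    have "0 < absv (b - w) * M ^ j" using b M by simp
    hence "univalent n b' (absv (b - w) * M ^ j)"
      using b'r IH(3) by (intro univalent_recenter[OF r(2) b'r]) (auto simp: mult.commute)
    hence "univalent (n * j + n) b (absv (b - w))"
      using IH by (intro univalent_append) (auto simp: b'_def)
    moreover have "D (n * j + n) b = M ^ j * M"
      using univalent_main(3)[OF r(2) b'r] IH(2) by (simp add: D_add b'_def[symmetric] M_def)
    moreover have "absv ((f ^^ (n * j + n)) b - w) = M * absv (b' - w)"
    proof -
      have "(f ^^ (n * j + n)) b = (f ^^ n) b'" unfolding b'_def by (simp add: funpow_add add.commute[of _ n])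
      thus ?thesis using univalent_main(2)[OF r(2) b'r, of w] r(1) n(2) by (simp add: M_def)
    qed
    ultimately show ?case using IH(3) by (simp add: add.commute mult_ac)
  qed (use b in auto)
  show ?thesis unfolding escapes_def
  proof (rule exI[of _ r], intro conjI r(1), rule exI[of _ 1], intro conjI, simp, rule exI[of _ r], intro conjI allI impI r(1))
    fix b assume b: "b \<noteq> w" "absv (b - w) < r"
    have "\<exists>j. r \<le> M ^ j * absv (b - w)"
    proof -
      obtain j where "r / absv (b - w) < M ^ j" using real_arch_pow[OF M] by blast
      thus ?thesis using b by (intro exI[of _ j]) (simp add: field_simps)
    qed
    define j where "j = (LEAST j. r \<le> M ^ j * absv (b - w))"
    have j: "r \<le> M ^ j * absv (b - w)" unfolding j_def using \<open>\<exists>j. _\<close> by (rule LeastI_ex)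
    have "M ^ i * absv (b - w) < r" if "i < j" for i
      using not_less_Least[of i "\<lambda>j. r \<le> M ^ j * absv (b - w)"] that unfolding j_def by simp
    hence "univalent (n * j) b (absv (b - w)) \<and> D (n * j) b = M ^ j" using key[OF b(1), of j] by blast
    thus "\<exists>k. univalent k b (1 * absv (b - w)) \<and> r \<le> D k b * absv (b - w)"
      using j by (intro exI[of _ "n * j"]) simp
  qed
qed

text \<open>By \<open>local_mono\<close> the first step is linear on a ball about \<open>b\<close>
  of radius proportional to \<open>absv (b - w)\<close>. Its image has radius proportional to
  \<open>absv (f b - f w)\<close>, so the escape of \<open>f b\<close> from \<open>f w\<close> can
  be appended.\<close>

lemma escapes_preimage:
  assumes Q: "poly Q w \<noteq> 0" and "escapes (f w)"
  shows "escapes w"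
proof -
  obtain \<delta>' \<kappa>' \<eta>' where e: "0 < \<delta>'" "0 < \<kappa>'" "0 < \<eta>'" "\<And>b. b \<noteq> f w \<Longrightarrow> absv (b - f w) < \<delta>' \<Longrightarrow>
     \<exists>k. univalent k b (\<kappa>' * absv (b - f w)) \<and> \<eta>' \<le> D k b * absv (b - f w)"
    using assms(2) unfolding escapes_def by blast
  obtain a \<delta> where a: "0 < \<delta>" "\<delta> \<le> 1" "a \<noteq> 0"
    "\<And>b. absv (b - w) < \<delta> \<Longrightarrow> absv (f b - f w) = absv a * absv (b - w) ^ mult w"
    "\<And>b. b \<noteq> w \<Longrightarrow> absv (b - w) < \<delta> \<Longrightarrow> absv (df b) = absv (of_nat (mult w)) * absv a * absv (b - w) ^ (mult w - 1)"
    "\<And>b. b \<noteq> w \<Longrightarrow> absv (b - w) < \<delta> \<Longrightarrow> lin b (absv (of_nat (mult w)) / 2 * absv (b - w))"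
    by (rule local_mono[OF Q]) (rule that; assumption)
  define m where "m = absv (of_nat (mult w))"
  have m: "0 < m" "m \<le> 1" using mult_pos[OF Q] absv_of_nat_le by (auto simp: m_def)
  define \<kappa> where "\<kappa> = min (m / 2) \<kappa>'"
  have k: "0 < \<kappa>" "\<kappa> \<le> m / 2" "\<kappa> \<le> \<kappa>'" using m e by (auto simp: \<kappa>_def)
  have ap: "0 < absv a" using a by simp
  show ?thesis unfolding escapes_def
  proof (rule exI[of _ "min \<delta> (\<delta>' / absv a)"], intro conjI, simp add: a e, rule exI[of _ \<kappa>], intro conjI k(1),
      rule exI[of _ "m * \<eta>'"], intro conjI allI impI)
    show "0 < m * \<eta>'" using m e by simp
    fix b assume b: "b \<noteq> w" "absv (b - w) < min \<delta> (\<delta>' / absv a)"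
    define \<rho> where "\<rho> = absv (b - w)"
    have \<rho>: "0 < \<rho>" "\<rho> < \<delta>" "\<rho> < \<delta>' / absv a" using b by (auto simp: \<rho>_def)
    have fb: "absv (f b - f w) = absv a * \<rho> ^ mult w" using a(4)[of b] \<rho> by (simp add: \<rho>_def)
    have "\<rho> ^ mult w \<le> \<rho> ^ 1" using \<rho> a(2) mult_pos[OF Q] by (intro power_decreasing) auto
    hence "absv a * \<rho> ^ mult w \<le> absv a * \<rho>" using ap by simp
    also have "\<dots> < \<delta>'" using \<rho>(3) ap by (simp add: field_simps)
    finally have fbd: "absv (f b - f w) < \<delta>'" using fb by simp
    have fb0: "0 < absv (f b - f w)" using fb \<rho> ap by simp
    hence "f b \<noteq> f w" by auto
    then obtain k where kk: "univalent k (f b) (\<kappa>' * absv (f b - f w))" "\<eta>' \<le> D k (f b) * absv (f b - f w)"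
      using e(4) fbd by blast
    have linb: "lin b (m / 2 * \<rho>)" using a(6)[of b] b \<rho> by (simp add: m_def \<rho>_def)
    have "\<rho> ^ mult w = \<rho> * \<rho> ^ (mult w - 1)" using mult_pos[OF Q] by (simp flip: power_Suc)
    hence dfb: "absv (df b) * \<rho> = m * absv (f b - f w)"
      using a(5)[of b] b \<rho> fb by (simp add: m_def \<rho>_def)
    have "lin b (\<kappa> * \<rho>)" using k \<rho> by (intro lin_shrink[OF linb]) auto
    hence ok1: "univalent 1 b (\<kappa> * \<rho>)" using k \<rho> by (simp add: univalent_def)
    \<comment> \<open>One step turns the radius \<open>\<kappa> * \<rho>\<close> into one that fits
      the ball on which \<open>f b\<close> escapes; this fixes \<open>\<kappa>\<close> as the
      smaller of \<open>m / 2\<close> and \<open>\<kappa>'\<close>.\<close>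
    have sz: "\<kappa> * \<rho> * D 1 b = \<kappa> * (m * absv (f b - f w))"
      using dfb by (simp add: D_Suc mult_ac)
    have "\<kappa> * (m * absv (f b - f w)) \<le> \<kappa>' * (1 * absv (f b - f w))"
      using k m e by (intro mult_mono) auto
    hence le: "\<kappa> * (m * absv (f b - f w)) \<le> \<kappa>' * absv (f b - f w)" by simp
    have "0 < \<kappa> * (m * absv (f b - f w))" using k m fb0 by (intro mult_pos_pos)
    from univalent_shrink[OF kk(1) this le] have "univalent k ((f ^^ 1) b) (\<kappa> * \<rho> * D 1 b)"
      unfolding sz by simp
    hence "univalent (1 + k) b (\<kappa> * \<rho>)" by (rule univalent_append[OF ok1])
    moreover have "m * \<eta>' \<le> D (1 + k) b * \<rho>"
    proof -
      have "D (1 + k) b * \<rho> = m * (D k (f b) * absv (f b - f w))"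
        using dfb by (simp add: D_Suc' mult_ac)
      thus ?thesis using kk(2) m by simp
    qed
    ultimately show "\<exists>k. univalent k b (\<kappa> * absv (b - w)) \<and> m * \<eta>' \<le> D k b * absv (b - w)"
      unfolding \<rho>_def by blast
  qed
qed

lemma escapes_eventually_periodic:
  assumes "w \<in> Jc" "0 < n" "(f ^^ (m + n)) w = (f ^^ m) w"
  shows "escapes w"
  using assms
proof (induction m arbitrary: w)
  case 0
  thus ?case using escapes_periodic by simp
next
  case (Suc m)
  have "escapes (f w)"
    using Suc.IH[OF Jc_forward(2)[OF Suc.prems(1)] Suc.prems(2)] Suc.prems(3)
    unfolding add_Suc funpow_Suc_right by simp
  thus ?case using escapes_preimage Jc_forward(1)[OF Suc.prems(1)] by blast
qed

text \<open>Distance to \<open>S\<close> capped at 1; the cap also supplies a value when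
  \<open>S\<close> is empty.\<close>

definition sing_dist :: "'a set \<Rightarrow> 'a \<Rightarrow> real" where
  "sing_dist S b = Min (insert 1 ((\<lambda>w. absv (b - w)) ` S))"

lemma sing_dist:
  assumes "finite S"
  shows "sing_dist S b \<le> 1" "w \<in> S \<Longrightarrow> sing_dist S b \<le> absv (b - w)" "b \<notin> S \<Longrightarrow> 0 < sing_dist S b"
    "sing_dist S b < 1 \<Longrightarrow> \<exists>w\<in>S. sing_dist S b = absv (b - w)"
proof -
  let ?A = "insert 1 ((\<lambda>w. absv (b - w)) ` S)"
  have fin: "finite ?A" using assms by simp
  show "sing_dist S b \<le> 1" "w \<in> S \<Longrightarrow> sing_dist S b \<le> absv (b - w)" unfolding sing_dist_def using fin by (auto intro!: Min_le)
  have "sing_dist S b \<in> ?A" unfolding sing_dist_def using fin by (intro Min_in) auto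
  thus "b \<notin> S \<Longrightarrow> 0 < sing_dist S b" "sing_dist S b < 1 \<Longrightarrow> \<exists>w\<in>S. sing_dist S b = absv (b - w)" by auto
qed

text \<open>Near a point of \<open>S\<close> radii of linearity come from \<open>local_mono\<close>,
  elsewhere from noncriticality. Both dominate a multiple of \<open>sing_dist\<close>, and
  compactness of \<open>Y\<close> makes the multiple uniform.\<close>

lemma uniform_lin:
  assumes Y: "cpt Y" "\<And>y. y \<in> Y \<Longrightarrow> poly Q y \<noteq> 0" and S: "finite S" "\<And>y. y \<in> Y \<Longrightarrow> df y = 0 \<Longrightarrow> y \<in> S"
  obtains \<kappa> where "0 < \<kappa>" "\<And>b. b \<in> Y \<Longrightarrow> b \<notin> S \<Longrightarrow> lin b (\<kappa> * sing_dist S b)"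
proof -
  note sing_dist = sing_dist[OF S(1)]
  have loc: "\<exists>r>0. \<exists>k>0. \<forall>b\<in>Y. absv (b - y) < r \<longrightarrow> b \<in> S \<or> lin b (k * sing_dist S b)" if y: "y \<in> Y" for y
  proof (cases "y \<in> S")
    case True
    obtain \<delta> where a: "0 < \<delta>" "\<And>b. b \<noteq> y \<Longrightarrow> absv (b - y) < \<delta> \<Longrightarrow> lin b (absv (of_nat (mult y)) / 2 * absv (b - y))"
      by (rule local_mono[OF Y(2)[OF y]]) (rule that; assumption)
    have m: "0 < absv (of_nat (mult y)) / 2" using mult_pos[OF Y(2)[OF y]] by simp
    have "b \<in> S \<or> lin b (absv (of_nat (mult y)) / 2 * sing_dist S b)" if "absv (b - y) < \<delta>" for b
    proof (cases "b \<in> S")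
      case False
      hence "b \<noteq> y" using True by blast
      have "0 < sing_dist S b" "sing_dist S b \<le> absv (b - y)" using sing_dist False True by auto
      thus ?thesis using m by (intro disjI2 lin_shrink[OF a(2)[OF \<open>b \<noteq> y\<close> that]] mult_left_mono mult_pos_pos) auto
    qed simp
    thus ?thesis using a(1) m by blast
  next
    case False
    obtain r where r: "0 < r" "lin y r"
      using lin_noncritical[OF Y(2)[OF y]] S(2)[OF y] False by blast
    have "b \<in> S \<or> lin b (r * sing_dist S b)" if "absv (b - y) < r" for b
    proof (cases "b \<in> S")
      case False
      have "0 < sing_dist S b" "sing_dist S b \<le> 1" using sing_dist False by auto
      thus ?thesis using r that by (intro disjI2 lin_recenter(1)[OF r(2) that]) (auto simp: mult_left_le)
    qed simp
    thus ?thesis using r(1) by blast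
  qed
  have mono: "y \<in> S \<or> lin y (k' * sing_dist S y)" if "y \<in> S \<or> lin y (k * sing_dist S y)" "0 < k'" "k' \<le> k" for k k' y
  proof (cases "y \<in> S")
    case False
    hence "0 < sing_dist S y" using sing_dist by blast
    have "lin y (k * sing_dist S y)" using that(1) False by blast
    thus ?thesis using that(2,3) \<open>0 < sing_dist S y\<close> by (intro disjI2) (erule lin_shrink, auto)
  qed simp
  show ?thesis
  proof (rule cpt_uniform[where X = Y and R = "\<lambda>k y. y \<in> S \<or> lin y (k * sing_dist S y)"])
    fix k assume k: "0 < k" "\<And>y. y \<in> Y \<Longrightarrow> y \<in> S \<or> lin y (k * sing_dist S y)"
    show ?thesis
      by (rule that[OF k(1)]) (use k(2) in blast)
  next
    fix y assume "y \<in> Y"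
    thus "\<exists>r>0. \<exists>k>0. \<forall>b\<in>Y. absv (b - y) < r \<longrightarrow> b \<in> S \<or> lin b (k * sing_dist S b)" by (rule loc)
  next
    fix k k' y assume "y \<in> S \<or> lin y (k * sing_dist S y)" "0 < k'" "k' \<le> k"
    thus "y \<in> S \<or> lin y (k' * sing_dist S y)" by (rule mono)
  qed (rule Y(1))
qed

text \<open>A ball about \<open>v\<close> is iterated until its image radius reaches
  \<open>k0\<close> times the distance of the orbit point from \<open>S\<close>. If that distance is
  at least \<open>d\<close>, the image is already large; otherwise the ball is shrunk to fit the
  escape from the nearest point of \<open>S\<close>, which brings it to definite size.\<close>

lemma big_images:
  assumes Y: "cpt Y" "\<And>y. y \<in> Y \<Longrightarrow> poly Q y \<noteq> 0" and S: "finite S" "\<And>y. y \<in> Y \<Longrightarrow> df y = 0 \<Longrightarrow> y \<in> S"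
    and esc: "\<And>w. w \<in> S \<Longrightarrow> escapes w"
  shows "\<exists>\<kappa>>0. \<forall>v\<in>Jc. (\<forall>n. (f ^^ n) v \<in> Y - S) \<longrightarrow>
     (\<forall>s>0. \<exists>s' n. 0 < s' \<and> s' \<le> s \<and> univalent n v s' \<and> \<kappa> \<le> s' * D n v)"
proof -
  note sing_dist = sing_dist[OF S(1)]
  obtain k0 where k0: "0 < k0" "\<And>b. b \<in> Y \<Longrightarrow> b \<notin> S \<Longrightarrow> lin b (k0 * sing_dist S b)"
    using uniform_lin[OF Y S] by blast
  have "\<forall>w\<in>S. \<exists>\<delta> \<kappa> \<eta>. 0 < \<delta> \<and> 0 < \<kappa> \<and> 0 < \<eta> \<and> (\<forall>b. b \<noteq> w \<longrightarrow> absv (b - w) < \<delta> \<longrightarrow>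
     (\<exists>k. univalent k b (\<kappa> * absv (b - w)) \<and> \<eta> \<le> D k b * absv (b - w)))"
    using esc unfolding escapes_def by blast
  then obtain \<delta> \<kappa> \<eta> where e: "\<And>w. w \<in> S \<Longrightarrow> 0 < \<delta> w \<and> 0 < \<kappa> w \<and> 0 < \<eta> w"
    "\<And>w b. w \<in> S \<Longrightarrow> b \<noteq> w \<Longrightarrow> absv (b - w) < \<delta> w \<Longrightarrow>
     \<exists>k. univalent k b (\<kappa> w * absv (b - w)) \<and> \<eta> w \<le> D k b * absv (b - w)"
    by metis
  define d where "d = Min (insert 1 (\<delta> ` S))"
  have d: "0 < d" "d \<le> 1" "\<And>w. w \<in> S \<Longrightarrow> d \<le> \<delta> w"
    unfolding d_def using S(1) e(1) by (auto intro!: Min_le)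
  define k1 where "k1 w = min (\<kappa> w) k0" for w
  define K where "K = Min (insert (k0 * d) ((\<lambda>w. k1 w * \<eta> w) ` S))"
  have K: "0 < K" "K \<le> k0 * d" "\<And>w. w \<in> S \<Longrightarrow> K \<le> k1 w * \<eta> w"
    unfolding K_def using S(1) e(1) k0 d by (auto intro!: Min_le simp: k1_def)
  have "\<exists>s' n. 0 < s' \<and> s' \<le> s \<and> univalent n v s' \<and> K \<le> s' * D n v"
    if v: "v \<in> Jc" and orb: "\<And>n. (f ^^ n) v \<in> Y - S" and s: "0 < s" for v s
  proof -
    let ?b = "\<lambda>n. (f ^^ n) v"
    have lin: "lin (?b n) (k0 * sing_dist S (?b n))" for n using k0(2) orb by blast
    have okn: "univalent n v s" if "\<forall>i<n. s * D i v < k0 * sing_dist S (?b i)" for n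
      using that
    proof (induction n)
      case (Suc n)
      hence "univalent n v s" by simp
      moreover from this have "0 < s * D n v" using univalent_main(1) s by simp
      ultimately show ?case using Suc.prems by (auto simp: univalent_Suc intro!: lin_shrink[OF lin])
    qed (use s in simp)
    \<comment> \<open>If the image radius never caught up, all iterates would be univalent on one
      ball with bounded derivatives, and \<open>v\<close> would be a Fatou point.\<close>
    have ex: "\<exists>n. k0 * sing_dist S (?b n) \<le> s * D n v"
    proof (rule ccontr)
      assume "\<not> ?thesis"
      hence lt: "s * D n v < k0 * sing_dist S (?b n)" for n by (simp add: not_le)
      hence univalent: "univalent n v s" for n using okn by blast
      have Db: "D n v \<le> k0 / s" for n
      proof -
        have "s * D n v \<le> k0 * 1" using lt[of n] mult_left_mono[OF sing_dist(1)[of "?b n"], of k0] k0(1) by linarith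
        thus ?thesis using s by (simp add: field_simps)
      qed
      have "v \<notin> Jc"
      proof (rule Fatou_criterion[OF s, of v "k0 / s"])
        fix n u assume u: "absv (u - v) < s"
        show "poly Q ((f ^^ n) u) \<noteq> 0" using univalent_main(4)[OF univalent[of "Suc n"] u] by simp
        fix w assume w: "absv (w - v) < s"
        show "absv ((f ^^ n) u - (f ^^ n) w) \<le> k0 / s * absv (u - w)"
          unfolding univalent_main(2)[OF univalent u w] using Db by (intro mult_right_mono) auto
      qed
      thus False using v by simp
    qed
    define n where "n = (LEAST n. k0 * sing_dist S (?b n) \<le> s * D n v)"
    have n: "k0 * sing_dist S (?b n) \<le> s * D n v" unfolding n_def by (rule LeastI_ex[OF ex])
    have "\<forall>i<n. s * D i v < k0 * sing_dist S (?b i)"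
      using not_less_Least unfolding n_def by (auto simp: not_le[symmetric])
    hence univalent: "univalent n v s" by (rule okn)
    have Dn: "0 < D n v" using univalent_main(1)[OF univalent] .
    show ?thesis
    proof (cases "d \<le> sing_dist S (?b n)")
      case True
      have "K \<le> k0 * d" by (rule K)
      also have "\<dots> \<le> k0 * sing_dist S (?b n)" using True k0 by simp
      also have "\<dots> \<le> s * D n v" by (rule n)
      finally show ?thesis using univalent s by blast
    next
      case False
      then obtain w where w: "w \<in> S" "sing_dist S (?b n) = absv (?b n - w)" using sing_dist(4)[of "?b n"] d by auto
      have bw: "?b n \<noteq> w" using orb w(1) by blast
      have "absv (?b n - w) < \<delta> w" using False w d(3)[OF w(1)] by simp
      from e(2)[OF w(1) bw this] obtain k where k: "univalent k (?b n) (\<kappa> w * absv (?b n - w))" "\<eta> w \<le> D k (?b n) * absv (?b n - w)" by blast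
      define \<sigma>' where "\<sigma>' = absv (?b n - w)"
      have \<sigma>': "0 < \<sigma>'" using bw by (simp add: \<sigma>'_def)
      have k1: "0 < k1 w" "k1 w \<le> \<kappa> w" "k1 w \<le> k0" using e(1)[OF w(1)] k0(1) by (auto simp: k1_def)
      \<comment> \<open>The radius whose image after \<open>n\<close> steps is \<open>k1 w\<close>
        times the distance to \<open>w\<close>, small enough for the escape.\<close>
      define s' where "s' = k1 w * \<sigma>' / D n v"
      have s'D: "s' * D n v = k1 w * \<sigma>'" using Dn by (simp add: s'_def)
      have s'0: "0 < s'" using k1 \<sigma>' Dn by (simp add: s'_def)
      have "k1 w * \<sigma>' \<le> k0 * \<sigma>'" using k1 \<sigma>' by simp
      also have "\<dots> \<le> s * D n v" using n w(2) by (simp add: \<sigma>'_def)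
      finally have s's: "s' \<le> s" using Dn unfolding s'_def by (simp add: pos_divide_le_eq)
      have "univalent k (?b n) (s' * D n v)"
        unfolding s'D using k1 \<sigma>' by (intro univalent_shrink[OF k(1)]) (auto simp: \<sigma>'_def)
      hence "univalent (n + k) v s'" by (rule univalent_append[OF univalent_shrink[OF univalent s'0 s's]])
      moreover have "K \<le> s' * D (n + k) v"
      proof -
        have "K \<le> k1 w * \<eta> w" using K(3) w(1) by blast
        also have "\<dots> \<le> k1 w * (D k (?b n) * \<sigma>')" using k(2) k1 by (simp add: \<sigma>'_def)
        also have "\<dots> = s' * D n v * D k (?b n)" unfolding s'D by simp
        also have "\<dots> = s' * D (n + k) v" by (simp add: D_add)
        finally show ?thesis .
      qed
      ultimately show ?thesis using s'0 s's by blast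
    qed
  qed
  thus ?thesis using K(1) by (intro exI[of _ K]) simp
qed

end

subsection \<open>The metric of a subhyperbolic map\<close>

lemma powr_unbounded:
  fixes c g B :: real
  assumes "0 < c" "0 < g"
  obtains r where "0 < r" "r \<le> 1" "\<And>t. 0 < t \<Longrightarrow> t < r \<Longrightarrow> B \<le> c * t powr (- g)"
proof -
  define B' where "B' = max B 1 / c"
  have B': "0 < B'" using assms by (simp add: B'_def)
  show ?thesis
  proof (rule that[of "min 1 (B' powr (- 1 / g))"])
    fix t :: real assume t: "0 < t" "t < min 1 (B' powr (- 1 / g))"
    have "(B' powr (- 1 / g)) powr (- g) \<le> t powr (- g)"
      using t assms by (intro powr_mono2') auto
    hence "B' \<le> t powr (- g)" using assms B' by (simp add: powr_powr)
    hence "c * B' \<le> c * t powr (- g)" using assms by simp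
    moreover have "c * B' = max B 1" using assms by (simp add: B'_def)
    ultimately show "B \<le> c * t powr (- g)" by simp
  qed (use B' in auto)
qed

context dyn
begin

lemma orbit_finite:
  assumes "0 < n" "(f ^^ (m + n)) c = (f ^^ m) c"
  shows "finite (range (\<lambda>k. (f ^^ k) c))"
proof -
  have "(f ^^ k) c \<in> (\<lambda>i. (f ^^ i) c) ` {..<m + n}" for k
  proof (induction k rule: less_induct)
    case (less k)
    show ?case
    proof (cases "k < m + n")
      case False
      define j where "j = k - (m + n)"
      have k: "k = j + (m + n)" using False by (simp add: j_def)
      have "(f ^^ k) c = (f ^^ j) ((f ^^ (m + n)) c)" unfolding k by (simp only: funpow_add o_apply)
      also have "\<dots> = (f ^^ (j + m)) c" unfolding assms(2) by (simp only: funpow_add o_apply)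
      finally show ?thesis using less.IH[of "j + m"] assms(1) k by simp
    qed simp
  qed
  hence "range (\<lambda>k. (f ^^ k) c) \<subseteq> (\<lambda>i. (f ^^ i) c) ` {..<m + n}" by blast
  thus ?thesis using finite_surj[of "{..<m + n}"] by blast
qed

end

locale subhyp = dyn +
  fixes L :: "'a set"
  assumes heine_borel_L: "heine_borel L" and sfL: "is_subfield L" and overL: "over L P" "over L Q"
    and preperiodic: "\<And>c. c \<in> Jc \<Longrightarrow> df c = 0 \<Longrightarrow> \<exists>m n. 0 < n \<and> (f ^^ (m + n)) c = (f ^^ m) c"
begin

section \<open>The critical orbits in J \<inter> L\<close>

definition X :: "'a set" where "X = Jc \<inter> L"
definition S :: "'a set" where "S = (\<Union>c\<in>{c \<in> X. df c = 0}. range (\<lambda>n. (f ^^ n) c))"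
definition Per :: "'a set" where "Per = {w \<in> S. \<exists>n>0. (f ^^ n) w = w}"

lemma cptX: "cpt X" unfolding X_def by (rule cpt_Jc[OF heine_borel_L])

lemma fL: "x \<in> L \<Longrightarrow> f x \<in> L"
  using sfL overL by (auto simp: f_def intro!: subfield_simps over_poly)

lemma X_forward: "x \<in> X \<Longrightarrow> f x \<in> X" "x \<in> X \<Longrightarrow> poly Q x \<noteq> 0" "x \<in> X \<Longrightarrow> x \<in> Jc"
  using fL Jc_forward by (auto simp: X_def)

lemma X_iterate: "x \<in> X \<Longrightarrow> (f ^^ n) x \<in> X"
  by (induction n) (auto simp: X_forward)

lemma S_subset: "S \<subseteq> X"
  using X_iterate by (auto simp: S_def)

lemma S_forward: "w \<in> S \<Longrightarrow> f w \<in> S"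
proof -
  assume "w \<in> S"
  then obtain c n where "c \<in> X" "df c = 0" "w = (f ^^ n) c" by (auto simp: S_def)
  thus "f w \<in> S" unfolding S_def by (auto intro!: bexI[of _ c] image_eqI[of _ _ "Suc n"])
qed

lemma S_iterate: "w \<in> S \<Longrightarrow> (f ^^ n) w \<in> S"
  by (induction n) (auto simp: S_forward)

lemma critical_in_S: "x \<in> X \<Longrightarrow> df x = 0 \<Longrightarrow> x \<in> S"
  unfolding S_def by (auto intro!: bexI[of _ x] image_eqI[of _ _ 0])

text \<open>By \<open>local_mono\<close> the derivative does not vanish on a punctured ball about
  any point of \<open>X\<close>, so each ball of a finite cover contains at most its centre as
  critical point.\<close>

lemma finite_critical: "finite {c \<in> X. df c = 0}"
proof -
  have "\<exists>r>0. \<forall>b. b \<noteq> x \<longrightarrow> absv (b - x) < r \<longrightarrow> df b \<noteq> 0" if x: "x \<in> X" for x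
  proof -
    obtain \<delta> where a: "0 < \<delta>" "\<And>b. b \<noteq> x \<Longrightarrow> absv (b - x) < \<delta> \<Longrightarrow> lin b (absv (of_nat (mult x)) / 2 * absv (b - x))"
      by (rule local_mono[OF X_forward(2)[OF x]]) (rule that; assumption)
    thus ?thesis using linD(2) by (metis absv_0 less_irrefl)
  qed
  then obtain r where r: "\<And>x. x \<in> X \<Longrightarrow> 0 < r x" "\<And>x b. x \<in> X \<Longrightarrow> b \<noteq> x \<Longrightarrow> absv (b - x) < r x \<Longrightarrow> df b \<noteq> 0"
    by metis
  obtain T where T: "finite T" "T \<subseteq> X" "\<And>y. y \<in> X \<Longrightarrow> \<exists>x\<in>T. absv (y - x) < r x"
    using cpt_cover[OF cptX, of r] r(1) by metis
  have "c \<in> T" if c: "c \<in> X" "df c = 0" for c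
  proof -
    obtain x where "x \<in> T" "absv (c - x) < r x" using T(3)[OF c(1)] by blast
    moreover from this have "c = x" using r(2)[of x c] T(2) c(2) by blast
    ultimately show ?thesis by simp
  qed
  hence "{c \<in> X. df c = 0} \<subseteq> T" by blast
  thus ?thesis using T(1) finite_subset by blast
qed

lemma finite_S: "finite S"
  unfolding S_def
proof (intro finite_UN_I finite_critical)
  fix c assume "c \<in> {c \<in> X. df c = 0}"
  hence "c \<in> Jc" "df c = 0" using X_forward by auto
  then obtain m n where "0 < n" "(f ^^ (m + n)) c = (f ^^ m) c" using preperiodic by blast
  thus "finite (range (\<lambda>k. (f ^^ k) c))" by (rule orbit_finite)
qed

lemma S_preperiodic: "w \<in> S \<Longrightarrow> \<exists>m n. 0 < n \<and> (f ^^ (m + n)) w = (f ^^ m) w"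
proof -
  assume "w \<in> S"
  then obtain c k where c: "c \<in> X" "df c = 0" "w = (f ^^ k) c" by (auto simp: S_def)
  then obtain m n where mn: "0 < n" "(f ^^ (m + n)) c = (f ^^ m) c" using preperiodic X_forward by blast
  have "(f ^^ j) w = (f ^^ k) ((f ^^ j) c)" for j
    unfolding c(3) by (metis add.commute funpow_add o_apply)
  thus ?thesis using mn by metis
qed

lemma S_reaches_Per: "w \<in> S \<Longrightarrow> \<exists>m. (f ^^ m) w \<in> Per"
proof -
  assume w: "w \<in> S"
  then obtain m n where mn: "0 < n" "(f ^^ (m + n)) w = (f ^^ m) w" using S_preperiodic by blast
  have "(f ^^ n) ((f ^^ m) w) = (f ^^ m) w" using mn(2) by (metis add.commute funpow_add o_apply)
  thus ?thesis unfolding Per_def using mn(1) S_iterate[OF w] by blast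
qed

lemma escapes_S: "w \<in> S \<Longrightarrow> escapes w"
  using S_preperiodic S_subset X_forward(3) escapes_eventually_periodic by (metis subsetD)

lemma Per_forward: "w \<in> Per \<Longrightarrow> f w \<in> Per"
proof -
  assume "w \<in> Per"
  then obtain n where "w \<in> S" "0 < n" "(f ^^ n) w = w" by (auto simp: Per_def)
  moreover from this have "(f ^^ n) (f w) = f w" by (metis funpow_swap1)
  ultimately show "f w \<in> Per" using S_forward by (auto simp: Per_def)
qed

lemma Per_noncritical: "w \<in> Per \<Longrightarrow> df w \<noteq> 0"
proof
  assume "w \<in> Per" and df: "df w = 0"
  then obtain n where n: "w \<in> S" "0 < n" "(f ^^ n) w = w" by (auto simp: Per_def)
  hence "1 < D n w" using periodic_repelling S_subset X_forward(3) by blast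
  moreover obtain k where "n = Suc k" using n(2) by (cases n) auto
  ultimately show False using df by (simp add: D_Suc')
qed

text \<open>The choice is \<open>e w = \<Lambda> ^ h w / (2 * \<Lambda> ^ H)\<close>, with
  \<open>h w\<close> the number of steps from \<open>w\<close> to a cycle and
  \<open>\<Lambda>\<close> larger than all local degrees on \<open>S\<close>: each step towards a
  cycle divides the exponent by \<open>\<Lambda>\<close>, and the denominator keeps all values at
  most 1/2.\<close>

lemma exponents:
  obtains e :: "'a \<Rightarrow> real" where "\<And>w. w \<in> S \<Longrightarrow> 0 < e w" "\<And>w. w \<in> S \<Longrightarrow> e w \<le> 1 / 2"
    "\<And>w. w \<in> S \<Longrightarrow> w \<notin> Per \<Longrightarrow> mult w * e (f w) < e w" "\<And>w. w \<in> Per \<Longrightarrow> e (f w) = e w"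
proof -
  define h where "h w = (LEAST m. (f ^^ m) w \<in> Per)" for w
  have h0: "h w = 0" if "w \<in> Per" for w unfolding h_def using that by (intro Least_eq_0) simp
  have hS: "h w = Suc (h (f w))" if w: "w \<in> S" "w \<notin> Per" for w
  proof -
    obtain m where m: "(f ^^ m) w \<in> Per" using S_reaches_Per[OF w(1)] by blast
    have "h w = Suc (LEAST m. (f ^^ Suc m) w \<in> Per)"
      unfolding h_def by (rule Least_Suc[where P = "\<lambda>m. (f ^^ m) w \<in> Per", OF m]) (use w in simp)
    thus ?thesis unfolding h_def funpow_Suc_right by simp
  qed
  define \<Lambda> where "\<Lambda> = 1 + (\<Sum>w\<in>S. real (mult w))"
  have \<Lambda>1: "1 \<le> \<Lambda>" by (simp add: \<Lambda>_def sum_nonneg)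
  have \<Lambda>: "mult w < \<Lambda>" if "w \<in> S" for w
    using member_le_sum[of w S "\<lambda>w. real (mult w)"] that finite_S by (simp add: \<Lambda>_def)
  define H where "H = Max (h ` S)"
  have hH: "h w \<le> H" if "w \<in> S" for w unfolding H_def using that finite_S by simp
  define e where "e w = \<Lambda> ^ h w / (2 * \<Lambda> ^ H)" for w
  show ?thesis
  proof (rule that[of e])
    fix w assume w: "w \<in> S"
    show "0 < e w" using \<Lambda>1 by (simp add: e_def)
    have "\<Lambda> ^ h w \<le> \<Lambda> ^ H" using hH[OF w] \<Lambda>1 by (intro power_increasing) auto
    thus "e w \<le> 1 / 2" using \<Lambda>1 by (simp add: e_def field_simps)
    assume "w \<notin> Per"
    hence "e w = \<Lambda> * e (f w)" using hS[OF w] by (simp add: e_def)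
    moreover have "0 < e (f w)" using \<Lambda>1 by (simp add: e_def)
    ultimately show "mult w * e (f w) < e w" using \<Lambda>[OF w] by simp
  next
    fix w assume "w \<in> Per"
    thus "e (f w) = e w" using h0 Per_forward by (simp add: e_def)
  qed
qed

definition e :: "'a \<Rightarrow> real" where
  "e = (SOME e :: 'a \<Rightarrow> real. (\<forall>w\<in>S. 0 < e w) \<and> (\<forall>w\<in>S. e w \<le> 1 / 2) \<and>
     (\<forall>w\<in>S. w \<notin> Per \<longrightarrow> mult w * e (f w) < e w) \<and> (\<forall>w\<in>Per. e (f w) = e w))"

lemma e: "w \<in> S \<Longrightarrow> 0 < e w" "w \<in> S \<Longrightarrow> e w \<le> 1 / 2"
    "w \<in> S \<Longrightarrow> w \<notin> Per \<Longrightarrow> mult w * e (f w) < e w" "w \<in> Per \<Longrightarrow> e (f w) = e w"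
proof -
  have ex: "\<exists>g::'a \<Rightarrow> real. (\<forall>w\<in>S. 0 < g w) \<and> (\<forall>w\<in>S. g w \<le> 1 / 2) \<and>
     (\<forall>w\<in>S. w \<notin> Per \<longrightarrow> mult w * g (f w) < g w) \<and> (\<forall>w\<in>Per. g (f w) = g w)"
  proof (rule exponents)
    fix g :: "'a \<Rightarrow> real"
    assume "\<And>w. w \<in> S \<Longrightarrow> 0 < g w" "\<And>w. w \<in> S \<Longrightarrow> g w \<le> 1 / 2"
      "\<And>w. w \<in> S \<Longrightarrow> w \<notin> Per \<Longrightarrow> mult w * g (f w) < g w" "\<And>w. w \<in> Per \<Longrightarrow> g (f w) = g w"
    thus "\<exists>g::'a \<Rightarrow> real. (\<forall>w\<in>S. 0 < g w) \<and> (\<forall>w\<in>S. g w \<le> 1 / 2) \<and>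
     (\<forall>w\<in>S. w \<notin> Per \<longrightarrow> mult w * g (f w) < g w) \<and> (\<forall>w\<in>Per. g (f w) = g w)"
      by (intro exI[of _ g]) simp
  qed
  have "(\<forall>w\<in>S. 0 < e w) \<and> (\<forall>w\<in>S. e w \<le> 1 / 2) \<and>
     (\<forall>w\<in>S. w \<notin> Per \<longrightarrow> mult w * e (f w) < e w) \<and> (\<forall>w\<in>Per. e (f w) = e w)"
    using someI_ex[OF ex] unfolding e_def .
  thus "w \<in> S \<Longrightarrow> 0 < e w" "w \<in> S \<Longrightarrow> e w \<le> 1 / 2"
    "w \<in> S \<Longrightarrow> w \<notin> Per \<Longrightarrow> mult w * e (f w) < e w" "w \<in> Per \<Longrightarrow> e (f w) = e w" by blast+
qed

lemma e_mult: "w \<in> S \<Longrightarrow> mult w * e (f w) \<le> e w"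
proof (cases "w \<in> Per")
  case True
  assume w: "w \<in> S"
  have "mult w = 1" using Per_noncritical[OF True] mult_eq_1_iff X_forward(2) S_subset w by blast
  thus ?thesis using e(4)[OF True] by simp
qed (use e(3) in force)

text \<open>At a point of \<open>S\<close> the singular summand has the default value
  \<open>0 powr x = 0\<close>, so \<open>R0\<close> shows no pole there; the value \<infinity> is
  assigned separately in \<open>expanding_metric\<close>. The summand 1 keeps the weight bounded
  below.\<close>

definition R0 :: "'a \<Rightarrow> real" where
  "R0 z = 1 + (\<Sum>w\<in>S. absv (z - w) powr (e w - 1))"

lemma R0_ge_1: "1 \<le> R0 z" by (simp add: R0_def sum_nonneg)

lemma R0_lower: "w \<in> S \<Longrightarrow> absv (z - w) powr (e w - 1) \<le> R0 z"
  using member_le_sum[of w S "\<lambda>w. absv (z - w) powr (e w - 1)"] finite_S by (simp add: R0_def)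

lemma R0_const:
  assumes "z \<notin> S"
  obtains r where "0 < r" "\<And>u. absv (u - z) < r \<Longrightarrow> u \<notin> S" "\<And>u. absv (u - z) < r \<Longrightarrow> R0 u = R0 z"
proof -
  have eq: "absv (u - w) = absv (z - w)" if "absv (u - z) < sing_dist S z" "w \<in> S" for u w
  proof (rule absv_eq_if_close)
    show "absv (u - w - (z - w)) < absv (z - w)" using that sing_dist(2)[OF finite_S that(2), of z] by simp
  qed
  show ?thesis
  proof (rule that[of "sing_dist S z"])
    show "0 < sing_dist S z" using sing_dist(3)[OF finite_S assms] .
    fix u assume u: "absv (u - z) < sing_dist S z"
    show "u \<notin> S" using eq[OF u, of u] assms by auto
    show "R0 u = R0 z" unfolding R0_def using eq[OF u] by (intro arg_cong[of _ _ "\<lambda>x. 1 + x"] sum.cong) auto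
  qed
qed

text \<open>Near \<open>a\<close> the other summands are constant, and a constant is dominated by
  the singular summand, which is at least 1 at distances below 1.\<close>

lemma R0_upper:
  assumes a: "a \<in> S"
  obtains r C where "0 < r" "r \<le> 1" "0 < C" "\<And>z. z \<noteq> a \<Longrightarrow> absv (z - a) < r \<Longrightarrow> z \<notin> S"
    "\<And>z. z \<noteq> a \<Longrightarrow> absv (z - a) < r \<Longrightarrow> R0 z \<le> C * absv (z - a) powr (e a - 1)"
proof -
  let ?S = "S - {a}"
  have fin: "finite ?S" using finite_S by simp
  define r where "r = sing_dist ?S a"
  have r: "0 < r" "r \<le> 1" unfolding r_def using sing_dist(1,3)[OF fin] by auto
  have eq: "absv (u - w) = absv (a - w)" if "absv (u - a) < r" "w \<in> ?S" for u w
  proof (rule absv_eq_if_close)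
    show "absv (u - w - (a - w)) < absv (a - w)" using that sing_dist(2)[OF fin that(2), of a] by (simp add: r_def)
  qed
  define c where "c = 1 + (\<Sum>w\<in>?S. absv (a - w) powr (e w - 1))"
  have c: "1 \<le> c" by (simp add: c_def sum_nonneg)
  show ?thesis
  proof (rule that[of r "c + 1"])
    fix z assume z: "z \<noteq> a" "absv (z - a) < r"
    show "z \<notin> S" using eq[OF z(2), of z] z(1) by auto
    have "R0 z = absv (z - a) powr (e a - 1) + c"
      unfolding R0_def c_def using eq[OF z(2)] a finite_S by (simp add: sum.remove)
    also have "c \<le> c * absv (z - a) powr (e a - 1)"
    proof -
      have "1 powr (e a - 1) \<le> absv (z - a) powr (e a - 1)"
        using z r e(2)[OF a] by (intro powr_mono2') auto
      thus ?thesis using c by simp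
    qed
    finally show "R0 z \<le> (c + 1) * absv (z - a) powr (e a - 1)" by (simp add: algebra_simps)
  qed (use r c in auto)
qed

section \<open>Local degrees of iterates and the pulled-back weight\<close>

definition M :: "nat \<Rightarrow> 'a \<Rightarrow> nat" where "M i x = (\<Prod>j<i. mult ((f ^^ j) x))"

lemma M_pos: "x \<in> X \<Longrightarrow> 0 < M i x"
  unfolding M_def using mult_pos X_forward(2) X_iterate by (simp add: prod_pos)

lemma M_Suc: "M (Suc i) x = M i x * mult ((f ^^ i) x)" by (simp add: M_def)

text \<open>Outside \<open>S\<close> the local degree is 1; once the orbit is in \<open>S\<close>,
  the inequality \<open>e_mult\<close> keeps the product from increasing. The bound 1 means that the
  weight at an orbit point in \<open>S\<close> pulls back to a term that still blows up at
  \<open>x\<close>.\<close>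

lemma M_exponent:
  assumes x: "x \<in> X"
  shows "(f ^^ i) x \<notin> S \<Longrightarrow> M i x = 1" "(f ^^ i) x \<in> S \<Longrightarrow> M i x * e ((f ^^ i) x) < 1"
proof (induction i)
  case 0
  { case 1 show ?case by (simp add: M_def) next
    case 2 thus ?case using e(2) by (force simp: M_def) }
next
  case (Suc i)
  let ?b = "(f ^^ i) x"
  have m1: "mult ?b = 1" if "?b \<notin> S"
    using that critical_in_S mult_eq_1_iff[of ?b] X_iterate[OF x, of i] X_forward(2) by blast
  { case 1
    hence "?b \<notin> S" using S_forward by auto
    thus ?case using m1 Suc.IH(1) by (simp add: M_Suc)
  next
    case 2
    show ?case
    proof (cases "?b \<in> S")
      case True
      have "M i x * (mult ?b * e (f ?b)) \<le> M i x * e ?b"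
        using e_mult[OF True] by (intro mult_left_mono) auto
      thus ?thesis using Suc.IH(2)[OF True] by (simp add: M_Suc mult_ac)
    next
      case False
      thus ?thesis using m1 Suc.IH(1) e(2)[OF 2] by (simp add: M_Suc)
    qed }
qed

text \<open>Composition of the exact monomial formulas of \<open>local_mono\<close>; distances
  compose to the power \<open>M i x\<close>, and the chain rule adds up the derivative exponents to
  \<open>M i x - 1\<close>.\<close>

lemma iter_local:
  assumes x: "x \<in> X"
  shows "\<exists>A C \<delta>. 0 < A \<and> 0 < C \<and> 0 < \<delta> \<and> \<delta> \<le> 1 \<and> (\<forall>z. z \<noteq> x \<longrightarrow> absv (z - x) < \<delta> \<longrightarrow>
     (\<forall>j<i. poly Q ((f ^^ j) z) \<noteq> 0 \<and> df ((f ^^ j) z) \<noteq> 0) \<and>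
     absv ((f ^^ i) z - (f ^^ i) x) = A * absv (z - x) ^ M i x \<and> D i z = C * absv (z - x) ^ (M i x - 1))"
proof (induction i)
  case 0
  show ?case by (rule exI[of _ 1])+ (auto simp: M_def)
next
  case (Suc i)
  then obtain A C \<delta> where IH: "0 < A" "0 < C" "0 < \<delta>" "\<delta> \<le> 1"
    "\<And>z j. z \<noteq> x \<Longrightarrow> absv (z - x) < \<delta> \<Longrightarrow> j < i \<Longrightarrow> poly Q ((f ^^ j) z) \<noteq> 0 \<and> df ((f ^^ j) z) \<noteq> 0"
    "\<And>z. z \<noteq> x \<Longrightarrow> absv (z - x) < \<delta> \<Longrightarrow> absv ((f ^^ i) z - (f ^^ i) x) = A * absv (z - x) ^ M i x"
    "\<And>z. z \<noteq> x \<Longrightarrow> absv (z - x) < \<delta> \<Longrightarrow> D i z = C * absv (z - x) ^ (M i x - 1)" by blast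
  let ?b = "(f ^^ i) x"
  have Qb: "poly Q ?b \<noteq> 0" using X_iterate[OF x] X_forward(2) by blast
  obtain a d where a: "0 < d" "d \<le> 1" "a \<noteq> 0" "\<And>b. absv (b - ?b) < d \<Longrightarrow> poly Q b \<noteq> 0"
    "\<And>b. absv (b - ?b) < d \<Longrightarrow> absv (f b - f ?b) = absv a * absv (b - ?b) ^ mult ?b"
    "\<And>b. b \<noteq> ?b \<Longrightarrow> absv (b - ?b) < d \<Longrightarrow> absv (df b) = absv (of_nat (mult ?b)) * absv a * absv (b - ?b) ^ (mult ?b - 1)"
    by (rule local_mono[OF Qb]) (rule that; assumption)
  define m where "m = absv (of_nat (mult ?b))"
  have m: "0 < m" "0 < absv a" using mult_pos[OF Qb] a(3) by (auto simp: m_def)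
  have M: "0 < M i x" using M_pos[OF x] .
  define \<delta>' where "\<delta>' = min \<delta> (d / A)"
  show ?case
  proof (rule exI[of _ "absv a * A ^ mult ?b"], rule exI[of _ "C * m * absv a * A ^ (mult ?b - 1)"], rule exI[of _ \<delta>'], intro conjI allI impI)
    show "0 < absv a * A ^ mult ?b" "0 < C * m * absv a * A ^ (mult ?b - 1)" using IH m by auto
    show "0 < \<delta>'" "\<delta>' \<le> 1" using IH a by (auto simp: \<delta>'_def)
    fix z assume z: "z \<noteq> x" "absv (z - x) < \<delta>'"
    define t where "t = absv (z - x)"
    have t: "0 < t" "t < \<delta>" "t < d / A" using z by (auto simp: t_def \<delta>'_def)
    have zd: "absv (z - x) < \<delta>" using t by (simp add: t_def)
    have dist: "absv ((f ^^ i) z - ?b) = A * t ^ M i x" using IH(6)[OF z(1) zd] by (simp add: t_def)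
    have "t ^ M i x \<le> t ^ 1" using t IH(4) M by (intro power_decreasing) auto
    hence "A * t ^ M i x \<le> A * t" using IH(1) by simp
    also have "\<dots> < d" using t(3) IH(1) by (simp add: pos_less_divide_eq mult.commute)
    finally have near: "absv ((f ^^ i) z - ?b) < d" using dist by simp
    have "0 < absv ((f ^^ i) z - ?b)" unfolding dist using IH(1) t by simp
    hence neq: "(f ^^ i) z \<noteq> ?b" by auto
    have dfz: "absv (df ((f ^^ i) z)) = m * absv a * (A * t ^ M i x) ^ (mult ?b - 1)"
      using a(6)[OF neq near] dist by (simp add: m_def)
    have "0 < m * absv a * (A * t ^ M i x) ^ (mult ?b - 1)" using m IH(1) t by simp
    hence df0: "df ((f ^^ i) z) \<noteq> 0" using dfz by (metis absv_0 less_irrefl)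
    show "poly Q ((f ^^ j) z) \<noteq> 0" if "j < Suc i" for j
      using that IH(5)[OF z(1) zd] a(4)[OF near] by (cases "j = i") simp_all
    show "df ((f ^^ j) z) \<noteq> 0" if "j < Suc i" for j
      using that IH(5)[OF z(1) zd] df0 by (cases "j = i") auto
    show "absv ((f ^^ Suc i) z - (f ^^ Suc i) x) = absv a * A ^ mult ?b * absv (z - x) ^ M (Suc i) x"
      using a(5)[OF near] dist by (simp add: t_def M_Suc power_mult_distrib power_mult)
    have "M (Suc i) x - 1 = (M i x - 1) + M i x * (mult ?b - 1)"
      using M mult_pos[OF Qb] by (cases "M i x"; cases "mult ?b") (auto simp: M_Suc algebra_simps)
    hence "t ^ (M (Suc i) x - 1) = t ^ (M i x - 1) * (t ^ M i x) ^ (mult ?b - 1)"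
      by (simp add: power_add power_mult)
    thus "D (Suc i) z = C * m * absv a * A ^ (mult ?b - 1) * absv (z - x) ^ (M (Suc i) x - 1)"
      using IH(7)[OF z(1) zd] dfz by (simp add: D_Suc t_def power_mult_distrib mult_ac)
  qed
qed

text \<open>Here \<open>t ^ (m - 1)\<close> stands for the derivative of an iterate and
  \<open>(A * t ^ m) powr (e - 1)\<close> for the weight at the image; the product has the
  pulled-back exponent.\<close>

lemma powr_collect:
  fixes t A e :: real
  assumes "0 < t" "0 < A" "0 < m"
  shows "t ^ (m - 1) * (A * t ^ m) powr (e - 1) = A powr (e - 1) * t powr (m * e - 1)"
proof -
  have "t ^ (m - 1) = t powr (real m - 1)" using assms by (simp add: powr_realpow[symmetric] of_nat_diff)
  moreover have "(A * t ^ m) powr (e - 1) = A powr (e - 1) * t powr (real m * (e - 1))"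
    using assms by (simp add: powr_mult powr_realpow[symmetric] powr_powr)
  ultimately have "t ^ (m - 1) * (A * t ^ m) powr (e - 1) = A powr (e - 1) * (t powr (real m - 1) * t powr (real m * (e - 1)))"
    by simp
  also have "t powr (real m - 1) * t powr (real m * (e - 1)) = t powr (m * e - 1)"
    by (simp add: powr_add[symmetric] algebra_simps)
  finally show ?thesis .
qed

lemma term_lower:
  assumes x: "x \<in> X" and S: "(f ^^ i) x \<in> S"
  obtains c r where "0 < c" "0 < r" "r \<le> 1" "\<And>z. z \<noteq> x \<Longrightarrow> absv (z - x) < r \<Longrightarrow>
     c * absv (z - x) powr (M i x * e ((f ^^ i) x) - 1) \<le> D i z * R0 ((f ^^ i) z)"
proof -
  obtain A C \<delta> where A: "0 < A" "0 < C" "0 < \<delta>" "\<delta> \<le> 1"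
    "\<And>z. z \<noteq> x \<Longrightarrow> absv (z - x) < \<delta> \<Longrightarrow> absv ((f ^^ i) z - (f ^^ i) x) = A * absv (z - x) ^ M i x \<and>
       D i z = C * absv (z - x) ^ (M i x - 1)"
    using iter_local[OF x, of i] by blast
  let ?e = "e ((f ^^ i) x)"
  show ?thesis
  proof (rule that[of "C * A powr (?e - 1)" \<delta>])
    fix z assume z: "z \<noteq> x" "absv (z - x) < \<delta>"
    have "absv (z - x) ^ (M i x - 1) * (A * absv (z - x) ^ M i x) powr (?e - 1)
       = A powr (?e - 1) * absv (z - x) powr (M i x * ?e - 1)"
      using z A M_pos[OF x] by (intro powr_collect) auto
    hence "C * A powr (?e - 1) * absv (z - x) powr (M i x * ?e - 1)
        = C * absv (z - x) ^ (M i x - 1) * (A * absv (z - x) ^ M i x) powr (?e - 1)" by simp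
    also have "\<dots> \<le> C * absv (z - x) ^ (M i x - 1) * R0 ((f ^^ i) z)"
      using R0_lower[OF S, of "(f ^^ i) z"] A(5)[OF z] A(2) by (intro mult_left_mono) auto
    finally show "C * A powr (?e - 1) * absv (z - x) powr (M i x * ?e - 1) \<le> D i z * R0 ((f ^^ i) z)"
      using A(5)[OF z] by simp
  qed (use A in auto)
qed

text \<open>The condition that makes the \<open>N\<close> terms of the final metric locally
  constant, by \<open>Reg_const\<close>.\<close>

definition Reg :: "nat \<Rightarrow> 'a \<Rightarrow> bool" where
  "Reg N z \<longleftrightarrow> (\<forall>i<N. poly Q ((f ^^ i) z) \<noteq> 0 \<and> df ((f ^^ i) z) \<noteq> 0 \<and> (f ^^ i) z \<notin> S)"

lemma term_upper:
  assumes x: "x \<in> X"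
  shows "\<exists>B \<beta> r. 0 < B \<and> 0 < \<beta> \<and> \<beta> < 1 \<and> 0 < r \<and> r \<le> 1 \<and> (\<forall>z. z \<noteq> x \<longrightarrow> absv (z - x) < r \<longrightarrow>
     (f ^^ i) z \<notin> S \<and> D i z * R0 ((f ^^ i) z) \<le> B * absv (z - x) powr (- \<beta>))"
proof -
  obtain A C \<delta> where A: "0 < A" "0 < C" "0 < \<delta>" "\<delta> \<le> 1"
    "\<And>z. z \<noteq> x \<Longrightarrow> absv (z - x) < \<delta> \<Longrightarrow> absv ((f ^^ i) z - (f ^^ i) x) = A * absv (z - x) ^ M i x \<and>
       D i z = C * absv (z - x) ^ (M i x - 1)"
    using iter_local[OF x, of i] by blast
  have M: "0 < M i x" using M_pos[OF x] .
  have near: "absv ((f ^^ i) z - (f ^^ i) x) < d" if z: "z \<noteq> x" "absv (z - x) < \<delta>" "absv (z - x) < d / A" for z d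
  proof -
    have "absv (z - x) ^ M i x \<le> absv (z - x) ^ 1" using z A(4) M by (intro power_decreasing) auto
    hence "A * absv (z - x) ^ M i x \<le> A * absv (z - x)" using A(1) by simp
    also have "\<dots> < d" using z(3) A(1) by (simp add: pos_less_divide_eq mult.commute)
    finally show ?thesis using A(5)[OF z(1,2)] by simp
  qed
  show ?thesis
  proof (cases "(f ^^ i) x \<in> S")
    case True
    let ?e = "e ((f ^^ i) x)"
    obtain r C' where r: "0 < r" "r \<le> 1" "0 < C'" "\<And>z. z \<noteq> (f ^^ i) x \<Longrightarrow> absv (z - (f ^^ i) x) < r \<Longrightarrow> z \<notin> S"
      "\<And>z. z \<noteq> (f ^^ i) x \<Longrightarrow> absv (z - (f ^^ i) x) < r \<Longrightarrow> R0 z \<le> C' * absv (z - (f ^^ i) x) powr (?e - 1)"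
      by (rule R0_upper[OF True]) (rule that; assumption)
    define \<beta> where "\<beta> = 1 - M i x * ?e"
    have \<beta>: "0 < \<beta>" "\<beta> < 1" using M_exponent(2)[OF x True] M e(1)[OF True] by (auto simp: \<beta>_def)
    show ?thesis
    proof (rule exI[of _ "C * C' * A powr (?e - 1)"], rule exI[of _ \<beta>], rule exI[of _ "min \<delta> (r / A)"], intro conjI allI impI)
      fix z assume z: "z \<noteq> x" "absv (z - x) < min \<delta> (r / A)"
      have zd: "absv (z - x) < \<delta>" using z by simp
      have n: "absv ((f ^^ i) z - (f ^^ i) x) < r" using near[OF z(1) zd] z(2) by simp
      have dist: "absv ((f ^^ i) z - (f ^^ i) x) = A * absv (z - x) ^ M i x" "D i z = C * absv (z - x) ^ (M i x - 1)"
        using A(5)[OF z(1) zd] by auto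
      have "0 < absv ((f ^^ i) z - (f ^^ i) x)" unfolding dist using A(1) z(1) by simp
      hence neq: "(f ^^ i) z \<noteq> (f ^^ i) x" by auto
      show "(f ^^ i) z \<notin> S" by (rule r(4)[OF neq n])
      have "D i z * R0 ((f ^^ i) z) \<le> C * absv (z - x) ^ (M i x - 1) * (C' * (A * absv (z - x) ^ M i x) powr (?e - 1))"
        unfolding dist(2) using r(5)[OF neq n] A(2) dist(1) by (intro mult_left_mono) auto
      also have "\<dots> = C * C' * (absv (z - x) ^ (M i x - 1) * (A * absv (z - x) ^ M i x) powr (?e - 1))" by simp
      also have "\<dots> = C * C' * (A powr (?e - 1) * absv (z - x) powr (M i x * ?e - 1))"
        using z A M by (subst powr_collect) auto
      finally show "D i z * R0 ((f ^^ i) z) \<le> C * C' * A powr (?e - 1) * absv (z - x) powr (- \<beta>)"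
        by (simp add: \<beta>_def)
    qed (use A(1-4) r(1-3) \<beta> in auto)
  next
    case False
    obtain r where r: "0 < r" "\<And>u. absv (u - (f ^^ i) x) < r \<Longrightarrow> u \<notin> S" "\<And>u. absv (u - (f ^^ i) x) < r \<Longrightarrow> R0 u = R0 ((f ^^ i) x)"
      by (rule R0_const[OF False]) (rule that; assumption)
    let ?B = "C * R0 ((f ^^ i) x)"
    have Bpos: "0 < ?B" using A(2) R0_ge_1[of "(f ^^ i) x"] by simp
    show ?thesis
    \<comment> \<open>The term is bounded here; at distances below 1 any exponent between 0 and 1
      gives a valid bound, and 1/2 is one.\<close>
    proof (rule exI[of _ ?B], rule exI[of _ "1 / 2"], rule exI[of _ "min \<delta> (r / A)"], intro conjI allI impI)
      fix z assume z: "z \<noteq> x" "absv (z - x) < min \<delta> (r / A)"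
      have zd: "absv (z - x) < \<delta>" using z by simp
      have n: "absv ((f ^^ i) z - (f ^^ i) x) < r" using near[OF z(1) zd] z(2) by simp
      show "(f ^^ i) z \<notin> S" by (rule r(2)[OF n])
      have "D i z = C * absv (z - x) ^ (M i x - 1)" using A(5)[OF z(1) zd] by simp
      also have "\<dots> \<le> C * 1" using zd A by (intro mult_left_mono power_le_one) auto
      finally have "D i z * R0 ((f ^^ i) z) \<le> ?B"
        using r(3)[OF n] R0_ge_1[of "(f ^^ i) x"] by (simp add: mult_right_mono)
      also have "1 powr (- (1 / 2)) \<le> absv (z - x) powr (- (1 / 2))"
        using z A(4) by (intro powr_mono2') auto
      hence "?B \<le> ?B * absv (z - x) powr (- (1 / 2))"
        using mult_left_mono[of 1 "absv (z - x) powr (- (1 / 2))" ?B] Bpos by simp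
      finally show "D i z * R0 ((f ^^ i) z) \<le> ?B * absv (z - x) powr (- (1 / 2))" .
    qed (use A r(1) Bpos in auto)
  qed
qed

text \<open>Absolute values of nonzero quantities are locally constant; univalence of the iterates
  transports this along the orbit.\<close>

lemma Reg_const:
  assumes "Reg N z"
  shows "\<exists>r>0. \<forall>u. absv (u - z) < r \<longrightarrow> Reg N u \<and> (\<forall>i<N. D i u = D i z \<and> R0 ((f ^^ i) u) = R0 ((f ^^ i) z))"
  using assms
proof (induction N)
  case 0
  show ?case by (intro exI[of _ 1]) (auto simp: Reg_def)
next
  case (Suc N)
  have "Reg N z" using Suc.prems by (auto simp: Reg_def)
  then obtain r where r: "0 < r" "\<And>u. absv (u - z) < r \<Longrightarrow> Reg N u \<and> (\<forall>i<N. D i u = D i z \<and> R0 ((f ^^ i) u) = R0 ((f ^^ i) z))"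
    using Suc.IH by blast
  obtain s where s: "0 < s" "univalent (Suc N) z s" using univalent_exists[of "Suc N" z] Suc.prems by (auto simp: Reg_def)
  have okN: "univalent N z s" using univalent_mono[OF s(2)] by simp
  have "(f ^^ N) z \<notin> S" using Suc.prems by (auto simp: Reg_def)
  then obtain t where t: "0 < t" "\<And>u. absv (u - (f ^^ N) z) < t \<Longrightarrow> u \<notin> S" "\<And>u. absv (u - (f ^^ N) z) < t \<Longrightarrow> R0 u = R0 ((f ^^ N) z)"
    by (rule R0_const) (rule that; assumption)
  have DN: "0 < D N z" using univalent_main(1)[OF okN] .
  show ?case
  proof (intro exI[of _ "min r (min s (t / D N z))"] conjI allI impI)
    show "0 < min r (min s (t / D N z))" using r s t DN by simp
    fix u assume u: "absv (u - z) < min r (min s (t / D N z))"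
    have us: "absv (u - z) < s" using u by simp
    have IH: "Reg N u" "\<And>i. i < N \<Longrightarrow> D i u = D i z \<and> R0 ((f ^^ i) u) = R0 ((f ^^ i) z)" using r(2) u by auto
    have "absv ((f ^^ N) u - (f ^^ N) z) = D N z * absv (u - z)"
      using univalent_main(2)[OF okN us, of z] s(1) by simp
    also have "\<dots> < t" using u DN by (simp add: pos_less_divide_eq mult.commute)
    finally have n: "absv ((f ^^ N) u - (f ^^ N) z) < t" .
    have dfu: "df ((f ^^ N) u) \<noteq> 0"
    proof
      assume "df ((f ^^ N) u) = 0"
      hence "D (Suc N) u = 0" by (simp add: D_Suc)
      thus False using univalent_main(1)[OF s(2)] univalent_main(3)[OF s(2) us] by simp
    qed
    show "Reg (Suc N) u"
      using IH(1) t(2)[OF n] dfu univalent_main(4)[OF s(2) us, of N] by (auto simp: Reg_def less_Suc_eq)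
    fix i assume "i < Suc N"
    thus "D i u = D i z" "R0 ((f ^^ i) u) = R0 ((f ^^ i) z)"
      using IH(2)[of i] univalent_main(3)[OF okN us] t(3)[OF n] by (cases "i = N"; auto)+
  qed
qed

lemma Reg_X: "x \<in> X \<Longrightarrow> (\<And>i. i < N \<Longrightarrow> (f ^^ i) x \<notin> S) \<Longrightarrow> Reg N x"
  unfolding Reg_def using critical_in_S X_iterate X_forward(2) by blast

text \<open>Also points of \<open>X\<close> whose orbit meets \<open>S\<close> have regular
  punctured neighbourhoods. Finitely many bounds from \<open>term_upper\<close> are merged into one
  by taking the larger constant and the larger exponent, distances being below 1.\<close>

lemma Reg_near:
  assumes x: "x \<in> X"
  shows "\<exists>B \<beta> r. 0 < B \<and> 0 < \<beta> \<and> \<beta> < 1 \<and> 0 < r \<and> r \<le> 1 \<and> (\<forall>z. z \<noteq> x \<longrightarrow> absv (z - x) < r \<longrightarrow>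
     Reg N z \<and> (\<forall>i<N. D i z * R0 ((f ^^ i) z) \<le> B * absv (z - x) powr (- \<beta>)))"
proof -
  obtain \<delta> where \<delta>: "0 < \<delta>" "\<delta> \<le> 1" "\<And>z j. z \<noteq> x \<Longrightarrow> absv (z - x) < \<delta> \<Longrightarrow> j < N \<Longrightarrow>
     poly Q ((f ^^ j) z) \<noteq> 0 \<and> df ((f ^^ j) z) \<noteq> 0"
    using iter_local[OF x, of N] by blast
  have "\<exists>B \<beta> r. 0 < B \<and> 0 < \<beta> \<and> \<beta> < 1 \<and> 0 < r \<and> r \<le> 1 \<and> (\<forall>z. z \<noteq> x \<longrightarrow> absv (z - x) < r \<longrightarrow>
     (\<forall>i<n. (f ^^ i) z \<notin> S \<and> D i z * R0 ((f ^^ i) z) \<le> B * absv (z - x) powr (- \<beta>)))" for n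
  proof (induction n)
    case 0
    show ?case by (rule exI[of _ 1], rule exI[of _ "1 / 2"], rule exI[of _ 1]) auto
  next
    case (Suc n)
    obtain B1 \<beta>1 r1 where 1: "0 < B1" "0 < \<beta>1" "\<beta>1 < 1" "0 < r1" "r1 \<le> 1" "\<And>z i. z \<noteq> x \<Longrightarrow> absv (z - x) < r1 \<Longrightarrow> i < n \<Longrightarrow>
       (f ^^ i) z \<notin> S \<and> D i z * R0 ((f ^^ i) z) \<le> B1 * absv (z - x) powr (- \<beta>1)"
      using Suc.IH by blast
    obtain B2 \<beta>2 r2 where 2: "0 < B2" "0 < \<beta>2" "\<beta>2 < 1" "0 < r2" "r2 \<le> 1" "\<And>z. z \<noteq> x \<Longrightarrow> absv (z - x) < r2 \<Longrightarrow>
       (f ^^ n) z \<notin> S \<and> D n z * R0 ((f ^^ n) z) \<le> B2 * absv (z - x) powr (- \<beta>2)"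
      using term_upper[OF x, of n] by blast
    show ?case
    proof (rule exI[of _ "max B1 B2"], rule exI[of _ "max \<beta>1 \<beta>2"], rule exI[of _ "min r1 r2"], intro conjI allI impI)
      fix z i assume z: "z \<noteq> x" "absv (z - x) < min r1 r2" and i: "i < Suc n"
      have t: "0 < absv (z - x)" "absv (z - x) \<le> 1" using z 1 by auto
      have mono: "b * absv (z - x) powr (- \<beta>) \<le> max B1 B2 * absv (z - x) powr (- max \<beta>1 \<beta>2)"
        if "b \<le> max B1 B2" "\<beta> \<le> max \<beta>1 \<beta>2" for b \<beta>
        using that t 1(1) by (intro mult_mono powr_mono') auto
      show "(f ^^ i) z \<notin> S" using 1(6)[OF z(1)] 2(6)[OF z(1)] z(2) i by (cases "i = n") auto
      show "D i z * R0 ((f ^^ i) z) \<le> max B1 B2 * absv (z - x) powr (- max \<beta>1 \<beta>2)"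
      proof (cases "i = n")
        case True
        thus ?thesis using 2(6)[OF z(1)] z(2) mono[of B2 \<beta>2] by auto
      next
        case False
        thus ?thesis using 1(6)[OF z(1), of i] z(2) i mono[of B1 \<beta>1] by auto
      qed
    qed (use 1(1-5) 2(1-5) in auto)
  qed
  from this[of N] obtain B \<beta> r where r: "0 < B" "0 < \<beta>" "\<beta> < 1" "0 < r" "r \<le> 1" "\<And>z i. z \<noteq> x \<Longrightarrow> absv (z - x) < r \<Longrightarrow> i < N \<Longrightarrow>
       (f ^^ i) z \<notin> S \<and> D i z * R0 ((f ^^ i) z) \<le> B * absv (z - x) powr (- \<beta>)" by blast
  show ?thesis
    by (rule exI[of _ B], rule exI[of _ \<beta>], rule exI[of _ "min r \<delta>"])
      (use r \<delta> in \<open>auto simp: Reg_def\<close>)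
qed

text \<open>Four sources of growth. Off \<open>S\<close>, either the orbit of \<open>a\<close>
  enters \<open>S\<close> and the pulled-back weight is unbounded near \<open>a\<close>, or it never
  does and \<open>big_images\<close> forces large derivatives. At a noncyclic point of
  \<open>S\<close> the strict inequality between the exponents gives an unbounded ratio; on a cycle
  each turn contributes \<open>D n a powr e a\<close>.\<close>

lemma local_expansion:
  assumes a: "a \<in> X"
  shows "\<exists>r>0. \<exists>n>0. \<forall>x\<in>X. absv (x - a) < r \<longrightarrow> (\<forall>i\<le>n. (f ^^ i) x \<notin> S) \<longrightarrow> 2 * R0 x \<le> D n x * R0 ((f ^^ n) x)"
proof (cases "a \<in> S")
  case False
  obtain r where r: "0 < r" "\<And>u. absv (u - a) < r \<Longrightarrow> R0 u = R0 a"
    by (rule R0_const[OF False]) (rule that; assumption)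
  show ?thesis
  proof (cases "\<exists>n. (f ^^ n) a \<in> S")
    case True
    then obtain n where n: "(f ^^ n) a \<in> S" by blast
    have n0: "0 < n" using n False by (cases n) auto
    let ?g = "1 - M n a * e ((f ^^ n) a)"
    have g: "0 < ?g" using M_exponent(2)[OF a n] by simp
    obtain c s where c: "0 < c" "0 < s" "s \<le> 1" "\<And>z. z \<noteq> a \<Longrightarrow> absv (z - a) < s \<Longrightarrow>
       c * absv (z - a) powr (M n a * e ((f ^^ n) a) - 1) \<le> D n z * R0 ((f ^^ n) z)"
      by (rule term_lower[OF a n]) (rule that; assumption)
    obtain t where t: "0 < t" "t \<le> 1" "\<And>u. 0 < u \<Longrightarrow> u < t \<Longrightarrow> 2 * R0 a \<le> c * u powr (- ?g)"
      by (rule powr_unbounded[OF c(1) g]) (rule that; assumption)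
    show ?thesis
    proof (intro exI[of _ "min r (min s t)"] conjI exI[of _ n] ballI impI)
      fix x assume x: "x \<in> X" "absv (x - a) < min r (min s t)" "\<forall>i\<le>n. (f ^^ i) x \<notin> S"
      have neq: "x \<noteq> a" using x(3) n by auto
      have "2 * R0 x = 2 * R0 a" using r(2)[of x] x(2) by simp
      also have "\<dots> \<le> c * absv (x - a) powr (- ?g)" using t(3)[of "absv (x - a)"] x(2) neq by simp
      also have "\<dots> \<le> D n x * R0 ((f ^^ n) x)" using c(4)[OF neq] x(2) by simp
      finally show "2 * R0 x \<le> D n x * R0 ((f ^^ n) x)" .
    qed (use r(1) c(2) t(1) n0 in auto)
  next
    case no: False
    have "\<exists>\<kappa>>0. \<forall>v\<in>Jc. (\<forall>n. (f ^^ n) v \<in> X - S) \<longrightarrow>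
       (\<forall>s>0. \<exists>s' n. 0 < s' \<and> s' \<le> s \<and> univalent n v s' \<and> \<kappa> \<le> s' * D n v)"
      by (rule big_images[OF cptX _ finite_S]) (auto dest: X_forward(2) intro: critical_in_S escapes_S)
    then obtain \<kappa> where \<kappa>: "0 < \<kappa>" "\<And>v s. v \<in> Jc \<Longrightarrow> \<forall>n. (f ^^ n) v \<in> X - S \<Longrightarrow> 0 < s \<Longrightarrow>
       \<exists>s' n. 0 < s' \<and> s' \<le> s \<and> univalent n v s' \<and> \<kappa> \<le> s' * D n v" by blast
    \<comment> \<open>An image of radius at least \<open>\<kappa>\<close> from a radius at most
      \<open>s\<close> forces \<open>D n a\<close> to be at least
      \<open>\<kappa> / s = 2 * R0 a\<close>.\<close>
    define s where "s = \<kappa> / (2 * R0 a)"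
    have R: "1 \<le> R0 a" by (rule R0_ge_1)
    have s: "0 < s" using \<kappa>(1) R by (simp add: s_def)
    have "a \<in> Jc" "\<forall>n. (f ^^ n) a \<in> X - S" using X_forward(3)[OF a] X_iterate[OF a] no by auto
    then obtain s' n where n: "0 < s'" "s' \<le> s" "univalent n a s'" "\<kappa> \<le> s' * D n a" using \<kappa>(2)[of a s] s by blast
    have "s' * D n a \<le> s * D n a" using n D_nonneg by (intro mult_right_mono) auto
    hence "\<kappa> \<le> \<kappa> / (2 * R0 a) * D n a" using n(4) by (simp add: s_def)
    hence "\<kappa> * (2 * R0 a) \<le> \<kappa> * D n a" using R by (simp add: field_simps)
    hence Dn: "2 * R0 a \<le> D n a" using \<kappa>(1) by simp
    have n0: "0 < n" using Dn R by (cases n) auto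
    show ?thesis
    proof (intro exI[of _ "min r s'"] conjI exI[of _ n] ballI impI)
      fix x assume x: "x \<in> X" "absv (x - a) < min r s'"
      have "2 * R0 x = 2 * R0 a" using r(2)[of x] x(2) by simp
      also have "\<dots> \<le> D n a * 1" using Dn by simp
      also have "\<dots> \<le> D n x * R0 ((f ^^ n) x)"
      proof -
        have "D n x = D n a" using univalent_main(3)[OF n(3), of x] x(2) by simp
        thus ?thesis using mult_left_mono[OF R0_ge_1[of "(f ^^ n) x"] D_nonneg[of n a]] by simp
      qed
      finally show "2 * R0 x \<le> D n x * R0 ((f ^^ n) x)" .
    qed (use r(1) n(1) n0 in auto)
  qed
next
  case S: True
  obtain r C where r: "0 < r" "r \<le> 1" "0 < C" "\<And>z. z \<noteq> a \<Longrightarrow> absv (z - a) < r \<Longrightarrow> R0 z \<le> C * absv (z - a) powr (e a - 1)"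
    by (rule R0_upper[OF S]) (rule that; assumption)
  show ?thesis
  proof (cases "a \<in> Per")
    case False
    have M1: "M (Suc 0) a = mult a" by (simp add: M_def)
    have fS: "(f ^^ 1) a \<in> S" using S_forward[OF S] by simp
    let ?g = "e a - mult a * e (f a)"
    have g: "0 < ?g" using e(3)[OF S False] by simp
    obtain c s where c: "0 < c" "0 < s" "s \<le> 1" "\<And>z. z \<noteq> a \<Longrightarrow> absv (z - a) < s \<Longrightarrow>
       c * absv (z - a) powr (M 1 a * e ((f ^^ 1) a) - 1) \<le> D 1 z * R0 ((f ^^ 1) z)"
      by (rule term_lower[OF a fS]) (rule that; assumption)
    obtain t where t: "0 < t" "t \<le> 1" "\<And>u. 0 < u \<Longrightarrow> u < t \<Longrightarrow> 2 * C \<le> c * u powr (- ?g)"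
      by (rule powr_unbounded[OF c(1) g]) (rule that; assumption)
    show ?thesis
    proof (intro exI[of _ "min r (min s t)"] conjI exI[of _ 1] ballI impI)
      fix x assume x: "x \<in> X" "absv (x - a) < min r (min s t)" "\<forall>i\<le>1. (f ^^ i) x \<notin> S"
      have neq: "x \<noteq> a" using x(3)[rule_format, of 0] S by auto
      have "2 * R0 x \<le> 2 * C * absv (x - a) powr (e a - 1)" using r(4)[OF neq] x(2) by simp
      also have "\<dots> \<le> c * absv (x - a) powr (- ?g) * absv (x - a) powr (e a - 1)"
        using t(3)[of "absv (x - a)"] x(2) neq by (intro mult_right_mono) auto
      also have "\<dots> = c * absv (x - a) powr (M 1 a * e ((f ^^ 1) a) - 1)"
        by (simp add: M1 powr_add[symmetric])
      also have "\<dots> \<le> D 1 x * R0 ((f ^^ 1) x)" using c(4)[OF neq] x(2) by simp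
      finally show "2 * R0 x \<le> D 1 x * R0 ((f ^^ 1) x)" .
    qed (use r(1) c(2) t(1) in auto)
  next
    case True
    then obtain n where n: "0 < n" "(f ^^ n) a = a" by (auto simp: Per_def)
    have \<mu>: "1 < D n a" using periodic_repelling X_forward(3)[OF a] n by blast
    have per: "(f ^^ i) a \<in> Per" for i by (induction i) (use True Per_forward in auto)
    have nj: "(f ^^ (n * j)) a = a \<and> D (n * j) a = D n a ^ j" for j
    proof (induction j)
      case (Suc j)
      have "(f ^^ (n * Suc j)) a = (f ^^ (n * j)) ((f ^^ n) a)"
        using funpow_add[of "n * j" n f] by (simp add: add.commute)
      thus ?case using Suc n(2) D_add[of n "n * j" a] by simp
    qed simp
    define \<epsilon> where "\<epsilon> = e a"
    have \<epsilon>: "0 < \<epsilon>" using e(1)[OF S] by (simp add: \<epsilon>_def)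
    \<comment> \<open>Enough turns around the cycle for the \<open>\<epsilon>\<close>-th power of
      the derivative to absorb \<open>2 * C\<close>, where \<open>C\<close> is the loss in
      \<open>R0_upper\<close>.\<close>
    obtain j0 where j0: "(2 * C) powr (1 / \<epsilon>) < D n a ^ j0" using real_arch_pow[OF \<mu>] by blast
    define j where "j = Suc j0"
    have "D n a ^ j0 \<le> D n a ^ j" using \<mu> by (intro power_increasing) (auto simp: j_def)
    hence "(2 * C) powr (1 / \<epsilon>) \<le> D n a ^ j" using j0 by linarith
    hence "((2 * C) powr (1 / \<epsilon>)) powr \<epsilon> \<le> (D n a ^ j) powr \<epsilon>" using \<epsilon> by (intro powr_mono2) auto
    hence big: "2 * C \<le> (D n a ^ j) powr \<epsilon>" using \<epsilon> r(3) by (simp add: powr_powr)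
    obtain s where s: "0 < s" "univalent (n * j) a s"
      using univalent_exists[of "n * j" a] Per_noncritical[OF per] X_forward(2)[OF X_iterate[OF a]] by blast
    show ?thesis
    proof (intro exI[of _ "min r s"] conjI exI[of _ "n * j"] ballI impI)
      fix x assume x: "x \<in> X" "absv (x - a) < min r s" "\<forall>i\<le>n * j. (f ^^ i) x \<notin> S"
      have neq: "x \<noteq> a" using x(3)[rule_format, of 0] S by auto
      define t where "t = absv (x - a)"
      define u where "u = D n a ^ j"
      have u: "0 < u" using \<mu> by (simp add: u_def)
      have t: "0 < t" using neq by (simp add: t_def)
      have "absv ((f ^^ (n * j)) x - a) = u * t"
        using univalent_main(2)[OF s(2), of x a] x(2) s(1) nj[of j] by (simp add: t_def u_def)
      hence "(u * t) powr (\<epsilon> - 1) \<le> R0 ((f ^^ (n * j)) x)" using R0_lower[OF S] by (metis \<epsilon>_def)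
      moreover have "D (n * j) x = u" using univalent_main(3)[OF s(2), of x] x(2) nj[of j] by (simp add: u_def)
      ultimately have *: "u * (u * t) powr (\<epsilon> - 1) \<le> D (n * j) x * R0 ((f ^^ (n * j)) x)" using u by simp
      have "u * (u * t) powr (\<epsilon> - 1) = (u powr 1 * u powr (\<epsilon> - 1)) * t powr (\<epsilon> - 1)"
        using u t by (simp add: powr_mult)
      also have "\<dots> = u powr \<epsilon> * t powr (\<epsilon> - 1)" by (simp only: powr_add[symmetric]) simp
      finally have eq: "u * (u * t) powr (\<epsilon> - 1) = u powr \<epsilon> * t powr (\<epsilon> - 1)" .
      have "2 * R0 x \<le> 2 * C * t powr (\<epsilon> - 1)" using r(4)[OF neq] x(2) by (simp add: t_def \<epsilon>_def)
      also have "\<dots> \<le> u powr \<epsilon> * t powr (\<epsilon> - 1)" using big by (intro mult_right_mono) (auto simp: u_def)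
      also have "\<dots> \<le> D (n * j) x * R0 ((f ^^ (n * j)) x)" using * eq by simp
      finally show "2 * R0 x \<le> D (n * j) x * R0 ((f ^^ (n * j)) x)" .
    qed (use r(1) s(1) n(1) in \<open>auto simp: j_def\<close>)
  qed
qed

theorem expanding_metric: "expanding_admissible absv P Q L"
proof (cases "X = {}")
  \<comment> \<open>Without Julia points in \<open>L\<close> there is no exceptional point, the
    bounding sum is 0, and only the empty neighbourhood is compatible with a positive lower
    bound.\<close>
  case True
  hence no: "\<not> (x \<in> L \<and> Some x \<in> Julia_set absv P Q UNIV)" for x by (auto simp: X_def Jc_def)
  have "admissible absv P Q L {} (\<lambda>_. 1) {}" unfolding admissible_def
    using no by (auto simp: absv_open_def absv_continuous_on_def intro!: exI[of _ 1] exI[of _ "1 / 2"])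
  moreover have "Some x \<notin> Julia_set absv P Q L" for x
    using True Julia_subset[of x L] by (auto simp: X_def)
  hence "expanding_wrt absv P Q L (\<lambda>_. 1) {}" unfolding expanding_wrt_def
    by (intro exI[of _ 2]) simp
  ultimately show ?thesis unfolding expanding_admissible_def by blast
next
  case False
  then obtain x0 where x0: "x0 \<in> X" by blast
  have "\<forall>a\<in>X. \<exists>r n. 0 < r \<and> 0 < n \<and> (\<forall>x\<in>X. absv (x - a) < r \<longrightarrow> (\<forall>i\<le>n. (f ^^ i) x \<notin> S) \<longrightarrow> 2 * R0 x \<le> D n x * R0 ((f ^^ n) x))"
    using local_expansion by blast
  then obtain r n where rn: "\<forall>a\<in>X. 0 < r a \<and> 0 < n a \<and> (\<forall>x\<in>X. absv (x - a) < r a \<longrightarrow> (\<forall>i\<le>n a. (f ^^ i) x \<notin> S) \<longrightarrow> 2 * R0 x \<le> D (n a) x * R0 ((f ^^ n a) x))"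
    unfolding bchoice_iff by blast
  obtain T where T: "finite T" "T \<subseteq> X" "\<And>y. y \<in> X \<Longrightarrow> \<exists>x\<in>T. absv (y - x) < r x"
    using cpt_cover[OF cptX, of r] rn by metis
  define N where "N = Max (insert 1 (n ` T))"
  have N: "0 < N" "\<And>a. a \<in> T \<Longrightarrow> n a \<le> N"
  proof -
    have "1 \<le> N" unfolding N_def using T(1) by (intro Max_ge) auto
    thus "0 < N" by simp
    show "n a \<le> N" if "a \<in> T" for a unfolding N_def using T(1) that by (intro Max_ge) auto
  qed
  have expd: "\<exists>k\<in>{0<..N}. 2 * R0 x \<le> D k x * R0 ((f ^^ k) x)" if x: "x \<in> X" "\<forall>i\<le>N. (f ^^ i) x \<notin> S" for x
  proof -
    obtain a where a: "a \<in> T" "absv (x - a) < r a" using T(3)[OF x(1)] by blast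
    have aX: "a \<in> X" using a T by blast
    have "\<forall>i\<le>n a. (f ^^ i) x \<notin> S" using x(2) N(2)[OF a(1)] by simp
    hence "2 * R0 x \<le> D (n a) x * R0 ((f ^^ n a) x)" using rn aX x(1) a(2) by blast
    moreover have "n a \<in> {0<..N}" using rn aX N(2)[OF a(1)] by simp
    ultimately show ?thesis by blast
  qed
  \<comment> \<open>The discount accumulated over \<open>N\<close> steps is exactly the gain 2 of
    \<open>expd\<close>, so the growth can be spread evenly over single steps.\<close>
  define \<Lambda> where "\<Lambda> = 2 powr (1 / N)"
  have \<Lambda>: "1 < \<Lambda>" "\<Lambda> ^ N = 2"
    using N(1) by (auto simp: \<Lambda>_def powr_powr simp flip: powr_realpow)
  define tm where "tm i z = D i z * R0 ((f ^^ i) z) / \<Lambda> ^ i" for i z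
  define \<rho>r where "\<rho>r z = Max ((\<lambda>i. tm i z) ` {..<N})" for z
  define Z0 where "Z0 = {x \<in> X. \<exists>i<N. (f ^^ i) x \<in> S}"
  define \<rho> where "\<rho> z = (if z \<in> Z0 then \<infinity> else ereal (\<rho>r z))" for z
  \<comment> \<open>\<open>x0\<close> is declared exceptional although the metric need not blow up
    there: admissibility bounds the metric by a sum over \<open>Z\<close>, which would be 0 for
    empty \<open>Z\<close>.\<close>
  define Z where "Z = insert x0 Z0"
  have tm_le: "tm i z \<le> \<rho>r z" if "i < N" for i z
    unfolding \<rho>r_def using that by (intro Max_ge) auto
  have \<rho>r_in: "\<exists>i<N. \<rho>r z = tm i z" for z
  proof -
    have "\<rho>r z \<in> (\<lambda>i. tm i z) ` {..<N}" unfolding \<rho>r_def using N(1) by (intro Max_in) auto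
    thus ?thesis by auto
  qed
  have \<rho>r_ge_1: "1 \<le> \<rho>r z" for z
    using tm_le[OF N(1), of z] R0_ge_1[of z] by (simp add: tm_def)
  have ZX: "Z0 \<subseteq> X" "Z \<subseteq> X" using x0 by (auto simp: Z_def Z0_def)
  have regX: "Reg N x" if "x \<in> X" "x \<notin> Z0" for x
    using Reg_X[of x N] that by (auto simp: Z0_def)
  have notZ0: "z \<notin> Z0" if "Reg N z" for z using that by (auto simp: Z0_def Reg_def)
  have const: "\<exists>s>0. \<forall>u. absv (u - z) < s \<longrightarrow> Reg N u \<and> \<rho>r u = \<rho>r z" if z: "Reg N z" for z
  proof -
    obtain s where s: "0 < s" "\<And>u. absv (u - z) < s \<Longrightarrow> Reg N u \<and> (\<forall>i<N. D i u = D i z \<and> R0 ((f ^^ i) u) = R0 ((f ^^ i) z))"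
      using Reg_const[OF z] by blast
    have "\<rho>r u = \<rho>r z" if "absv (u - z) < s" for u
      unfolding \<rho>r_def by (intro arg_cong[of _ _ Max] image_cong) (use s(2)[OF that] in \<open>auto simp: tm_def\<close>)
    thus ?thesis using s by blast
  qed
  have "\<exists>s B \<beta>. 0 < s \<and> s \<le> 1 \<and> 0 < B \<and> 0 < \<beta> \<and> \<beta> < 1 \<and> (x \<notin> Z0 \<longrightarrow> (\<forall>z. absv (z - x) < s \<longrightarrow> Reg N z \<and> \<rho>r z \<le> B)) \<and>
      (x \<in> Z0 \<longrightarrow> (\<forall>z. z \<noteq> x \<longrightarrow> absv (z - x) < s \<longrightarrow> Reg N z \<and> \<rho>r z \<le> B * absv (z - x) powr (- \<beta>)))" (is "\<exists>s B \<beta>. ?R x s B \<beta>")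
    if x: "x \<in> X" for x
  proof (cases "x \<in> Z0")
    case False
    obtain s where s: "0 < s" "\<And>u. absv (u - x) < s \<Longrightarrow> Reg N u \<and> \<rho>r u = \<rho>r x" using const[OF regX[OF x False]] by blast
    have s2: "Reg N u \<and> \<rho>r u \<le> \<rho>r x" if "absv (u - x) < min s 1" for u
      using s(2)[of u] that by linarith
    have pos: "0 < \<rho>r x" using \<rho>r_ge_1[of x] by linarith
    show ?thesis
      by (rule exI[of _ "min s 1"], rule exI[of _ "\<rho>r x"], rule exI[of _ "1 / 2"])
         (use False s(1) pos s2 in simp)
  next
    case True
    obtain B \<beta> s where s: "0 < B" "0 < \<beta>" "\<beta> < 1" "0 < s" "s \<le> 1" "\<And>z i. z \<noteq> x \<Longrightarrow> absv (z - x) < s \<Longrightarrow>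
       Reg N z \<and> (\<forall>i<N. D i z * R0 ((f ^^ i) z) \<le> B * absv (z - x) powr (- \<beta>))"
      using Reg_near[OF x, of N] by blast
    have "\<rho>r z \<le> B * absv (z - x) powr (- \<beta>)" if z: "z \<noteq> x" "absv (z - x) < s" for z
    proof -
      obtain i where i: "i < N" "\<rho>r z = tm i z" using \<rho>r_in by blast
      have "tm i z \<le> D i z * R0 ((f ^^ i) z) / 1"
        unfolding tm_def using \<Lambda>(1) D_nonneg R0_ge_1[of "(f ^^ i) z"] by (intro divide_left_mono mult_nonneg_nonneg) auto
      also have "\<dots> \<le> B * absv (z - x) powr (- \<beta>)" using s(6)[OF z] i(1) by simp
      finally show ?thesis using i(2) by simp
    qed
    hence s2: "Reg N z \<and> \<rho>r z \<le> B * absv (z - x) powr (- \<beta>)" if "z \<noteq> x" "absv (z - x) < s" for z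
      using s(6)[OF that] that by blast
    show ?thesis
      by (rule exI[of _ s], rule exI[of _ B], rule exI[of _ \<beta>]) (use True s(1-5) s2 in simp)
  qed
  hence "\<forall>x\<in>X. \<exists>s B \<beta>. ?R x s B \<beta>" by blast
  then obtain s B \<beta> where R: "\<forall>x\<in>X. ?R x (s x) (B x) (\<beta> x)"
    unfolding bchoice_iff by (elim exE)
  have sB: "\<And>x. x \<in> X \<Longrightarrow> 0 < s x \<and> s x \<le> 1 \<and> 0 < B x \<and> 0 < \<beta> x \<and> \<beta> x < 1"
    "\<And>x z. x \<in> X \<Longrightarrow> x \<notin> Z0 \<Longrightarrow> absv (z - x) < s x \<Longrightarrow> Reg N z \<and> \<rho>r z \<le> B x"
    "\<And>x z. x \<in> X \<Longrightarrow> x \<in> Z0 \<Longrightarrow> z \<noteq> x \<Longrightarrow> absv (z - x) < s x \<Longrightarrow> Reg N z \<and> \<rho>r z \<le> B x * absv (z - x) powr (- \<beta> x)"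
    using R by simp_all
  obtain T' where T': "finite T'" "T' \<subseteq> X" "\<And>y. y \<in> X \<Longrightarrow> \<exists>x\<in>T'. absv (y - x) < s x"
    using cpt_cover[OF cptX, of s] sB(1) by metis
  define V where "V = (\<Union>x\<in>T'. {z. absv (z - x) < s x})"
  have XV: "X \<subseteq> V" using T'(3) by (auto simp: V_def)
  have V: "\<exists>x\<in>T'. absv (z - x) < s x" if "z \<in> V" for z using that by (auto simp: V_def)
  \<comment> \<open>All points of a ball of the cover are regular except possibly the centre, so
    \<open>Z0\<close> lies among the finitely many centres.\<close>
  have Z0T': "Z0 \<subseteq> T'"
  proof
    fix z assume z: "z \<in> Z0"
    then obtain x where x: "x \<in> T'" "absv (z - x) < s x" using ZX XV V by blast
    have "z = x"
    proof (rule ccontr)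
      assume "z \<noteq> x"
      hence "Reg N z" using sB(2,3)[of x z] x T'(2) by blast
      thus False using z notZ0 by blast
    qed
    thus "z \<in> T'" using x by simp
  qed
  have RegV: "Reg N z" if zV: "z \<in> V" "z \<notin> Z0" for z
  proof -
    obtain x where x: "x \<in> T'" "absv (z - x) < s x" using V[OF zV(1)] by blast
    thus ?thesis using sB(2,3)[of x z] T'(2) zV(2) by blast
  qed
  have openV: "absv_open absv V" unfolding absv_open_def
  proof
    fix z assume "z \<in> V"
    then obtain x where x: "x \<in> T'" "absv (z - x) < s x" using V by blast
    have "{y. absv (y - z) < s x} \<subseteq> V" unfolding V_def using x absv_ultra_less by blast
    moreover have "0 < s x" using sB(1) x(1) T'(2) by blast
    ultimately show "\<exists>r>0. {y. absv (y - z) < r} \<subseteq> V" by blast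
  qed
  have contV: "absv_continuous_on absv V \<rho>" unfolding absv_continuous_on_def
  proof (intro ballI allI impI)
    fix z and q :: "nat \<Rightarrow> 'a" assume z: "z \<in> V" and q: "\<forall>n. q n \<in> V" "(\<lambda>n. absv (q n - z)) \<longlonglongrightarrow> 0"
    have ev: "\<forall>\<^sub>F n in sequentially. absv (q n - z) < c" if "0 < c" for c
      using q(2) that by (auto simp: order_tendsto_iff)
    show "(\<lambda>n. \<rho> (q n)) \<longlonglongrightarrow> \<rho> z"
    proof (cases "z \<in> Z0")
      case False
      obtain c where c: "0 < c" "\<And>u. absv (u - z) < c \<Longrightarrow> Reg N u \<and> \<rho>r u = \<rho>r z" using const[OF RegV[OF z False]] by blast
      have "\<forall>\<^sub>F n in sequentially. \<rho> (q n) = \<rho> z"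
        using ev[OF c(1)]
      proof eventually_elim
        case (elim n)
        thus ?case using c(2)[OF elim] False notZ0 by (simp add: \<rho>_def)
      qed
      thus ?thesis by (simp add: tendsto_eventually)
    next
      case True
      hence zX: "z \<in> X" using ZX by blast
      obtain i where i: "i < N" "(f ^^ i) z \<in> S" using True by (auto simp: Z0_def)
      obtain c t where c: "0 < c" "0 < t" "t \<le> 1" "\<And>u. u \<noteq> z \<Longrightarrow> absv (u - z) < t \<Longrightarrow>
         c * absv (u - z) powr (M i z * e ((f ^^ i) z) - 1) \<le> D i u * R0 ((f ^^ i) u)"
        by (rule term_lower[OF zX i(2)]) (rule that; assumption)
      have g: "0 < 1 - M i z * e ((f ^^ i) z)" using M_exponent(2)[OF zX i(2)] by simp
      \<comment> \<open>A single term tends to infinity already, namely one whose index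
        \<open>i\<close> has \<open>(f ^^ i) z\<close> in \<open>S\<close>; its discount is absorbed
        in the threshold, and points of \<open>Z0\<close> on the way carry the value \<infinity>
        anyway.\<close>
      have "(\<lambda>n. \<rho> (q n)) \<longlonglongrightarrow> \<infinity>" unfolding tendsto_PInfty
      proof
        fix b :: real
        obtain t' where t': "0 < t'" "t' \<le> 1" "\<And>u. 0 < u \<Longrightarrow> u < t' \<Longrightarrow> (b + 1) * \<Lambda> ^ i \<le> c * u powr (- (1 - M i z * e ((f ^^ i) z)))"
          by (rule powr_unbounded[OF c(1) g]) (rule that; assumption)
        have "0 < min t t'" using c t' by simp
        from ev[OF this] show "\<forall>\<^sub>F n in sequentially. ereal b < \<rho> (q n)"
        proof eventually_elim
          case (elim n)
          show ?case
          proof (cases "q n \<in> Z0")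
            case False
            have neq: "q n \<noteq> z" using False True by blast
            have "(b + 1) * \<Lambda> ^ i \<le> c * absv (q n - z) powr (M i z * e ((f ^^ i) z) - 1)"
              using t'(3)[of "absv (q n - z)"] elim neq by simp
            also have "\<dots> \<le> D i (q n) * R0 ((f ^^ i) (q n))" using c(4)[OF neq] elim by simp
            finally have "b + 1 \<le> tm i (q n)" unfolding tm_def using \<Lambda>(1) by (simp add: pos_le_divide_eq)
            thus ?thesis using tm_le[OF i(1), of "q n"] False by (simp add: \<rho>_def)
          qed (simp add: \<rho>_def)
        qed
      qed
      thus ?thesis using True by (simp add: \<rho>_def)
    qed
  qed
  have finZ: "finite Z" unfolding Z_def using Z0T' T'(1) finite_subset by blast
  obtain RJ where RJ: "1 \<le> RJ" "\<And>x. x \<in> Jc \<Longrightarrow> absv x \<le> RJ" using Jc_bounded by blast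
  define \<beta>' where "\<beta>' = Max (insert (1 / 2) (\<beta> ` T'))"
  have \<beta>': "0 < \<beta>'" "\<beta>' < 1" "\<And>x. x \<in> T' \<Longrightarrow> \<beta> x \<le> \<beta>'"
  proof -
    have "1 / 2 \<le> \<beta>'" unfolding \<beta>'_def using T'(1) by (intro Max_ge) auto
    thus "0 < \<beta>'" by simp
    show "\<beta>' < 1" unfolding \<beta>'_def using T'(1,2) sB(1) by (subst Max_less_iff) auto
    show "\<beta> x \<le> \<beta>'" if "x \<in> T'" for x unfolding \<beta>'_def using T'(1) that by (intro Max_ge) auto
  qed
  \<comment> \<open>Where the metric is merely bounded, the summand at \<open>x0\<close> has to
    dominate it; the distance to \<open>x0\<close> can be as large as \<open>RJ\<close>, which the
    factor \<open>RJ powr \<beta>'\<close> compensates.\<close>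
  define B' where "B' = (1 + (\<Sum>x\<in>T'. B x)) * RJ powr \<beta>'"
  have RJp: "1 \<le> RJ powr \<beta>'" using RJ(1) \<beta>' by (simp add: ge_one_powr_ge_zero)
  have Bpos: "0 < B x" if "x \<in> T'" for x using sB(1) that T'(2) by blast
  have Bsum: "B x \<le> 1 + (\<Sum>x\<in>T'. B x)" if "x \<in> T'" for x
    using member_le_sum[OF that _ T'(1), of B] less_imp_le[OF Bpos] by force
  have BB': "B x * RJ powr \<beta>' \<le> B'" if "x \<in> T'" for x
    unfolding B'_def using Bsum[OF that] by (intro mult_right_mono) auto
  have BB: "B x \<le> B'" if "x \<in> T'" for x
    using BB'[OF that] mult_left_mono[OF RJp less_imp_le[OF Bpos[OF that]]] by linarith
  obtain x1 where "x1 \<in> T'" using T'(3)[OF x0] by blast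
  hence B'0: "0 < B'" using BB Bpos less_le_trans by blast
  have term_nn: "0 \<le> ereal B' / ereal (absv (z - zj) powr \<beta>')" for z zj
    using B'0 by (cases "absv (z - zj) powr \<beta>' = 0") (auto simp: divide_ereal_def ereal_divide)
  \<comment> \<open>A positive number divided by 0 is \<infinity> here, so the bound is trivial at
    the points of \<open>Z\<close>.\<close>
  have infty: "ereal B' / ereal (absv (z - z) powr \<beta>') = \<infinity>" for z
    using B'0 by (simp add: divide_ereal_def)
  have bound: "\<rho> z \<le> (\<Sum>zj\<in>Z. ereal B' / ereal (absv (z - zj) powr \<beta>'))" if z: "z \<in> V" for z
  proof -
    have one: "ereal B' / ereal (absv (z - w) powr \<beta>') \<le> (\<Sum>zj\<in>Z. ereal B' / ereal (absv (z - zj) powr \<beta>'))" if "w \<in> Z" for w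
      using sum_mono2[OF finZ, of "{w}" "\<lambda>zj. ereal B' / ereal (absv (z - zj) powr \<beta>')"] that term_nn
      by (simp only: sum.insert sum.empty finite.emptyI empty_iff not_False_eq_True add_0_right empty_subsetI insert_subset simp_thms)
    have fin: "ereal B' / ereal (absv (z - w) powr \<beta>') = ereal (B' * absv (z - w) powr (- \<beta>'))" if "w \<noteq> z" for w
      using that by (simp add: powr_minus divide_inverse)
    show ?thesis
    proof (cases "z \<in> Z")
      case True
      show ?thesis using one[OF True] infty by simp
    next
      case False
      hence zZ0: "z \<notin> Z0" by (simp add: Z_def)
      obtain x where x: "x \<in> T'" "absv (z - x) < s x" using V[OF z] by blast
      have xX: "x \<in> X" using x T' by blast
      have lt1: "absv (z - x) < 1" using x(2) sB(1)[OF xX] by simp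
      show ?thesis
      proof (cases "x \<in> Z0")
        case True
        have neq: "z \<noteq> x" using True zZ0 by blast
        have "\<rho>r z \<le> B x * absv (z - x) powr (- \<beta> x)" using sB(3)[OF xX True neq x(2)] by blast
        also have "\<dots> \<le> B' * absv (z - x) powr (- \<beta>')"
          using BB[OF x(1)] B'0 \<beta>'(3)[OF x(1)] lt1 neq by (intro mult_mono powr_mono') auto
        finally have "\<rho> z \<le> ereal (B' * absv (z - x) powr (- \<beta>'))" using zZ0 by (simp add: \<rho>_def)
        also have "\<dots> = ereal B' / ereal (absv (z - x) powr \<beta>')" using fin neq by metis
        also have "\<dots> \<le> (\<Sum>zj\<in>Z. ereal B' / ereal (absv (z - zj) powr \<beta>'))" using one True by (simp add: Z_def)
        finally show ?thesis .
      next
        case xZ0: False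
        have x0z: "x0 \<noteq> z" using False by (auto simp: Z_def)
        have "absv (z - x0) \<le> RJ"
        proof -
          have "absv z \<le> RJ" using absv_add[of "z - x" x] lt1 RJ(1) RJ(2)[OF X_forward(3)[OF xX]] by simp
          thus ?thesis using absv_diff[of z x0] RJ(2)[OF X_forward(3)[OF x0]] by simp
        qed
        hence "RJ powr (- \<beta>') \<le> absv (z - x0) powr (- \<beta>')" using x0z \<beta>'(1) by (intro powr_mono2') auto
        hence "B' * RJ powr (- \<beta>') \<le> B' * absv (z - x0) powr (- \<beta>')" using B'0 by simp
        moreover have "B x \<le> B' * RJ powr (- \<beta>')"
        proof -
          have "B x * (RJ powr \<beta>' * RJ powr (- \<beta>')) \<le> B' * RJ powr (- \<beta>')"
            using mult_right_mono[OF BB'[OF x(1)], of "RJ powr (- \<beta>')"] by (simp add: mult.assoc)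
          thus ?thesis using RJ(1) by (simp add: powr_add[symmetric])
        qed
        moreover have "\<rho>r z \<le> B x" using sB(2)[OF xX xZ0 x(2)] by blast
        ultimately have "\<rho> z \<le> ereal (B' * absv (z - x0) powr (- \<beta>'))" using zZ0 by (simp add: \<rho>_def)
        also have "\<dots> = ereal B' / ereal (absv (z - x0) powr \<beta>')" using fin x0z by metis
        also have "\<dots> \<le> (\<Sum>zj\<in>Z. ereal B' / ereal (absv (z - zj) powr \<beta>'))" using one by (simp add: Z_def)
        finally show ?thesis .
      qed
    qed
  qed
  have JX: "{x \<in> L. Some x \<in> Julia_set absv P Q UNIV} = X" by (auto simp: X_def Jc_def)
  have "admissible absv P Q L V \<rho> Z" unfolding admissible_def JX
  proof (intro conjI openV XV contV finZ ZX(2) ballI)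
    show "\<exists>C>0. \<forall>x\<in>V. ereal C \<le> \<rho> x"
      using \<rho>r_ge_1 by (intro exI[of _ 1]) (auto simp: \<rho>_def)
    show "\<rho> x \<noteq> \<infinity>" if "x \<in> V - Z" for x using that by (auto simp: \<rho>_def Z_def)
    show "\<exists>B>0. \<exists>\<beta>. 0 < \<beta> \<and> \<beta> < 1 \<and> (\<forall>z\<in>V. \<rho> z \<le> (\<Sum>zj\<in>Z. ereal B / ereal (absv (z - zj) powr \<beta>)))"
      using B'0 \<beta>' bound by blast
  qed
  moreover have "expanding_wrt absv P Q L \<rho> Z" unfolding expanding_wrt_def
  proof (intro exI[of _ \<Lambda>] conjI \<Lambda>(1) allI impI)
    fix x y assume x: "Some x \<in> Julia_set absv P Q L" and y: "rat_eval P Q (Some x) = Some y" and xZ: "x \<notin> Z" and yZ: "y \<notin> Z"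
    have xX: "x \<in> X" using Julia_subset[OF x] by (simp add: X_def)
    have yf: "y = f x" using y X_forward(2)[OF xX] by simp
    have x0: "x \<notin> Z0" "f x \<notin> Z0" using xZ yZ by (auto simp: Z_def yf)
    have noS: "\<forall>i\<le>N. (f ^^ i) x \<notin> S"
    proof (intro allI impI)
      fix i assume i: "i \<le> N"
      show "(f ^^ i) x \<notin> S"
      proof (cases i)
        case 0
        thus ?thesis using x0(1) xX N(1) by (auto simp: Z0_def)
      next
        case (Suc j)
        have "(f ^^ j) (f x) \<notin> S" using x0(2) X_forward(1)[OF xX] i Suc by (auto simp: Z0_def)
        thus ?thesis unfolding Suc funpow_Suc_right by simp
      qed
    qed
    have shift: "tm j (f x) * absv (df x) = \<Lambda> * tm (Suc j) x" for j
      using \<Lambda>(1) unfolding tm_def D_Suc' funpow_Suc_right by simp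
    have step: "\<Lambda> * tm (Suc j) x \<le> \<rho>r (f x) * absv (df x)" if "j < N" for j
      using mult_right_mono[OF tm_le[OF that, of "f x"], of "absv (df x)"] shift[of j] by simp
    obtain i where i: "i < N" "\<rho>r x = tm i x" using \<rho>r_in by blast
    \<comment> \<open>If the maximum at \<open>x\<close> sits at a positive index, the index shift
      gives the factor at once. At index 0, the doubling in \<open>expd\<close> shows that the
      discounted term \<open>k\<close> is at least as large. Index \<open>k = N\<close> is harmless,
      as only its predecessor has to be a legal index at \<open>f x\<close>.\<close>
    have "\<Lambda> * \<rho>r x \<le> \<rho>r (f x) * absv (df x)"
    proof (cases i)
      case (Suc j)
      thus ?thesis using i step[of j] by simp
    next
      case 0
      obtain k where k: "k \<in> {0<..N}" "2 * R0 x \<le> D k x * R0 ((f ^^ k) x)" using expd[OF xX noS] by blast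
      then obtain j where j: "k = Suc j" "j < N" by (cases k) auto
      have "\<Lambda> ^ k \<le> \<Lambda> ^ N" using k(1) \<Lambda>(1) by (intro power_increasing) auto
      hence "R0 x * \<Lambda> ^ k \<le> R0 x * 2" using \<Lambda>(2) R0_ge_1[of x] by simp
      hence "R0 x * \<Lambda> ^ k \<le> D k x * R0 ((f ^^ k) x)" using k(2) by simp
      hence "R0 x \<le> tm k x" unfolding tm_def using \<Lambda>(1) by (simp add: pos_le_divide_eq)
      moreover have "tm 0 x = R0 x" by (simp add: tm_def)
      ultimately have "\<Lambda> * \<rho>r x \<le> \<Lambda> * tm (Suc j) x" using 0 i(2) j(1) \<Lambda>(1) by simp
      thus ?thesis using step[OF j(2)] by simp
    qed
    thus "ereal \<Lambda> * \<rho> x \<le> \<rho> y * ereal (absv (rat_deriv P Q x))"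
      using x0 by (simp add: \<rho>_def yf df_def)
  qed
  ultimately show ?thesis unfolding expanding_admissible_def by blast
qed

end

subsection \<open>Julia points over ramified extensions\<close>

text \<open>\<open>E\<close> clears the denominators of the \<open>p\<close>-orders occurring in
  \<open>L1\<close>, and \<open>\<tau>\<close> has \<open>p\<close>-order \<open>1 / l\<close>. The
  prime \<open>l\<close> exceeds \<open>E\<close>, which puts values of \<open>\<tau>\<close>
  outside the value group of \<open>L1\<close>, and exceeds the degree of the map, which keeps
  monomials apart.\<close>

locale generic = dyn +
  fixes L1 :: "'a set" and \<tau> :: 'a and l E :: nat
  assumes heine_borel_L: "heine_borel L1" and sfL: "is_subfield L1" and overL: "over L1 P" "over L1 Q"
    and vals: "0 < E" "\<And>x. x \<in> L1 \<Longrightarrow> x \<noteq> 0 \<Longrightarrow> \<exists>k::int. absv x ^ E = real p powi k"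
    and l: "prime l" "E < l" "rat_deg P Q < l" and \<tau>: "\<tau> ^ l = of_nat p"
begin

text \<open>Absolute values available once \<open>\<tau>\<close> is adjoined but not taken on
  \<open>L1\<close>, by \<open>generic_value_not_value\<close>.\<close>

definition generic_value :: "real \<Rightarrow> bool" where
  "generic_value \<gamma> \<longleftrightarrow> (\<exists>g\<in>L1. \<exists>e. g \<noteq> 0 \<and> \<not> l dvd e \<and> \<gamma> = absv g * absv \<tau> ^ e)"

lemma \<tau>_neq_0: "\<tau> \<noteq> 0"
  using \<tau> p_gt_1 prime_gt_0_nat[OF l(1)] by (auto simp: zero_power)

lemma generic_value_pos: "generic_value \<gamma> \<Longrightarrow> 0 < \<gamma>"
  using \<tau>_neq_0 by (auto simp: generic_value_def)

lemma generic_value_power: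
  assumes "generic_value \<gamma>" "h \<in> L1" "h \<noteq> 0" "0 < i" "i < l"
  shows "generic_value (absv h * \<gamma> ^ i)"
proof -
  obtain g e where g: "g \<in> L1" "g \<noteq> 0" "\<not> l dvd e" "\<gamma> = absv g * absv \<tau> ^ e"
    using assms(1) by (auto simp: generic_value_def)
  have "\<not> l dvd i" using assms(4,5) by (auto dest: dvd_imp_le)
  hence "\<not> l dvd e * i" using g(3) prime_dvd_mult_iff[OF l(1)] by blast
  moreover have "absv h * \<gamma> ^ i = absv (h * g ^ i) * absv \<tau> ^ (e * i)"
    unfolding g(4) by (simp add: absv_mult power_mult_distrib power_mult)
  moreover have "h * g ^ i \<in> L1" "h * g ^ i \<noteq> 0" using g assms sfL by (auto intro!: subfield_simps)
  ultimately show ?thesis unfolding generic_value_def by blast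
qed

text \<open>Comparing \<open>p\<close>-orders after raising to the power \<open>E * l\<close> makes
  \<open>l\<close> divide \<open>e * E\<close>; but \<open>l\<close> is prime, exceeds
  \<open>E\<close> and does not divide \<open>e\<close>.\<close>

lemma generic_value_not_value:
  assumes "generic_value \<gamma>" "h \<in> L1" "h \<noteq> 0"
  shows "\<gamma> \<noteq> absv h"
proof
  assume eq: "\<gamma> = absv h"
  obtain g e where g: "g \<in> L1" "g \<noteq> 0" "\<not> l dvd e" "\<gamma> = absv g * absv \<tau> ^ e"
    using assms(1) by (auto simp: generic_value_def)
  have "absv (h / g) = absv \<tau> ^ e" using eq g(2,4) by (simp add: divide_eq_eq mult.commute)
  moreover have "h / g \<in> L1" "h / g \<noteq> 0" using assms g sfL by (auto intro!: subfield_simps)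
  ultimately obtain k :: int where k: "(absv \<tau> ^ e) ^ E = real p powi k" using vals(2) by metis
  have "absv \<tau> ^ l = 1 / real p" using arg_cong[OF \<tau>, of absv] by (simp add: absv_p)
  hence "((absv \<tau> ^ e) ^ E) ^ l = (1 / real p) ^ (e * E)"
    by (metis mult.commute power_mult)
  also have "\<dots> = real p powi (- int (e * E))"
    by (simp only: power_int_minus power_int_of_nat inverse_eq_divide power_one_over)
  finally have "real p powi (k * int l) = real p powi (- int (e * E))"
    unfolding k by (simp add: power_int_mult)
  hence "k * int l = - int (e * E)"
    using p_gt_1 by (metis power_int_strict_increasing not_less_iff_gr_or_eq)
  hence "int l dvd int (e * E)" by (metis dvd_minus_iff dvd_triv_right)
  hence "l dvd e * E" by (simp only: int_dvd_int_iff)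
  moreover have "\<not> l dvd E" using vals(1) l(2) by (auto dest: dvd_imp_le)
  ultimately show False using g(3) prime_dvd_mult_iff[OF l(1)] by blast
qed

text \<open>No two nonzero monomials have equal absolute value at \<open>x\<close>, since a ratio of
  coefficients would then have a generic value. Hence the largest monomial is not cancelled, and
  \<open>absv (poly t x)\<close> is the Gauss norm of \<open>t\<close> on the disc of radius
  \<open>absv x\<close>.\<close>

lemma poly_gen:
  assumes t: "over L1 t" "degree t < l" "t \<noteq> 0" and x: "generic_value (absv x)"
  obtains k where "k \<le> degree t" "coeff t k \<noteq> 0" "absv (poly t x) = absv (coeff t k) * absv x ^ k"
    "\<And>i. absv (coeff t i) * absv x ^ i \<le> absv (poly t x)"
proof -
  let ?g = "\<lambda>i. coeff t i * x ^ i" and ?I = "{..degree t}"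
  have fin: "finite ?I" "?I \<noteq> {}" by auto
  let ?A = "(\<lambda>i. absv (?g i)) ` ?I"
  have "Max ?A \<in> ?A" using fin by (intro Max_in) auto
  then obtain k where k0: "k \<in> ?I" "Max ?A = absv (?g k)" by blast
  have k: "k \<in> ?I" "\<And>i. i \<in> ?I \<Longrightarrow> absv (?g i) \<le> absv (?g k)"
    using k0(1) unfolding k0(2)[symmetric] by (auto intro!: Max_ge)
  have x0: "0 < absv x" using generic_value_pos[OF x] .
  have "0 < absv (?g (degree t))" using t(3) x0 by (auto simp: absv_mult)
  hence kpos: "0 < absv (?g k)" by (rule less_le_trans) (rule k(2), simp)
  hence tk: "coeff t k \<noteq> 0" by auto
  have less: "absv (?g i) < absv (?g k)" if i: "i \<in> ?I - {k}" for i
  proof (rule ccontr)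
    assume "\<not> ?thesis"
    hence eq: "absv (?g i) = absv (?g k)" using k(2)[of i] i by simp
    hence ti: "coeff t i \<noteq> 0" using kpos by auto
    have aux: False if jk: "j < k'" "k' < l" "absv (?g j) = absv (?g k')" "coeff t j \<noteq> 0" "coeff t k' \<noteq> 0" for j k'
    proof -
      have "absv (coeff t j) * absv x ^ j = absv (coeff t k') * absv x ^ k'" using jk(3) by (simp add: absv_mult)
      also have "absv x ^ k' = absv x ^ j * absv x ^ (k' - j)" using jk(1) by (simp flip: power_add)
      finally have "1 * absv x ^ (k' - j) = absv (coeff t j / coeff t k')"
        using x0 jk(5) by (simp add: field_simps)
      moreover have "generic_value (absv 1 * absv x ^ (k' - j))"
        using jk sfL by (intro generic_value_power x) (auto simp: subfield_simps)
      moreover have "coeff t j / coeff t k' \<in> L1" using t(1) sfL by (auto simp: over_def intro: subfield_simps)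
      ultimately show False using generic_value_not_value[of _ "coeff t j / coeff t k'"] jk(4,5) by (metis absv_1 divide_eq_0_iff)
    qed
    have kl: "k < l" "i < l" using k(1) i t(2) by auto
    consider "i < k" | "k < i" using i by force
    thus False
    proof cases
      case 1 show False by (rule aux[OF 1 kl(1) eq ti tk])
    next
      case 2 show False by (rule aux[OF 2 kl(2) eq[symmetric] tk ti])
    qed
  qed
  have pt: "absv (poly t x) = absv (?g k)"
    unfolding poly_altdef using fin(1) k(1) less by (rule absv_sum_dominant)
  show ?thesis
  proof (rule that[of k])
    show "k \<le> degree t" "coeff t k \<noteq> 0" using k tk by auto
    show "absv (poly t x) = absv (coeff t k) * absv x ^ k" using pt by (simp add: absv_mult)
    fix i show "absv (coeff t i) * absv x ^ i \<le> absv (poly t x)"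
    proof (cases "i \<le> degree t")
      case True
      thus ?thesis using k(2)[of i] pt by (simp add: absv_mult)
    qed (simp add: coeff_eq_0)
  qed
qed

end

context nonarch
begin

text \<open>\<open>N\<close> bounds the Gauss norm of the nonconstant part on the disc of radius
  \<open>\<gamma>\<close>; as for a Cauchy estimate, division by the radius bounds difference
  quotients.\<close>

lemma poly_gauss_lipschitz:
  assumes N: "\<And>i. 0 < i \<Longrightarrow> absv (coeff t i) * \<gamma> ^ i \<le> N" and \<gamma>: "0 < \<gamma>" and N0: "0 \<le> N"
    and z: "absv z \<le> \<gamma>" "absv z' \<le> \<gamma>"
  shows "absv (poly t z - poly t z') \<le> N / \<gamma> * absv (z - z')"
proof -
  have "poly t z - poly t z' = (\<Sum>i\<le>degree t. coeff t i * (z ^ i - z' ^ i))"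
    by (simp add: poly_altdef sum_subtractf right_diff_distrib)
  also have "absv \<dots> \<le> N / \<gamma> * absv (z - z')"
  proof (rule absv_sum_le)
    show "0 \<le> N / \<gamma> * absv (z - z')" using N0 \<gamma> by simp
    fix i assume "i \<in> {..degree t}"
    show "absv (coeff t i * (z ^ i - z' ^ i)) \<le> N / \<gamma> * absv (z - z')"
    proof (cases i)
      case 0
      thus ?thesis using N0 \<gamma> by simp
    next
      case (Suc n)
      have "absv (coeff t i * (z ^ i - z' ^ i)) \<le> absv (coeff t i) * (\<gamma> ^ n * absv (z - z'))"
        unfolding absv_mult Suc using absv_power_diff[OF z, of n] by (intro mult_left_mono) auto
      also have "\<dots> = absv (coeff t i) * \<gamma> ^ i / \<gamma> * absv (z - z')" using \<gamma> by (simp add: Suc)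
      also have "\<dots> \<le> N / \<gamma> * absv (z - z')"
        using N[of i] Suc \<gamma> by (intro mult_right_mono divide_right_mono) auto
      finally show ?thesis .
    qed
  qed
  finally show ?thesis .
qed

end

context generic
begin

text \<open>The numerator \<open>T\<close> of \<open>f z - f b\<close>, expanded at
  \<open>b\<close>, has no constant term, so its dominating monomial at \<open>u\<close> has
  positive degree below \<open>l\<close> and turns a generic distance into a generic one. As
  \<open>u\<close> realises the Gauss norm, the single displacement \<open>absv (f u - f b)\<close>
  controls \<open>f\<close> on the whole disc.\<close>

lemma generic_value_step:
  assumes b: "b \<in> L1" "poly Q b \<noteq> 0" and u: "generic_value (absv (u - b))"
    and Qb: "\<And>z. absv (z - b) \<le> absv (u - b) \<Longrightarrow> absv (poly Q z) = absv (poly Q b)"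
  shows "generic_value (absv (f u - f b))"
    "\<And>z z'. absv (z - b) \<le> absv (u - b) \<Longrightarrow> absv (z' - b) \<le> absv (u - b) \<Longrightarrow>
       absv (f z - f z') \<le> absv (f u - f b) / absv (u - b) * absv (z - z')"
proof -
  define \<gamma> where "\<gamma> = absv (u - b)"
  have \<gamma>: "0 < \<gamma>" unfolding \<gamma>_def by (rule generic_value_pos[OF u])
  define sh where "sh q = pcompose q [:b, 1:]" for q :: "'a poly"
  have sh: "poly (sh q) x = poly q (b + x)" for q x by (simp add: sh_def poly_pcompose)
  have osh: "over L1 (sh q)" if "over L1 q" for q
    unfolding sh_def using that b(1) sfL by (intro over_pcompose) (auto simp: over_simps subfield_simps)
  have dsh: "degree (sh q) = degree q" for q by (simp add: sh_def degree_pcompose)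
  define T where "T = smult (poly Q b) (sh P) - smult (poly P b) (sh Q)"
  have polyT: "poly T x = poly Q b * poly P (b + x) - poly P b * poly Q (b + x)" for x
    by (simp add: T_def sh)
  have QL: "poly Q b \<in> L1" "poly P b \<in> L1" using overL b sfL by (auto intro!: over_poly)
  have oT: "over L1 T" unfolding T_def using overL QL sfL by (intro over_simps osh) auto
  have dT: "degree T < l"
  proof -
    have "degree T \<le> max (degree P) (degree Q)" unfolding T_def
      by (rule order_trans[OF degree_diff_le_max]) (use degree_smult_le[of _ "sh P"] degree_smult_le[of _ "sh Q"] dsh in \<open>force simp: le_max_iff_disj\<close>)
    thus ?thesis using l(3) unfolding rat_deg_def by linarith
  qed
  have T0: "T \<noteq> 0"
  proof
    assume "T = 0"
    hence "poly Q b * poly P (b + (x - b)) - poly P b * poly Q (b + (x - b)) = 0" for x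
      using polyT[of "x - b"] by simp
    hence "poly (P - smult (f b) Q) x = 0" for x using b(2) by (simp add: f_def field_simps)
    hence "P - smult (f b) Q = 0" unfolding poly_all_0_iff_0[symmetric] ..
    thus False using fiber_neq_0 by blast
  qed
  have cT: "coeff T 0 = 0" using polyT[of 0] by (simp add: poly_0_coeff_0)
  obtain k where k: "k \<le> degree T" "coeff T k \<noteq> 0" "absv (poly T (u - b)) = absv (coeff T k) * absv (u - b) ^ k"
    "\<And>i. absv (coeff T i) * absv (u - b) ^ i \<le> absv (poly T (u - b))"
    by (rule poly_gen[OF oT dT T0 u]) (rule that; assumption)
  have k0: "0 < k" "k < l" using k cT dT by (auto intro: Nat.gr0I)
  have Qz: "absv (poly Q z) = absv (poly Q b)" if "absv (z - b) \<le> \<gamma>" for z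
    by (rule Qb) (use that in \<open>simp add: \<gamma>_def\<close>)
  have Q0: "poly Q z \<noteq> 0" if "absv (z - b) \<le> \<gamma>" for z using Qz[OF that] b(2) by (metis absv_eq_0)
  have Qpos: "0 < absv (poly Q b)" using b by simp
  have fb: "f z - f b = poly T (z - b) / (poly Q z * poly Q b)" if "absv (z - b) \<le> \<gamma>" for z
    using Q0[OF that] b(2) by (simp add: polyT f_def field_simps)
  have fub: "absv (f u - f b) = absv (poly T (u - b)) / absv (poly Q b) ^ 2"
    using fb[of u] Qz[of u] by (simp add: \<gamma>_def absv_mult power2_eq_square)
  have fuk: "absv (f u - f b) = absv (coeff T k / poly Q b ^ 2) * absv (u - b) ^ k"
    unfolding fub k(3) by simp
  have cL: "coeff T k / poly Q b ^ 2 \<in> L1" using oT QL sfL by (auto simp: over_def intro!: subfield_simps)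
  have c0: "coeff T k / poly Q b ^ 2 \<noteq> 0" using k(2) b(2) by simp
  show "generic_value (absv (f u - f b))" unfolding fuk by (rule generic_value_power[OF u cL c0 k0])
  define q where "q = sh Q - [:poly Q b:]"
  have polyq: "poly q x = poly Q (b + x) - poly Q b" for x by (simp add: q_def sh)
  have oq: "over L1 q" unfolding q_def using overL QL sfL by (intro over_simps osh) auto
  have dq: "degree q < l"
  proof -
    have "degree q \<le> max (degree (sh Q)) (degree [:poly Q b:])" unfolding q_def by (rule degree_diff_le_max)
    thus ?thesis using l(3) by (auto simp: rat_deg_def dsh)
  qed
  have Nq: "absv (coeff q i) * \<gamma> ^ i \<le> absv (poly Q b)" for i
  proof (cases "q = 0")
    case False
    obtain k' where "\<And>i. absv (coeff q i) * absv (u - b) ^ i \<le> absv (poly q (u - b))"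
      by (rule poly_gen[OF oq dq False u]) (rule that; assumption)
    hence "absv (coeff q i) * \<gamma> ^ i \<le> absv (poly Q u - poly Q b)" by (simp add: \<gamma>_def polyq)
    also have "\<dots> \<le> absv (poly Q b)" using absv_diff[of "poly Q u" "poly Q b"] Qz[of u] by (simp add: \<gamma>_def)
    finally show ?thesis .
  qed auto
  define N where "N = absv (poly T (u - b))"
  have N: "0 \<le> N" "\<And>i. absv (coeff T i) * \<gamma> ^ i \<le> N" using k(4) by (auto simp: N_def \<gamma>_def)
  fix z z' assume z: "absv (z - b) \<le> absv (u - b)" "absv (z' - b) \<le> absv (u - b)"
  hence z\<gamma>: "absv (z - b) \<le> \<gamma>" "absv (z' - b) \<le> \<gamma>" by (auto simp: \<gamma>_def)
  have TL: "absv (poly T (z - b) - poly T (z' - b)) \<le> N / \<gamma> * absv (z - z')"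
    using poly_gauss_lipschitz[of T \<gamma> N "z - b" "z' - b"] N \<gamma> z\<gamma> by simp
  have TB: "absv (poly T (z' - b)) \<le> N"
  proof -
    have "absv (poly T (z' - b) - poly T 0) \<le> N / \<gamma> * absv (z' - b - 0)"
      using N \<gamma> z\<gamma> by (intro poly_gauss_lipschitz) auto
    also have "\<dots> \<le> N / \<gamma> * \<gamma>" using N \<gamma> z\<gamma> by (intro mult_left_mono) auto
    finally show ?thesis using \<gamma> cT by (simp add: poly_0_coeff_0)
  qed
  have QLip: "absv (poly Q z' - poly Q z) \<le> absv (poly Q b) / \<gamma> * absv (z - z')"
  proof -
    have "absv (poly q (z' - b) - poly q (z - b)) \<le> absv (poly Q b) / \<gamma> * absv (z' - b - (z - b))"
      using Nq \<gamma> z\<gamma> by (intro poly_gauss_lipschitz) auto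
    thus ?thesis by (simp add: polyq absv_commute[of z'])
  qed
  have "t / (x * c) - t' / (x' * c) = ((t - t') * x' + t' * (x' - x)) / (c * x * x')" if "c \<noteq> 0" "x \<noteq> 0" "x' \<noteq> 0" for t t' x x' c :: 'a
    using that by (simp add: field_simps)
  note quot = this[OF b(2) Q0[OF z\<gamma>(1)] Q0[OF z\<gamma>(2)], of "poly T (z - b)" "poly T (z' - b)"]
  have "f z - f z' = (f z - f b) - (f z' - f b)" by simp
  also have "\<dots> = ((poly T (z - b) - poly T (z' - b)) * poly Q z' + poly T (z' - b) * (poly Q z' - poly Q z)) / (poly Q b * poly Q z * poly Q z')"
    unfolding fb[OF z\<gamma>(1)] fb[OF z\<gamma>(2)] by (rule quot)
  finally have eq: "f z - f z' = ((poly T (z - b) - poly T (z' - b)) * poly Q z' + poly T (z' - b) * (poly Q z' - poly Q z)) / (poly Q b * poly Q z * poly Q z')" .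
  let ?B = "absv (poly Q b)"
  have "absv ((poly T (z - b) - poly T (z' - b)) * poly Q z') \<le> N / \<gamma> * absv (z - z') * ?B"
    unfolding absv_mult Qz[OF z\<gamma>(2)] by (intro mult_right_mono TL) auto
  moreover have "absv (poly T (z' - b) * (poly Q z' - poly Q z)) \<le> N * (?B / \<gamma> * absv (z - z'))"
    unfolding absv_mult using TB QLip N(1) by (intro mult_mono) auto
  hence "absv (poly T (z' - b) * (poly Q z' - poly Q z)) \<le> N / \<gamma> * absv (z - z') * ?B" by (simp add: mult_ac)
  ultimately have "absv ((poly T (z - b) - poly T (z' - b)) * poly Q z' + poly T (z' - b) * (poly Q z' - poly Q z)) \<le> N / \<gamma> * absv (z - z') * ?B"
    by (rule absv_leI)
  hence "absv (f z - f z') \<le> N / \<gamma> * absv (z - z') * ?B / (?B * ?B * ?B)"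
    unfolding eq absv_divide absv_mult Qz[OF z\<gamma>(1)] Qz[OF z\<gamma>(2)] using Qpos by (intro divide_right_mono) auto
  also have "\<dots> = N / ?B ^ 2 / \<gamma> * absv (z - z')" using Qpos \<gamma> by (simp add: field_simps power2_eq_square)
  finally show "absv (f z - f z') \<le> absv (f u - f b) / absv (u - b) * absv (z - z')"
    unfolding fub N_def \<gamma>_def .
qed

lemma Q_locally_constant:
  obtains \<delta> where "0 < \<delta>" "\<And>b z. b \<in> Jc \<inter> L1 \<Longrightarrow> absv (z - b) < \<delta> \<Longrightarrow> absv (poly Q z) = absv (poly Q b)"
proof (rule cpt_uniform[where X = "Jc \<inter> L1" and R = "\<lambda>k b. \<forall>z. absv (z - b) < k \<longrightarrow> absv (poly Q z) = absv (poly Q b)"])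
  show "cpt (Jc \<inter> L1)" by (rule cpt_Jc[OF heine_borel_L])
next
  fix x assume "x \<in> Jc \<inter> L1"
  hence "0 < absv (poly Q x)" using Jc_forward(1) by auto
  then obtain d where d: "0 < d" "\<And>u. absv (u - x) < d \<Longrightarrow> absv (poly Q u - poly Q x) < absv (poly Q x)"
    by (rule poly_cont[of _ x Q]) (rule that; assumption)
  have eq: "absv (poly Q u) = absv (poly Q x)" if "absv (u - x) < d" for u using absv_eq_if_close[OF d(2)[OF that]] .
  have "\<forall>y\<in>Jc \<inter> L1. absv (y - x) < d \<longrightarrow> (\<forall>z. absv (z - y) < d \<longrightarrow> absv (poly Q z) = absv (poly Q y))"
  proof (intro ballI impI allI)
    fix y z assume "absv (y - x) < d" "absv (z - y) < d"
    thus "absv (poly Q z) = absv (poly Q y)" using eq[of y] eq[of z] absv_ultra_less[of z y d x] by simp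
  qed
  thus "\<exists>r>0. \<exists>k>0. \<forall>y\<in>Jc \<inter> L1. absv (y - x) < r \<longrightarrow> (\<forall>z. absv (z - y) < k \<longrightarrow> absv (poly Q z) = absv (poly Q y))"
    using d(1) by blast
next
  fix k k' y assume k: "\<forall>z. absv (z - y) < k \<longrightarrow> absv (poly Q z) = absv (poly Q y)" "0 < k'" "k' \<le> k"
  show "\<forall>z. absv (z - y) < k' \<longrightarrow> absv (poly Q z) = absv (poly Q y)"
  proof (intro allI impI)
    fix z assume "absv (z - y) < k'"
    hence "absv (z - y) < k" using k(3) by linarith
    thus "absv (poly Q z) = absv (poly Q y)" by (rule k(1)[rule_format])
  qed
next
  fix k assume k: "0 < k" "\<And>y. y \<in> Jc \<inter> L1 \<Longrightarrow> \<forall>z. absv (z - y) < k \<longrightarrow> absv (poly Q z) = absv (poly Q y)"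
  show thesis by (rule that[OF k(1)]) (rule k(2)[rule_format])
qed

text \<open>Were \<open>x\<close> a Fatou point over \<open>L\<close>, the point
  \<open>u = x + p ^ k * \<tau>\<close> of \<open>L\<close> would follow the orbit of
  \<open>x\<close> within \<open>\<delta>\<close> for ever. Its distance from that orbit stays
  generic, so by \<open>generic_value_step\<close> the disc of radius \<open>\<gamma>0\<close> in
  the large field follows as closely, with a common Lipschitz constant, and \<open>x\<close> would
  be a Fatou point there too.\<close>

lemma Julia_extension:
  assumes L: "is_subfield L" "L1 \<subseteq> L" "\<tau> \<in> L" and x: "x \<in> Jc" "x \<in> L1"
  shows "Some x \<in> Julia_set absv P Q L"
proof (rule ccontr)
  assume "\<not> ?thesis"
  hence "\<exists>r>0. equicont_ball L x r" using x L unfolding Julia_iff by blast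
  then obtain r where r: "0 < r" "equicont_ball L x r" by blast
  obtain \<delta> where \<delta>: "0 < \<delta>" "\<And>b z. b \<in> Jc \<inter> L1 \<Longrightarrow> absv (z - b) < \<delta> \<Longrightarrow> absv (poly Q z) = absv (poly Q b)"
    by (rule Q_locally_constant) (rule that; assumption)
  obtain R where R: "1 \<le> R" "\<And>x. x \<in> Jc \<Longrightarrow> absv x \<le> R" using Jc_bounded by blast
  \<comment> \<open>Chordal distance below \<open>e\<close> from a Julia point forces ordinary
    distance below \<open>\<delta>\<close>, because Julia points are bounded by \<open>R\<close>;
    see \<open>chordal_small\<close>.\<close>
  define e where "e = min (1 / R) (\<delta> / R\<^sup>2)"
  have e: "0 < e" "e \<le> 1 / R" "e * R\<^sup>2 \<le> \<delta>"
  proof -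
    have "e * R\<^sup>2 \<le> \<delta> / R\<^sup>2 * R\<^sup>2" unfolding e_def by (intro mult_right_mono) auto
    thus "e * R\<^sup>2 \<le> \<delta>" using R by simp
  qed (use R \<delta>(1) in \<open>auto simp: e_def\<close>)
  have xL: "x \<in> L" using x L by blast
  have x0: "absv (x - x) < r" using r by simp
  obtain d where d: "0 < d" "\<And>u n. u \<in> L \<Longrightarrow> absv (u - x) < r \<Longrightarrow> absv (x - u) < d \<Longrightarrow> 1 \<le> n \<Longrightarrow>
     chordal absv ((rat_eval P Q ^^ n) (Some x)) ((rat_eval P Q ^^ n) (Some u)) < e"
    by (rule equicont_ballD[OF r(2) xL x0 e(1)]) (rule that; assumption)
  have "0 < min (min r d) \<delta> / absv \<tau>" using r(1) d(1) \<delta>(1) \<tau>_neq_0 by simp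
  then obtain k where k: "absv (of_nat p ^ k) < min (min r d) \<delta> / absv \<tau>" using exists_close by blast
  define u where "u = x + of_nat p ^ k * \<tau>"
  define \<gamma>0 where "\<gamma>0 = absv (u - x)"
  have ux: "absv (u - x) < r" "absv (x - u) < d" "absv (u - x) < \<delta>"
    using k \<tau>_neq_0 by (auto simp: u_def absv_mult pos_less_divide_eq)
  have uL: "u \<in> L" unfolding u_def using xL L by (auto intro!: subfield_simps subfield_of_nat)
  have "\<not> l dvd 1" using prime_gt_1_nat[OF l(1)] by simp
  hence g0: "generic_value (absv (u - x))"
    unfolding generic_value_def u_def using sfL
    by (intro bexI[of _ "of_nat p ^ k"] exI[of _ 1])
       (use p_gt_1 in \<open>auto simp: absv_mult intro!: subfield_simps subfield_of_nat\<close>)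
  have \<gamma>0: "0 < \<gamma>0" unfolding \<gamma>0_def by (rule generic_value_pos[OF g0])
  have bL: "(f ^^ n) x \<in> L1" for n
  proof (induction n)
    case (Suc n)
    thus ?case using sfL overL by (auto simp: f_def[of "(f ^^ n) x"] intro!: subfield_simps over_poly)
  qed (use x in simp)
  have bJ: "(f ^^ n) x \<in> Jc" for n using Jc_iterate[OF x(1)] .
  have main: "(rat_eval P Q ^^ n) (Some u) = Some ((f ^^ n) u) \<and> absv ((f ^^ n) u - (f ^^ n) x) < \<delta> \<and>
     generic_value (absv ((f ^^ n) u - (f ^^ n) x)) \<and>
     (\<forall>z z'. absv (z - x) \<le> \<gamma>0 \<longrightarrow> absv (z' - x) \<le> \<gamma>0 \<longrightarrow>
        absv ((f ^^ n) z - (f ^^ n) z') \<le> absv ((f ^^ n) u - (f ^^ n) x) / \<gamma>0 * absv (z - z'))" for n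
  proof (induction n)
    case 0
    show ?case using ux g0 \<gamma>0 by (simp add: \<gamma>0_def)
  next
    case (Suc n)
    let ?b = "(f ^^ n) x" and ?u = "(f ^^ n) u"
    have IH: "(rat_eval P Q ^^ n) (Some u) = Some ?u" "absv (?u - ?b) < \<delta>" "generic_value (absv (?u - ?b))"
     "\<And>z z'. absv (z - x) \<le> \<gamma>0 \<Longrightarrow> absv (z' - x) \<le> \<gamma>0 \<Longrightarrow>
        absv ((f ^^ n) z - (f ^^ n) z') \<le> absv (?u - ?b) / \<gamma>0 * absv (z - z')"
      using Suc by auto
    have Qb: "absv (poly Q z) = absv (poly Q ?b)" if "absv (z - ?b) \<le> absv (?u - ?b)" for z
      by (rule \<delta>(2)) (use that IH(2) bL bJ in auto)
    have Qb0: "poly Q ?b \<noteq> 0" using Jc_forward(1) bJ by blast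
    have "poly Q ?u \<noteq> 0" using Qb[of ?u] Qb0 by (metis absv_eq_0 order_refl)
    hence ev: "(rat_eval P Q ^^ Suc n) (Some u) = Some ((f ^^ Suc n) u)" using IH(1) by simp
    have step1: "generic_value (absv (f ?u - f ?b))" by (rule generic_value_step(1)[OF bL Qb0 IH(3)]) (rule Qb)
    have step2: "absv (f z - f z') \<le> absv (f ?u - f ?b) / absv (?u - ?b) * absv (z - z')"
      if "absv (z - ?b) \<le> absv (?u - ?b)" "absv (z' - ?b) \<le> absv (?u - ?b)" for z z'
      by (rule generic_value_step(2)[OF bL Qb0 IH(3) _ that]) (rule Qb)
    have in_ball: "absv ((f ^^ n) z - ?b) \<le> absv (?u - ?b)" if "absv (z - x) \<le> \<gamma>0" for z
    proof -
      have "absv ((f ^^ n) z - ?b) \<le> absv (?u - ?b) / \<gamma>0 * absv (z - x)" using IH(4)[OF that, of x] \<gamma>0 by simp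
      also have "\<dots> \<le> absv (?u - ?b) / \<gamma>0 * \<gamma>0" using that \<gamma>0 by (intro mult_left_mono) auto
      finally show ?thesis using \<gamma>0 by simp
    qed
    have close: "absv ((f ^^ Suc n) u - (f ^^ Suc n) x) < \<delta>"
    proof -
      let ?b' = "(f ^^ Suc n) x"
      have b'R: "max 1 (absv ?b') \<le> R" using R bJ[of "Suc n"] by simp
      have "chordal absv (Some ?b') (Some ((f ^^ Suc n) u)) < e"
        using d(2)[OF uL ux(1,2), of "Suc n"] unfolding ev Jc_rat_eval[OF x(1)] by simp
      moreover have "e \<le> 1 / max 1 (absv ?b')"
      proof -
        have "1 / R \<le> 1 / max 1 (absv ?b')" using b'R by (intro divide_left_mono) auto
        thus ?thesis using e(2) by simp
      qed
      ultimately obtain y where y: "Some ((f ^^ Suc n) u) = Some y" "absv (?b' - y) < e * (max 1 (absv ?b'))\<^sup>2"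
        by (rule chordal_small) (rule that; assumption)
      have "e * (max 1 (absv ?b'))\<^sup>2 \<le> e * R\<^sup>2" using b'R e(1) by (intro mult_left_mono power_mono) auto
      hence "absv (?b' - y) < \<delta>" using y(2) e(3) by linarith
      thus ?thesis using y(1) by (simp add: absv_commute)
    qed
    have lip: "absv ((f ^^ Suc n) z - (f ^^ Suc n) z') \<le> absv ((f ^^ Suc n) u - (f ^^ Suc n) x) / \<gamma>0 * absv (z - z')"
      if z: "absv (z - x) \<le> \<gamma>0" "absv (z' - x) \<le> \<gamma>0" for z z'
    proof -
      have pos: "0 < absv (?u - ?b)" by (rule generic_value_pos[OF IH(3)])
      have "absv (f ((f ^^ n) z) - f ((f ^^ n) z')) \<le> absv (f ?u - f ?b) / absv (?u - ?b) * absv ((f ^^ n) z - (f ^^ n) z')"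
        by (rule step2[OF in_ball[OF z(1)] in_ball[OF z(2)]])
      also have "\<dots> \<le> absv (f ?u - f ?b) / absv (?u - ?b) * (absv (?u - ?b) / \<gamma>0 * absv (z - z'))"
        using IH(4)[OF z] by (intro mult_left_mono) auto
      also have "\<dots> = absv (f ?u - f ?b) / \<gamma>0 * absv (z - z')" using pos by simp
      finally show ?thesis by simp
    qed
    have "generic_value (absv ((f ^^ Suc n) u - (f ^^ Suc n) x))" using step1 by simp
    thus ?case using ev close lip by blast
  qed
  have bd: "absv ((f ^^ n) z - (f ^^ n) z') \<le> \<delta> / \<gamma>0 * absv (z - z')" if "absv (z - x) < \<gamma>0" "absv (z' - x) < \<gamma>0" for n z z'
  proof -
    have "absv ((f ^^ n) z - (f ^^ n) z') \<le> absv ((f ^^ n) u - (f ^^ n) x) / \<gamma>0 * absv (z - z')"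
      using main[of n] that by simp
    also have "\<dots> \<le> \<delta> / \<gamma>0 * absv (z - z')"
      using main[of n] \<gamma>0 by (intro mult_right_mono divide_right_mono) auto
    finally show ?thesis .
  qed
  have "x \<notin> Jc"
  proof (rule Fatou_criterion[OF \<gamma>0, of _ "\<delta> / \<gamma>0"])
    fix n z assume z: "absv (z - x) < \<gamma>0"
    have "absv ((f ^^ n) z - (f ^^ n) x) \<le> \<delta> / \<gamma>0 * absv (z - x)" using bd[OF z, of x] \<gamma>0 by simp
    also have "\<dots> < \<delta> / \<gamma>0 * \<gamma>0" using z \<gamma>0 \<delta>(1) by (intro mult_strict_left_mono) auto
    finally have "absv (poly Q ((f ^^ n) z)) = absv (poly Q ((f ^^ n) x))"
      by (intro \<delta>(2)) (use \<gamma>0 bL bJ in auto)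
    thus "poly Q ((f ^^ n) z) \<noteq> 0" using Jc_forward(1)[OF bJ] by (metis absv_eq_0)
    fix w assume "absv (w - x) < \<gamma>0"
    thus "absv ((f ^^ n) z - (f ^^ n) w) \<le> \<delta> / \<gamma>0 * absv (z - w)" by (rule bd[OF z])
  qed
  thus False using x by simp
qed

end

context dyn
begin

lemma Julia_extension_exists:
  assumes "heine_borel L1" "is_subfield L1" "over L1 P" "over L1 Q"
  shows "\<exists>L. finite_ext L1 L \<and> (\<forall>x\<in>Jc \<inter> L1. Some x \<in> Julia_set absv P Q L)"
proof -
  obtain E :: nat where E: "0 < E" "\<And>x. x \<in> L1 \<Longrightarrow> x \<noteq> 0 \<Longrightarrow> \<exists>k::int. absv x ^ E = real p powi k"
    by (rule heine_borel_values[OF assms(1,2)]) (rule that; assumption)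
  obtain l where l: "prime l" "max E (rat_deg P Q) < l" using bigger_prime by blast
  have l0: "0 < l" using prime_gt_0_nat[OF l(1)] .
  define m where "m = monom 1 l + [:- of_nat p :: 'a:]"
  have dm: "degree m = l"
    unfolding m_def using l0 by (simp add: degree_add_eq_left degree_monom_eq)
  then obtain \<tau> where \<tau>: "poly m \<tau> = 0" using alg_closed[of m] l0 by auto
  have t: "\<tau> ^ l = of_nat p" using \<tau> by (simp add: m_def poly_monom)
  have "over L1 m" unfolding m_def using assms(2) by (auto intro!: over_simps subfield_simps subfield_of_nat)
  moreover have "m \<noteq> 0" using dm l0 by auto
  ultimately obtain L where L: "finite_ext L1 L" "\<tau> \<in> L"
    using finite_ext_adjoin[OF assms(2) _ _ \<tau>] by blast
  interpret generic absv p P Q L1 \<tau> l E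
    by unfold_locales (use assms E l t in auto)
  have "Some x \<in> Julia_set absv P Q L" if "x \<in> Jc \<inter> L1" for x
    using that L by (intro Julia_extension) (auto simp: finite_ext_iff)
  thus ?thesis using L(1) by blast
qed

end

subsection \<open>Critical orbits of an expanding map\<close>

context dyn
begin

definition accumulates :: "'a set \<Rightarrow> 'a \<Rightarrow> bool" where
  "accumulates A x \<longleftrightarrow> (\<forall>r>0. \<exists>y\<in>A. y \<noteq> x \<and> absv (y - x) < r)"

lemma near_image:
  assumes Q: "poly Q w \<noteq> 0" and e: "0 < e"
  shows "\<exists>d>0. \<forall>z. z \<noteq> w \<longrightarrow> absv (z - w) < d \<longrightarrow> f z \<noteq> f w \<and> absv (f z - f w) < e"
proof -
  obtain a \<delta> where a: "0 < \<delta>" "\<delta> \<le> 1" "a \<noteq> 0"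
    "\<And>b. absv (b - w) < \<delta> \<Longrightarrow> absv (f b - f w) = absv a * absv (b - w) ^ mult w"
    by (rule local_mono[OF Q]) (rule that; assumption)
  have ap: "0 < absv a" using a by simp
  show ?thesis
  proof (intro exI[of _ "min \<delta> (e / absv a)"] conjI allI impI)
    show "0 < min \<delta> (e / absv a)" using a(1) e ap by simp
    fix z assume z: "z \<noteq> w" "absv (z - w) < min \<delta> (e / absv a)"
    have eq: "absv (f z - f w) = absv a * absv (z - w) ^ mult w" using a(4)[of z] z(2) by simp
    have "0 < absv a * absv (z - w) ^ mult w" using ap z(1) by simp
    hence "0 < absv (f z - f w)" by (simp only: eq)
    thus "f z \<noteq> f w" by auto
    have "absv (z - w) ^ mult w \<le> absv (z - w) ^ 1"
      using mult_pos[OF Q] z(2) a(2) by (intro power_decreasing) auto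
    hence "absv a * absv (z - w) ^ mult w \<le> absv a * absv (z - w)" using ap by simp
    also have "\<dots> < e" using z(2) ap by (simp add: pos_less_divide_eq mult.commute)
    finally show "absv (f z - f w) < e" using eq by simp
  qed
qed

lemma near_iterate:
  assumes x: "x \<in> Jc"
  shows "0 < e \<Longrightarrow> \<exists>d>0. \<forall>z. z \<noteq> x \<longrightarrow> absv (z - x) < d \<longrightarrow> (f ^^ j) z \<noteq> (f ^^ j) x \<and> absv ((f ^^ j) z - (f ^^ j) x) < e"
proof (induction j arbitrary: e)
  case 0
  thus ?case by auto
next
  case (Suc j)
  obtain d where d: "0 < d" "\<And>z. z \<noteq> (f ^^ j) x \<Longrightarrow> absv (z - (f ^^ j) x) < d \<Longrightarrow> f z \<noteq> f ((f ^^ j) x) \<and> absv (f z - f ((f ^^ j) x)) < e"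
    using near_image[OF Jc_forward(1)[OF Jc_iterate[OF x]] Suc.prems] by blast
  obtain d' where d': "0 < d'" "\<And>z. z \<noteq> x \<Longrightarrow> absv (z - x) < d' \<Longrightarrow> (f ^^ j) z \<noteq> (f ^^ j) x \<and> absv ((f ^^ j) z - (f ^^ j) x) < d"
    using Suc.IH[OF d(1)] by blast
  show ?case
  proof (intro exI[of _ d'] conjI allI impI d'(1))
    fix z assume z: "z \<noteq> x" "absv (z - x) < d'"
    from d(2)[OF conjunct1[OF d'(2)[OF z]] conjunct2[OF d'(2)[OF z]]]
    show "(f ^^ Suc j) z \<noteq> (f ^^ Suc j) x" "absv ((f ^^ Suc j) z - (f ^^ Suc j) x) < e" by simp_all
  qed
qed

lemma df_near:
  assumes Q: "poly Q w \<noteq> 0"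
  shows "\<exists>B>0. \<exists>d>0. \<forall>z. z \<noteq> w \<longrightarrow> absv (z - w) < d \<longrightarrow> absv (df z) \<le> B * (if df w = 0 then absv (z - w) else 1)"
proof -
  obtain a \<delta> where a: "0 < \<delta>" "\<delta> \<le> 1" "a \<noteq> 0"
    "\<And>b. b \<noteq> w \<Longrightarrow> absv (b - w) < \<delta> \<Longrightarrow> absv (df b) = absv (of_nat (mult w)) * absv a * absv (b - w) ^ (mult w - 1)"
    by (rule local_mono[OF Q]) (rule that; assumption)
  have m: "absv (of_nat (mult w)) \<le> 1" by (rule absv_of_nat_le)
  show ?thesis
  proof (rule exI[of _ "absv a"], rule conjI, simp add: a(3), rule exI[of _ \<delta>], intro conjI allI impI a(1))
    fix z assume z: "z \<noteq> w" "absv (z - w) < \<delta>"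
    have "absv (df z) \<le> 1 * absv a * absv (z - w) ^ (mult w - 1)"
      unfolding a(4)[OF z] using m by (intro mult_right_mono) auto
    also have "absv (z - w) ^ (mult w - 1) \<le> (if df w = 0 then absv (z - w) else 1)"
    proof (cases "df w = 0")
      case True
      hence "1 \<le> mult w - 1" using mult_eq_1_iff[OF Q] mult_pos[OF Q] by linarith
      hence "absv (z - w) ^ (mult w - 1) \<le> absv (z - w) ^ 1" using z a(2) by (intro power_decreasing) auto
      thus ?thesis using True by simp
    qed (use z a(2) in \<open>auto intro: power_le_one\<close>)
    finally show "absv (df z) \<le> absv a * (if df w = 0 then absv (z - w) else 1)" by (simp add: mult_left_mono)
  qed
qed

lemma D_near:
  assumes x: "x \<in> Jc"
  shows "\<exists>B>0. \<exists>d>0. \<forall>z. z \<noteq> x \<longrightarrow> absv (z - x) < d \<longrightarrow> D n z \<le> B"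
proof (induction n)
  case 0
  show ?case by (intro exI[of _ 1] conjI) auto
next
  case (Suc n)
  obtain B d where B: "0 < B" "0 < d" "\<And>z. z \<noteq> x \<Longrightarrow> absv (z - x) < d \<Longrightarrow> D n z \<le> B" using Suc.IH by blast
  let ?b = "(f ^^ n) x"
  obtain B' d' where B': "0 < B'" "0 < d'" "\<And>z. z \<noteq> ?b \<Longrightarrow> absv (z - ?b) < d' \<Longrightarrow> absv (df z) \<le> B' * (if df ?b = 0 then absv (z - ?b) else 1)"
    using df_near[OF Jc_forward(1)[OF Jc_iterate[OF x]]] by blast
  have "0 < min d' 1" using B'(2) by simp
  then obtain d'' where d'': "0 < d''" "\<And>z. z \<noteq> x \<Longrightarrow> absv (z - x) < d'' \<Longrightarrow> (f ^^ n) z \<noteq> ?b \<and> absv ((f ^^ n) z - ?b) < min d' 1"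
    using near_iterate[OF x, of "min d' 1" n] by blast
  show ?case
  proof (rule exI[of _ "B * B'"], intro conjI exI[of _ "min d d''"] allI impI)
    show "0 < B * B'" "0 < min d d''" using B B' d'' by auto
    fix z assume z: "z \<noteq> x" "absv (z - x) < min d d''"
    have n: "(f ^^ n) z \<noteq> ?b" "absv ((f ^^ n) z - ?b) < d'" "absv ((f ^^ n) z - ?b) < 1"
      using d''(2)[OF z(1)] z(2) by auto
    have "absv (df ((f ^^ n) z)) \<le> B' * (if df ?b = 0 then absv ((f ^^ n) z - ?b) else 1)" by (rule B'(3)[OF n(1,2)])
    also have "\<dots> \<le> B' * 1" using n(3) B'(1) by (intro mult_left_mono) auto
    finally have "absv (df ((f ^^ n) z)) \<le> B'" by simp
    thus "D (Suc n) z \<le> B * B'" unfolding D_Suc using B(3)[OF z(1)] z(2) B(1) by (intro mult_mono) auto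
  qed
qed

lemma D_critical_small:
  assumes c: "c \<in> Jc" "df c = 0" and e: "0 < e"
  shows "\<exists>d>0. \<forall>z. z \<noteq> c \<longrightarrow> absv (z - c) < d \<longrightarrow> D (Suc n) z \<le> e"
proof -
  obtain B d where B: "0 < B" "0 < d" "\<And>z. z \<noteq> f c \<Longrightarrow> absv (z - f c) < d \<Longrightarrow> D n z \<le> B"
    using D_near[OF Jc_forward(2)[OF c(1)], of n] by blast
  obtain B' d' where B': "0 < B'" "0 < d'" "\<And>z. z \<noteq> c \<Longrightarrow> absv (z - c) < d' \<Longrightarrow> absv (df z) \<le> B' * absv (z - c)"
    using df_near[OF Jc_forward(1)[OF c(1)]] c(2) by auto
  obtain d'' where d'': "0 < d''" "\<And>z. z \<noteq> c \<Longrightarrow> absv (z - c) < d'' \<Longrightarrow> f z \<noteq> f c \<and> absv (f z - f c) < d"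
    using near_image[OF Jc_forward(1)[OF c(1)] B(2)] by blast
  show ?thesis
  proof (intro exI[of _ "min (min d' d'') (e / (B * B'))"] conjI allI impI)
    show "0 < min (min d' d'') (e / (B * B'))" using B B' d'' e by simp
    fix z assume z: "z \<noteq> c" "absv (z - c) < min (min d' d'') (e / (B * B'))"
    have "D (Suc n) z \<le> (B' * absv (z - c)) * B"
      unfolding D_Suc' using B'(3)[OF z(1)] B(3)[of "f z"] d''(2)[OF z(1)] z(2) D_nonneg B'(1) by (intro mult_mono) auto
    also have "\<dots> = absv (z - c) * (B * B')" by simp
    also have "\<dots> \<le> e" using z(2) B(1) B'(1) by (simp add: pos_less_divide_eq less_imp_le)
    finally show "D (Suc n) z \<le> e" .
  qed
qed

text \<open>Along orbits in \<open>A\<close> expansion gives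
  \<open>\<rho> z \<le> \<rho> ((f ^^ n) z) * D n z\<close>. For \<open>z\<close> tending to
  \<open>c\<close> the right side tends to 0 once \<open>(f ^^ n) c\<close> is not exceptional,
  against the lower bound \<open>C\<close>. The invariant set \<open>A\<close> is kept separate from
  the Julia points in \<open>L\<close> because expansion is given only on the Julia set over
  \<open>L\<close>.\<close>

lemma no_accumulation:
  assumes adm: "expanding_admissible absv P Q L"
    and A: "A \<subseteq> Jc \<inter> L" "\<And>x. x \<in> A \<Longrightarrow> f x \<in> A" "\<And>x. x \<in> A \<Longrightarrow> Some x \<in> Julia_set absv P Q L"
    and c: "c \<in> A" "df c = 0" "inj (\<lambda>n. (f ^^ n) c)"
  shows "\<not> accumulates A c"
proof
  assume accumulates: "accumulates A c"
  obtain V \<rho> Z where VZ: "admissible absv P Q L V \<rho> Z" "expanding_wrt absv P Q L \<rho> Z"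
    using adm unfolding expanding_admissible_def by blast
  have JV: "x \<in> V" if "x \<in> Jc" "x \<in> L" for x using VZ(1) that unfolding admissible_def Jc_def by blast
  have cont: "absv_continuous_on absv V \<rho>" and finZ: "finite Z" and rfin: "\<And>x. x \<in> V - Z \<Longrightarrow> \<rho> x \<noteq> \<infinity>"
    using VZ(1) unfolding admissible_def by auto
  obtain C where C: "0 < C" "\<And>x. x \<in> V \<Longrightarrow> ereal C \<le> \<rho> x" using VZ(1) unfolding admissible_def by blast
  obtain lam where lam: "1 < lam" "\<And>x y. Some x \<in> Julia_set absv P Q L \<Longrightarrow> rat_eval P Q (Some x) = Some y \<Longrightarrow>
     x \<notin> Z \<Longrightarrow> y \<notin> Z \<Longrightarrow> ereal lam * \<rho> x \<le> \<rho> y * ereal (absv (rat_deriv P Q x))"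
    using VZ(2) unfolding expanding_wrt_def by blast
  have Ait: "(f ^^ n) x \<in> A" if "x \<in> A" for x n by (induction n) (use that A(2) in auto)
  have AV: "x \<in> V" if "x \<in> A" for x using that A(1) JV by blast
  have cJ: "c \<in> Jc" using c(1) A(1) by blast
  have real_\<rho>: "\<exists>r. \<rho> x = ereal r \<and> C \<le> r" if "x \<in> A" "x \<notin> Z" for x
    using C(2)[OF AV[OF that(1)]] rfin[of x] AV[OF that(1)] that(2) by (cases "\<rho> x") auto
  have "finite {n. (f ^^ n) c \<in> Z}"
    using finite_vimageI[OF finZ c(3)] by (simp add: vimage_def)
  \<comment> \<open>An injective orbit visits the finite set \<open>Z\<close> finitely often; beyond
    the last visit the metric is finite at the iterate of \<open>c\<close>.\<close>
  then obtain n0 where n0: "\<And>n. (f ^^ n) c \<in> Z \<Longrightarrow> n \<le> n0" using finite_nat_set_iff_bounded_le by auto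
  define n where "n = Suc n0"
  have nZ: "(f ^^ n) c \<notin> Z" using n0[of n] by (auto simp: n_def)
  obtain Rn where Rn: "\<rho> ((f ^^ n) c) = ereal Rn" "C \<le> Rn" using real_\<rho>[OF Ait[OF c(1)] nZ] by blast
  \<comment> \<open>Chosen so that \<open>(Rn + 1) * \<epsilon>\<close> is half of the lower bound
    \<open>C\<close>.\<close>
  define \<epsilon> where "\<epsilon> = C / (2 * (Rn + 1))"
  have \<epsilon>: "0 < \<epsilon>" using C(1) Rn(2) by (simp add: \<epsilon>_def)
  obtain d1 where d1: "0 < d1" "\<And>z. z \<noteq> c \<Longrightarrow> absv (z - c) < d1 \<Longrightarrow> D n z \<le> \<epsilon>"
    using D_critical_small[OF cJ c(2) \<epsilon>, of n0] unfolding n_def by blast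
  \<comment> \<open>Even where \<open>(f ^^ j) c\<close> is exceptional, iterates of nearby points
    are not, since a small punctured neighbourhood of \<open>c\<close> misses the value
    \<open>(f ^^ j) c\<close>.\<close>
  have "\<exists>d>0. \<forall>z. z \<noteq> c \<longrightarrow> absv (z - c) < d \<longrightarrow> (f ^^ j) z \<notin> Z" for j
  proof -
    let ?Z = "Z - {(f ^^ j) c}"
    have pos: "0 < sing_dist ?Z ((f ^^ j) c)" using finZ by (intro sing_dist(3)) auto
    obtain d where d: "0 < d" "\<And>z. z \<noteq> c \<Longrightarrow> absv (z - c) < d \<Longrightarrow> (f ^^ j) z \<noteq> (f ^^ j) c \<and> absv ((f ^^ j) z - (f ^^ j) c) < sing_dist ?Z ((f ^^ j) c)"
      using near_iterate[OF cJ pos, of j] by blast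
    have "(f ^^ j) z \<notin> Z" if z: "z \<noteq> c" "absv (z - c) < d" for z
    proof
      assume "(f ^^ j) z \<in> Z"
      hence "(f ^^ j) z \<in> ?Z" using d(2)[OF z] by simp
      hence "sing_dist ?Z ((f ^^ j) c) \<le> absv ((f ^^ j) c - (f ^^ j) z)" using finZ by (intro sing_dist(2)) auto
      thus False using d(2)[OF z] by (simp add: absv_commute)
    qed
    thus ?thesis using d(1) by blast
  qed
  then obtain d2 where d2: "\<And>j. 0 < d2 j" "\<And>j z. z \<noteq> c \<Longrightarrow> absv (z - c) < d2 j \<Longrightarrow> (f ^^ j) z \<notin> Z" by metis
  define d where "d = min d1 (Min (d2 ` {..n}))"
  have d: "0 < d" using d1(1) d2(1) by (simp add: d_def)
  have avoid: "(f ^^ j) z \<notin> Z" if "z \<noteq> c" "absv (z - c) < d" "j \<le> n" for z j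
  proof (rule d2(2)[OF that(1)])
    have "Min (d2 ` {..n}) \<le> d2 j" using that(3) by (intro Min_le) auto
    hence "d \<le> d2 j" unfolding d_def by linarith
    thus "absv (z - c) < d2 j" using that(2) by linarith
  qed
  have "\<exists>y\<in>A. y \<noteq> c \<and> absv (y - c) < inverse (Suc k)" for k
    using accumulates unfolding accumulates_def by simp
  then obtain y where y: "\<And>k. y k \<in> A" "\<And>k. y k \<noteq> c" "\<And>k. absv (y k - c) < inverse (Suc k)" by metis
  have ylim: "(\<lambda>k. absv (y k - c)) \<longlonglongrightarrow> 0" by (rule lim_inverse_nat) (rule y(3))
  have qlim: "(\<lambda>k. absv ((f ^^ n) (y k) - (f ^^ n) c)) \<longlonglongrightarrow> 0"
  proof (rule tendstoI)
    fix e :: real assume "0 < e"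
    then obtain t where t: "0 < t" "\<And>z. z \<noteq> c \<Longrightarrow> absv (z - c) < t \<Longrightarrow> (f ^^ n) z \<noteq> (f ^^ n) c \<and> absv ((f ^^ n) z - (f ^^ n) c) < e"
      using near_iterate[OF cJ, of e n] by blast
    have "\<forall>\<^sub>F k in sequentially. absv (y k - c) < t" using ylim t(1) by (auto simp: order_tendsto_iff)
    thus "\<forall>\<^sub>F k in sequentially. dist (absv ((f ^^ n) (y k) - (f ^^ n) c)) 0 < e"
    proof eventually_elim
      case (elim k)
      thus ?case using t(2)[OF y(2) elim] by (simp add: dist_real_def)
    qed
  qed
  have "(\<lambda>k. \<rho> ((f ^^ n) (y k))) \<longlonglongrightarrow> \<rho> ((f ^^ n) c)"
    using cont[unfolded absv_continuous_on_def, rule_format, of "(f ^^ n) c" "\<lambda>k. (f ^^ n) (y k)"] qlim AV Ait y(1) c(1) by blast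
  hence "\<forall>\<^sub>F k in sequentially. \<rho> ((f ^^ n) (y k)) < ereal (Rn + 1)"
    unfolding Rn(1) by (rule order_tendstoD(2)) simp
  moreover have "\<forall>\<^sub>F k in sequentially. absv (y k - c) < d" using ylim d by (auto simp: order_tendsto_iff)
  ultimately have "\<forall>\<^sub>F k in sequentially. \<rho> ((f ^^ n) (y k)) < ereal (Rn + 1) \<and> absv (y k - c) < d"
    by eventually_elim simp
  then obtain k where k: "\<rho> ((f ^^ n) (y k)) < ereal (Rn + 1)" "absv (y k - c) < d"
    by (auto simp: eventually_sequentially)
  let ?z = "y k"
  have "\<forall>j. \<exists>r. j \<le> n \<longrightarrow> \<rho> ((f ^^ j) ?z) = ereal r \<and> C \<le> r"
    using real_\<rho>[OF Ait[OF y(1)[of k]] avoid[OF y(2)[of k] k(2)]] by blast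
  then obtain r where r: "\<And>j. j \<le> n \<Longrightarrow> \<rho> ((f ^^ j) ?z) = ereal (r j)" "\<And>j. j \<le> n \<Longrightarrow> C \<le> r j" by metis
  have chain: "j \<le> n \<Longrightarrow> C \<le> r j * D j ?z" for j
  proof (induction j)
    case 0
    thus ?case using r(2)[of 0] by simp
  next
    case (Suc j)
    let ?x = "(f ^^ j) ?z"
    have xA: "?x \<in> A" by (rule Ait[OF y(1)])
    hence Qx: "poly Q ?x \<noteq> 0" using A(1) Jc_forward(1) by blast
    have Z: "?x \<notin> Z" "f ?x \<notin> Z" using avoid[OF y(2) k(2), of j] avoid[OF y(2) k(2), of "Suc j"] Suc.prems by auto
    have "ereal lam * \<rho> ?x \<le> \<rho> (f ?x) * ereal (absv (rat_deriv P Q ?x))"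
      using Qx by (intro lam(2) A(3) xA Z) simp
    hence "lam * r j \<le> r (Suc j) * absv (df ?x)"
      using r(1)[of j] r(1)[of "Suc j"] Suc.prems by (simp add: df_def)
    moreover have "1 * r j \<le> lam * r j" using lam(1) r(2)[of j] C(1) Suc.prems by (intro mult_right_mono) auto
    ultimately have "r j \<le> r (Suc j) * absv (df ?x)" by linarith
    hence "r j * D j ?z \<le> r (Suc j) * absv (df ?x) * D j ?z" by (intro mult_right_mono D_nonneg)
    hence "r j * D j ?z \<le> r (Suc j) * D (Suc j) ?z" by (simp add: D_Suc mult_ac)
    thus ?case using Suc.IH Suc.prems by linarith
  qed
  have "r n < Rn + 1" using k(1) r(1)[of n] by simp
  moreover have "D n ?z \<le> \<epsilon>" using d1(2)[OF y(2), of k] k(2) by (simp add: d_def)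
  ultimately have "r n * D n ?z \<le> (Rn + 1) * \<epsilon>"
    using r(2)[of n] C(1) D_nonneg Rn(2) by (intro mult_mono) auto
  also have "\<dots> = C / 2" using Rn(2) C(1) by (simp add: \<epsilon>_def field_simps)
  finally show False using chain[of n] C(1) by simp
qed

text \<open>Near \<open>u\<close> the equation \<open>f z = y i\<close> is modelled by
  \<open>a * (z - u) ^ m = w i\<close>. Dividing \<open>w i\<close> by \<open>m\<close>-th powers of
  powers of \<open>p\<close> gives \<open>\<theta> i\<close> of bounded size away from 0, with a
  limit \<open>\<theta>0\<close> along a subsequence. One \<open>m\<close>-th root \<open>s\<close>
  of \<open>\<theta>0 / a\<close> then serves all late members: \<open>u + t i * s\<close> is close
  enough to a solution for Newton iteration in \<open>L2\<close>.\<close>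

lemma accumulates_preimage:
  assumes L1: "heine_borel L1" "is_subfield L1" "over L1 P" "over L1 Q" and u: "u \<in> Jc" "u \<in> L1"
    and accumulates: "accumulates (Jc \<inter> L1) (f u)"
  shows "\<exists>L2. finite_ext L1 L2 \<and> accumulates (Jc \<inter> L2) u"
proof -
  have Qu: "poly Q u \<noteq> 0" using Jc_forward(1)[OF u(1)] .
  obtain a \<delta> H where a: "0 < \<delta>" "\<delta> \<le> 1" "a \<noteq> 0" "0 \<le> H"
    "\<And>b. absv (b - u) < \<delta> \<Longrightarrow> absv (f b - f u - a * (b - u) ^ mult u) \<le> H * absv (b - u) ^ Suc (mult u)"
    "\<And>b. b \<noteq> u \<Longrightarrow> absv (b - u) < \<delta> \<Longrightarrow> absv (df b) = absv (of_nat (mult u)) * absv a * absv (b - u) ^ (mult u - 1)"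
    "\<And>b. b \<noteq> u \<Longrightarrow> absv (b - u) < \<delta> \<Longrightarrow> lin b (absv (of_nat (mult u)) / 2 * absv (b - u))"
    by (rule local_mono[OF Qu]) (rule that; assumption)
  define m where "m = mult u"
  define \<mu> where "\<mu> = absv (of_nat m)"
  have m: "0 < m" unfolding m_def by (rule mult_pos[OF Qu])
  have \<mu>: "0 < \<mu>" "\<mu> \<le> 1" unfolding \<mu>_def using m absv_of_nat_le by auto
  have ap: "0 < absv a" using a(3) by simp
  have P1: "1 < real p" by (rule p_gt_1)
  have fL: "f z \<in> L1" if "z \<in> L1" for z
    using that L1 by (auto simp: f_def intro!: subfield_simps over_poly)
  have pk: "(of_nat p :: 'a) ^ k \<in> L1" for k using L1(2) by (auto intro!: subfield_simps subfield_of_nat)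
  have pk0: "(of_nat p :: 'a) ^ k \<noteq> 0" for k using p_gt_1 by auto
  \<comment> \<open>\<open>a\<close> is the limit of the quotients
    \<open>(f (u + x) - f u) / x ^ m\<close> in the closed field \<open>L1\<close>; only then is
    \<open>s\<close> algebraic over \<open>L1\<close> by an explicit equation.\<close>
  have aL: "a \<in> L1"
  proof (rule heine_borel_closed'[OF L1(1)])
    fix e :: real assume e: "0 < e"
    have "0 < min \<delta> (e / (H + 1))" using a e by simp
    then obtain k where k: "absv (of_nat p ^ k) < min \<delta> (e / (H + 1))" using exists_close by blast
    define x where "x = (of_nat p :: 'a) ^ k"
    have x: "x \<noteq> 0" "absv x < \<delta>" "absv x < e / (H + 1)" using k pk0 by (auto simp: x_def)
    have "absv (f (u + x) - f u - a * x ^ m) \<le> H * absv x ^ Suc m" using a(5)[of "u + x"] x(2) by (simp add: m_def)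
    moreover have "(f (u + x) - f u) / x ^ m - a = (f (u + x) - f u - a * x ^ m) / x ^ m"
      using x(1) by (simp add: diff_divide_distrib)
    ultimately have "absv ((f (u + x) - f u) / x ^ m - a) \<le> H * absv x ^ Suc m / absv x ^ m"
      by (simp only: absv_divide absv_power) (intro divide_right_mono, simp_all)
    also have "\<dots> = H * absv x" using x(1) by simp
    also have "\<dots> \<le> (H + 1) * absv x" by (intro mult_right_mono) auto
    also have "\<dots> < e" using x(3) a(4) by (simp add: pos_less_divide_eq mult.commute)
    finally have "absv ((f (u + x) - f u) / x ^ m - a) < e" .
    moreover have "(f (u + x) - f u) / x ^ m \<in> L1"
      using L1(2) u(2) pk[of k] by (auto simp: x_def intro!: subfield_simps fL)
    ultimately show "\<exists>y\<in>L1. absv (y - a) < e" by blast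
  qed
  define q where "q = real p ^ m"
  have q: "1 < q" unfolding q_def using P1 m by (simp add: one_less_power)
  have "\<exists>y\<in>Jc \<inter> L1. y \<noteq> f u \<and> absv (y - f u) < inverse (Suc i)" for i
    using accumulates unfolding accumulates_def by simp
  then obtain y where y: "\<And>i. y i \<in> Jc \<inter> L1" "\<And>i. y i \<noteq> f u" "\<And>i. absv (y i - f u) < inverse (Suc i)" by metis
  define w where "w i = y i - f u" for i
  have w0: "0 < absv (w i)" for i using y(2) by (simp add: w_def)
  have w1: "absv (w i) < 1" for i
  proof -
    have "inverse (real (Suc i)) \<le> 1" by (simp add: field_simps)
    thus ?thesis using y(3)[of i] by (simp add: w_def)
  qed
  have "\<exists>k::nat. 1 / q < absv (w i) * q ^ k \<and> absv (w i) * q ^ k \<le> 1" for i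
  proof -
    obtain k :: int where k: "1 / q < absv (w i) * q powi k" "absv (w i) * q powi k \<le> 1"
      using exists_powi_between[OF q w0] by blast
    have "0 \<le> k"
    proof (rule ccontr)
      assume "\<not> 0 \<le> k"
      hence "q powi k \<le> q powi (-1)" using q by (intro power_int_increasing) auto
      hence "absv (w i) * q powi k \<le> 1 * q powi (-1)" using w1[of i] q by (intro mult_mono) auto
      thus False using k(1) by (simp add: power_int_minus inverse_eq_divide)
    qed
    hence "q powi k = q ^ nat k" by (simp add: power_int_def)
    thus ?thesis using k by metis
  qed
  then obtain k where k: "\<And>i. 1 / q < absv (w i) * q ^ k i" "\<And>i. absv (w i) * q ^ k i \<le> 1" by metis
  define t where "t i = (of_nat p :: 'a) ^ k i" for i
  have t0: "t i \<noteq> 0" for i unfolding t_def by (rule pk0)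
  have tm: "absv (t i) ^ m = 1 / q ^ k i" for i
    by (simp add: t_def q_def absv_p power_divide power_mult[symmetric] mult.commute)
  define \<theta> where "\<theta> i = w i / t i ^ m" for i
  have \<theta>a: "absv (\<theta> i) = absv (w i) * q ^ k i" for i
    using tm[of i] by (simp add: \<theta>_def)
  have wL: "w i \<in> L1" for i using y(1)[of i] fL[OF u(2)] L1(2) by (auto simp: w_def intro!: subfield_simps)
  have \<theta>L: "\<theta> i \<in> L1" for i unfolding \<theta>_def t_def by (rule subfield_simps(8)[OF L1(2) wL subfield_simps(9)[OF L1(2) pk]])
  obtain \<theta>0 r where r: "\<theta>0 \<in> L1" "strict_mono r" "(\<lambda>n. absv (\<theta> (r n) - \<theta>0)) \<longlonglongrightarrow> 0"
    using heine_borelE[OF L1(1), of \<theta> 1] \<theta>L k(2) unfolding \<theta>a[symmetric] by blast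
  have ev\<theta>: "\<forall>\<^sub>F n in sequentially. absv (\<theta> (r n) - \<theta>0) < e" if "0 < e" for e
    using r(3) that by (auto simp: order_tendsto_iff)
  have \<theta>00: "\<theta>0 \<noteq> 0"
  proof
    assume z: "\<theta>0 = 0"
    have "\<forall>\<^sub>F n in sequentially. absv (\<theta> (r n) - \<theta>0) < 1 / q" using q by (intro ev\<theta>) simp
    then obtain n where "absv (\<theta> (r n) - \<theta>0) < 1 / q" by (auto simp: eventually_sequentially)
    thus False using k(1)[of "r n"] \<theta>a[of "r n"] z by simp
  qed
  define pm where "pm = monom 1 m + [:- (\<theta>0 / a):]"
  have dpm: "degree pm = m"
    unfolding pm_def using m by (simp add: degree_add_eq_left degree_monom_eq)
  then obtain s where s: "poly pm s = 0" using alg_closed[of pm] m by auto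
  have sm: "a * s ^ m = \<theta>0" using s a(3) by (simp add: pm_def poly_monom)
  have s0: "s \<noteq> 0" using sm \<theta>00 m by (auto simp: zero_power)
  have "over L1 pm" unfolding pm_def using L1(2) r(1) aL by (auto intro!: over_simps subfield_simps)
  moreover have "pm \<noteq> 0" using dpm m by auto
  ultimately obtain L2 where L2: "finite_ext L1 L2" "s \<in> L2" using finite_ext_adjoin[OF L1(2) _ _ s] by blast
  have L2': "is_subfield L2" "L1 \<subseteq> L2" using L2(1) by (auto simp: finite_ext_iff)
  have o2: "over L2 P" "over L2 Q" using L1(3,4) L2'(2) by (auto simp: over_def)
  have hb2: "heine_borel L2" by (rule heine_borel_finite_ext[OF L1(1) L2(1)])
  have "accumulates (Jc \<inter> L2) u" unfolding accumulates_def
  proof (intro allI impI)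
    fix \<epsilon> :: real assume \<epsilon>: "0 < \<epsilon>"
    \<comment> \<open>The last bound keeps the error of the monomial model below the radius of the
      linear image of the ball about \<open>z0\<close>: one factor \<open>\<mu>\<close> comes from
      the derivative, the other from the radius of linearity.\<close>
    define \<eta> where "\<eta> = min (min \<epsilon> \<delta>) (\<mu> * \<mu> / 2 * absv a / (H + 1))"
    have \<eta>: "0 < \<eta>" using \<epsilon> a \<mu> ap by (simp add: \<eta>_def)
    have "0 < \<mu> * \<mu> / 2 * absv \<theta>0" using \<mu> \<theta>00 by simp
    from ev\<theta>[OF this] have ev1: "\<forall>\<^sub>F n in sequentially. absv (\<theta> (r n) - \<theta>0) < \<mu> * \<mu> / 2 * absv \<theta>0" .
    have lim: "(\<lambda>n. inverse (real (Suc (r n)))) \<longlonglongrightarrow> 0"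
      using LIMSEQ_subseq_LIMSEQ[OF LIMSEQ_inverse_real_of_nat r(2)] by (simp add: o_def)
    have "0 < (\<eta> / absv s) ^ m / q" using \<eta> s0 q by simp
    hence ev2: "\<forall>\<^sub>F n in sequentially. inverse (real (Suc (r n))) < (\<eta> / absv s) ^ m / q"
      using lim by (simp only: order_tendsto_iff)
    from eventually_conj[OF ev1 ev2] obtain n where n: "absv (\<theta> (r n) - \<theta>0) < \<mu> * \<mu> / 2 * absv \<theta>0"
      "inverse (real (Suc (r n))) < (\<eta> / absv s) ^ m / q" by (auto simp: eventually_sequentially)
    define i where "i = r n"
    have tsmall: "absv (t i) < \<eta> / absv s"
    proof (rule power_less_imp_less_base)
      have "1 / q ^ k i < q * absv (w i)" using k(1)[of i] q by (simp add: field_simps)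
      also have "\<dots> < q * ((\<eta> / absv s) ^ m / q)"
        using y(3)[of i] n(2) q unfolding i_def[symmetric] w_def by (intro mult_strict_left_mono) linarith+
      finally show "absv (t i) ^ m < (\<eta> / absv s) ^ m" using q tm[of i] by simp
    qed (use \<eta> in simp)
    define z0 where "z0 = u + t i * s"
    define \<sigma> where "\<sigma> = absv (z0 - u)"
    have \<sigma>ts: "\<sigma> = absv (t i) * absv s" by (simp add: \<sigma>_def z0_def absv_mult)
    have \<sigma>: "0 < \<sigma>" "\<sigma> < \<eta>" using t0 s0 tsmall unfolding \<sigma>ts by (auto simp: pos_less_divide_eq)
    have zu: "z0 \<noteq> u" "absv (z0 - u) < \<delta>" using \<sigma> by (auto simp: \<sigma>_def \<eta>_def)
    have lin: "lin z0 (\<mu> / 2 * \<sigma>)" using a(7)[OF zu] by (simp add: \<mu>_def m_def \<sigma>_def)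
    have dfz: "absv (df z0) = \<mu> * absv a * \<sigma> ^ (m - 1)" using a(6)[OF zu] by (simp add: \<mu>_def m_def \<sigma>_def)
    have rad: "absv (df z0) * (\<mu> / 2 * \<sigma>) = \<mu> * \<mu> / 2 * (absv a * \<sigma> ^ m)"
    proof -
      have "\<sigma> ^ m = \<sigma> ^ (m - 1) * \<sigma>" using m by (metis One_nat_def Suc_pred power_Suc2)
      thus ?thesis unfolding dfz by simp
    qed
    have a\<sigma>: "absv a * \<sigma> ^ m = absv (t i ^ m) * absv \<theta>0"
      unfolding \<sigma>ts sm[symmetric] by (simp add: absv_mult power_mult_distrib)
    have eq: "y i - f z0 = (w i - t i ^ m * \<theta>0) + - (f z0 - f u - a * (z0 - u) ^ m)"
      using sm by (simp add: w_def z0_def power_mult_distrib algebra_simps)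
    have hA: "absv (w i - t i ^ m * \<theta>0) < \<mu> * \<mu> / 2 * (absv a * \<sigma> ^ m)"
    proof -
      have "w i - t i ^ m * \<theta>0 = t i ^ m * (\<theta> i - \<theta>0)" using t0[of i] by (simp add: \<theta>_def right_diff_distrib)
      hence "absv (w i - t i ^ m * \<theta>0) = absv (t i ^ m) * absv (\<theta> i - \<theta>0)" by (simp only: absv_mult)
      also have "\<dots> < absv (t i ^ m) * (\<mu> * \<mu> / 2 * absv \<theta>0)"
        using n(1) t0[of i] unfolding i_def[symmetric] by (intro mult_strict_left_mono) auto
      finally show ?thesis unfolding a\<sigma> by (simp only: mult_ac)
    qed
    have hB: "absv (- (f z0 - f u - a * (z0 - u) ^ m)) < \<mu> * \<mu> / 2 * (absv a * \<sigma> ^ m)"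
    proof -
      have "absv (f z0 - f u - a * (z0 - u) ^ m) \<le> H * \<sigma> * \<sigma> ^ m" using a(5)[OF zu(2)] by (simp add: m_def \<sigma>_def mult.assoc)
      also have "\<dots> \<le> (H + 1) * \<sigma> * \<sigma> ^ m" using \<sigma> by (intro mult_right_mono) auto
      also have "\<dots> < \<mu> * \<mu> / 2 * absv a * \<sigma> ^ m"
      proof (rule mult_strict_right_mono)
        have "\<sigma> < \<mu> * \<mu> / 2 * absv a / (H + 1)" using \<sigma>(2) by (simp add: \<eta>_def)
        moreover have "0 < H + 1" using a(4) by simp
        ultimately show "(H + 1) * \<sigma> < \<mu> * \<mu> / 2 * absv a" by (simp only: pos_less_divide_eq mult.commute[of "H + 1"])
      qed (use \<sigma> in simp)
      finally show ?thesis by (simp only: absv_minus mult.assoc)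
    qed
    have "absv (y i - f z0) < absv (df z0) * (\<mu> / 2 * \<sigma>)"
      unfolding rad eq by (rule le_less_trans[OF absv_add max_less_iff_conj[THEN iffD2, OF conjI[OF hA hB]]])
    moreover have "t i \<in> L2" using pk[of "k i"] L2'(2) by (auto simp: t_def)
    hence "z0 \<in> L2" "y i \<in> L2"
      using u(2) L2(2) L2' y(1)[of i] by (auto simp: z0_def intro!: subfield_simps)
    ultimately obtain z where z: "z \<in> L2" "absv (z - z0) < \<mu> / 2 * \<sigma>" "f z = y i"
      using lin_surj[OF lin L2'(1) cauchy_closed_heine_borel[OF hb2] o2, of "y i"] by blast
    have zJ: "z \<in> Jc" using lin_Jc[OF lin z(2)] z(3) y(1)[of i] by simp
    have "z \<noteq> u" using z(3) y(2)[of i] by auto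
    moreover have "absv (z - u) < \<epsilon>"
    proof -
      have "\<mu> / 2 * \<sigma> \<le> 1 * \<sigma>" using \<mu> \<sigma> by (intro mult_right_mono) auto
      hence "absv (z - z0) < \<epsilon>" using z(2) \<sigma>(2) by (simp add: \<eta>_def)
      moreover have "absv (z0 - u) < \<epsilon>" using \<sigma>(2) by (simp add: \<sigma>_def[symmetric] \<eta>_def)
      ultimately show ?thesis by (rule absv_ultra_less)
    qed
    ultimately show "\<exists>y\<in>Jc \<inter> L2. y \<noteq> u \<and> absv (y - u) < \<epsilon>" using zJ z(1) by blast
  qed
  thus ?thesis using L2(1) by blast
qed

lemma over_finite_ext: "finite_ext F L \<Longrightarrow> over F q \<Longrightarrow> over L q"
  unfolding finite_ext_def over_def by blast

lemma accumulates_iterate: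
  assumes "heine_borel L1" "over L1 P" "over L1 Q" "is_subfield L1" "u \<in> Jc" "u \<in> L1" "accumulates (Jc \<inter> L1) ((f ^^ j) u)"
  shows "\<exists>L2. finite_ext L1 L2 \<and> accumulates (Jc \<inter> L2) u"
  using assms
proof (induction j arbitrary: L1)
  case 0
  thus ?case using finite_ext_refl by auto
next
  case (Suc j)
  note L = Suc.prems(1-4)
  have "(f ^^ j) u \<in> L1"
  proof (induction j)
    case (Suc j)
    thus ?case using L by (auto simp: f_def[of "(f ^^ j) u"] intro!: subfield_simps over_poly)
  qed (use Suc.prems in simp)
  then obtain L2 where L2: "finite_ext L1 L2" "accumulates (Jc \<inter> L2) ((f ^^ j) u)"
    using accumulates_preimage[OF L(1,4,2,3) Jc_iterate[OF Suc.prems(5)]] Suc.prems(7) by auto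
  have "is_subfield L2" "u \<in> L2" using L2(1) Suc.prems(6) by (auto simp: finite_ext_iff)
  then obtain L3 where "finite_ext L2 L3" "accumulates (Jc \<inter> L3) u"
    using Suc.IH[OF heine_borel_finite_ext[OF L(1) L2(1)] over_finite_ext[OF L2(1) L(2)] over_finite_ext[OF L2(1) L(3)] _ Suc.prems(5) _ L2(2)]
    by blast
  thus ?case using finite_ext_trans[OF L2(1)] by blast
qed

section \<open>Non-preperiodic critical points\<close>

definition preperiodic :: "'a \<Rightarrow> bool" where
  "preperiodic x \<longleftrightarrow> (\<exists>m n. 0 < n \<and> (f ^^ (m + n)) x = (f ^^ m) x)"

lemma preperiodic_iterate: "preperiodic ((f ^^ k) x) \<Longrightarrow> preperiodic x"
proof -
  assume "preperiodic ((f ^^ k) x)"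
  then obtain m n where "0 < n" "(f ^^ (m + n + k)) x = (f ^^ (m + k)) x"
    unfolding preperiodic_def by (auto simp: funpow_add)
  thus ?thesis unfolding preperiodic_def by (intro exI[of _ "m + k"] exI[of _ n]) (simp add: ac_simps)
qed

lemma not_preper_inj:
  assumes "\<not> preperiodic x"
  shows "inj (\<lambda>n. (f ^^ n) x)"
proof (rule linorder_injI)
  fix m n :: nat assume "m < n"
  thus "(f ^^ m) x \<noteq> (f ^^ n) x"
    using assms unfolding preperiodic_def by (metis le_add_diff_inverse less_imp_le zero_less_diff)
qed

lemma df_eq_0_iff: "poly Q x \<noteq> 0 \<Longrightarrow> df x = 0 \<longleftrightarrow> poly (pderiv P * Q - P * pderiv Q) x = 0"
  by (simp add: df_def rat_deriv_def)

text \<open>By \<open>local_mono\<close> points close to \<open>c\<close> have nonzero derivative,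
  whatever the local degree at \<open>c\<close>.\<close>

lemma Wronskian_neq_0:
  assumes "poly Q c \<noteq> 0"
  shows "pderiv P * Q - P * pderiv Q \<noteq> 0"
proof
  assume W: "pderiv P * Q - P * pderiv Q = 0"
  obtain \<delta> where a: "0 < \<delta>" "\<And>b. b \<noteq> c \<Longrightarrow> absv (b - c) < \<delta> \<Longrightarrow> lin b (absv (of_nat (mult c)) / 2 * absv (b - c))"
    by (rule local_mono[OF assms]) (rule that; assumption)
  obtain k where "absv (of_nat p ^ k) < \<delta>" using exists_close[OF a(1)] by blast
  hence l: "lin (c + of_nat p ^ k) (absv (of_nat (mult c)) / 2 * absv (c + of_nat p ^ k - c))"
    using p_gt_1 by (intro a(2)) auto
  have "poly Q (c + of_nat p ^ k) \<noteq> 0" using linD(3)[OF l, of "c + of_nat p ^ k"] linD(1)[OF l] by simp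
  thus False using linD(2)[OF l] df_eq_0_iff W by simp
qed

text \<open>Critical points are roots of the Wronskian, which is defined over \<open>K\<close>, so
  one finite extension contains them all. Further extensions serve to make expansion available on
  \<open>J \<inter> L\<close> and to pull accumulation back to \<open>c\<close>.\<close>

lemma critical_preperiodic:
  assumes K: "heine_borel K" "is_subfield K" "over K P" "over K Q"
    and adm: "\<And>L. finite_ext K L \<Longrightarrow> expanding_admissible absv P Q L"
    and c: "c \<in> Jc" "df c = 0"
  shows "preperiodic c"
proof (rule ccontr)
  assume np: "\<not> preperiodic c"
  let ?W = "pderiv P * Q - P * pderiv Q"
  have ext: "heine_borel L" "is_subfield L" "over L P" "over L Q" if "finite_ext K L" for L
    using that heine_borel_finite_ext[OF K(1) that] over_finite_ext[OF that] K(3,4) by (simp_all add: finite_ext_def)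
  have isolated: "\<not> accumulates (Jc \<inter> L) x" if L: "finite_ext K L" and x: "x \<in> Jc" "x \<in> L" "df x = 0" "\<not> preperiodic x" for L x
  proof -
    obtain L' where L': "finite_ext L L'" "\<forall>x\<in>Jc \<inter> L. Some x \<in> Julia_set absv P Q L'"
      using Julia_extension_exists[OF ext[OF L]] by blast
    show ?thesis
    proof (rule no_accumulation[OF adm[OF finite_ext_trans[OF L L'(1)]]])
      show "Jc \<inter> L \<subseteq> Jc \<inter> L'" using L'(1) by (auto simp: finite_ext_iff)
      show "f y \<in> Jc \<inter> L" if "y \<in> Jc \<inter> L" for y
        using that Jc_forward ext[OF L] by (auto simp: f_def intro!: subfield_simps over_poly)
    qed (use L'(2) x not_preper_inj in auto)
  qed
  define Cn where "Cn = {x \<in> Jc. df x = 0 \<and> \<not> preperiodic x}"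
  define Cp where "Cp = {x \<in> Jc. df x = 0 \<and> preperiodic x}"
  have crit: "Cn \<union> Cp \<subseteq> {x. poly ?W x = 0}"
    using df_eq_0_iff Jc_forward(1) by (auto simp: Cn_def Cp_def)
  have W0: "?W \<noteq> 0" by (rule Wronskian_neq_0[OF Jc_forward(1)[OF c(1)]])
  have fin: "finite (Cn \<union> Cp)" by (rule finite_subset[OF crit poly_roots_finite[OF W0]])
  have oW: "over K ?W" using K by (auto intro!: over_simps)
  have "\<exists>m. over K m \<and> m \<noteq> 0 \<and> poly m x = 0" if "x \<in> Cn \<union> Cp" for x
    using that crit W0 oW by blast
  then obtain L where L: "finite_ext K L" "Cn \<union> Cp \<subseteq> L"
    using finite_ext_adjoin_set[OF fin K(2)] by blast
  have cL: "c \<in> L" using L(2) c np by (auto simp: Cn_def)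
  have "finite {n. (f ^^ n) c \<in> Cn}"
    using finite_vimageI[OF _ not_preper_inj[OF np], of Cn] fin by (simp add: vimage_def)
  \<comment> \<open>The orbit of \<open>c\<close> is injective and \<open>Cn\<close> is finite, so
    from time \<open>j\<close> on the orbit avoids \<open>Cn\<close>; it never meets
    \<open>Cp\<close>, as none of its points is preperiodic.\<close>
  then obtain j where j: "\<And>n. (f ^^ n) c \<in> Cn \<Longrightarrow> n < j" using finite_nat_set_iff_bounded by auto
  define v where "v = (f ^^ j) c"
  have npv: "\<not> preperiodic v" using np preperiodic_iterate by (auto simp: v_def)
  have vJ: "v \<in> Jc" unfolding v_def by (rule Jc_iterate[OF c(1)])
  have L_iter: "(f ^^ n) x \<in> L" if "x \<in> L" for n x
    by (induction n) (use that ext[OF L(1)] in \<open>auto simp: f_def intro!: subfield_simps over_poly\<close>)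
  have vL: "v \<in> L" unfolding v_def by (rule L_iter[OF cL])
  have vCn: "(f ^^ n) v \<notin> Cn" for n
    using j[of "n + j"] by (auto simp: v_def funpow_add)
  have vCp: "(f ^^ n) v \<notin> Cp" for n
    using npv preperiodic_iterate by (auto simp: Cp_def)
  \<comment> \<open>Removing \<open>Cn\<close> preserves compactness, because by
    \<open>isolated\<close> its points are not limits of \<open>J \<inter> L\<close>.\<close>
  define Y where "Y = Jc \<inter> L - Cn"
  have vY: "(f ^^ n) v \<in> Y - Cp" for n
    using vCn vCp Jc_iterate[OF vJ] L_iter[OF vL] by (auto simp: Y_def)
  obtain R where R: "\<And>x. x \<in> Jc \<Longrightarrow> absv x \<le> R" using Jc_bounded by blast
  have Y: "cpt Y"
  proof (rule cpt_heine_borel[OF ext(1)[OF L(1)]])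
    fix l assume l: "l \<in> L" "l \<notin> Y"
    show "\<exists>e>0. \<forall>y\<in>Y. e \<le> absv (y - l)"
    proof (cases "l \<in> Jc")
      case True
      hence "l \<in> Cn" using l by (simp add: Y_def)
      hence "\<not> accumulates (Jc \<inter> L) l" using isolated[OF L(1) True l(1)] by (auto simp: Cn_def)
      then obtain e where "0 < e" "\<And>y. y \<in> Jc \<inter> L \<Longrightarrow> y \<noteq> l \<Longrightarrow> \<not> absv (y - l) < e"
        unfolding accumulates_def by blast
      thus ?thesis using l(2) by (intro exI[of _ e]) (auto simp: Y_def not_less)
    next
      case False
      then obtain r where "0 < r" "\<And>y. absv (y - l) < r \<Longrightarrow> y \<notin> Jc" using Jc_closed by blast
      thus ?thesis unfolding Y_def by (meson DiffD1 IntD1 not_less)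
    qed
  qed (use R in \<open>auto simp: Y_def\<close>)
  have finCp: "finite Cp" using fin by simp
  have esc: "escapes w" if "w \<in> Cp" for w
  proof -
    have "w \<in> Jc" "preperiodic w" using that by (auto simp: Cp_def)
    thus ?thesis using escapes_eventually_periodic unfolding preperiodic_def by metis
  qed
  have YQ: "poly Q y \<noteq> 0" if "y \<in> Y" for y using that Jc_forward(1) by (auto simp: Y_def)
  have Yc: "y \<in> Cp" if "y \<in> Y" "df y = 0" for y using that by (auto simp: Y_def Cn_def Cp_def)
  obtain \<kappa> where \<kappa>: "0 < \<kappa>" "\<And>s. 0 < s \<Longrightarrow> \<exists>s' n. 0 < s' \<and> s' \<le> s \<and> univalent n v s' \<and> \<kappa> \<le> s' * D n v"
    using big_images[OF Y YQ finCp Yc esc] vJ vY by meson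
  have "accumulates (Jc \<inter> L) v"
    unfolding accumulates_def
  proof (intro allI impI)
    fix r :: real assume r: "0 < r"
    define T where "T = {n. \<exists>s'. 0 < s' \<and> s' \<le> r \<and> univalent n v s' \<and> \<kappa> \<le> s' * D n v}"
    \<comment> \<open>Arbitrarily small \<open>s'\<close> with \<open>s' * D n v\<close> at least
      \<open>\<kappa>\<close> need unbounded derivatives, hence infinitely many
      \<open>n\<close>.\<close>
    have "infinite T"
    proof
      assume T: "finite T"
      define B where "B = (\<Sum>n\<in>T. D n v)"
      have B: "0 \<le> B" unfolding B_def by (intro sum_nonneg D_nonneg)
      have "0 < min r (\<kappa> / (B + 1))" using r \<kappa>(1) B by simp
      then obtain s' n where s: "0 < s'" "s' \<le> min r (\<kappa> / (B + 1))" "univalent n v s'" "\<kappa> \<le> s' * D n v"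
        using \<kappa>(2) by blast
      have "n \<in> T" using s by (auto simp: T_def)
      hence "D n v \<le> B" unfolding B_def using T D_nonneg by (intro member_le_sum) auto
      hence "s' * D n v \<le> \<kappa> / (B + 1) * B" using s(1,2) B D_nonneg by (intro mult_mono) auto
      also have "\<dots> < \<kappa>" using \<kappa>(1) B by (simp add: field_simps)
      finally show False using s(4) by simp
    qed
    hence inf: "infinite ((\<lambda>n. (f ^^ n) v) ` T)"
      using finite_imageD[of "\<lambda>n. (f ^^ n) v" T] inj_on_subset[OF not_preper_inj[OF npv], of T] by blast
    have "(\<lambda>n. (f ^^ n) v) ` T \<subseteq> Y" using vY by auto
    \<comment> \<open>For two orbit points within \<open>\<kappa>\<close>, the second lies in the
      univalent image, centred at the first, of a small ball about \<open>v\<close>. Its preimage in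
      that ball is a Julia point of \<open>L\<close> different from \<open>v\<close>.\<close>
    from cpt_infinite_close[OF Y inf this \<kappa>(1)]
    obtain x y where xy: "x \<in> (\<lambda>n. (f ^^ n) v) ` T" "y \<in> (\<lambda>n. (f ^^ n) v) ` T" "x \<noteq> y" "absv (x - y) < \<kappa>"
      by blast
    obtain n n' where n: "x = (f ^^ n) v" "n \<in> T" "y = (f ^^ n') v" using xy by blast
    obtain s where s: "0 < s" "s \<le> r" "univalent n v s" "\<kappa> \<le> s * D n v" using n(2) by (auto simp: T_def)
    have y: "y \<in> L" "y \<in> Jc" using vY[of n'] n(3) by (auto simp: Y_def)
    have "absv (y - (f ^^ n) v) < s * D n v" using xy(4) s(4) n(1) absv_commute[of x y] by simp
    then obtain z where z: "z \<in> L" "absv (z - v) < s" "(f ^^ n) z = y"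
      using univalent_surj[OF s(3) ext(2)[OF L(1)] cauchy_closed_heine_borel[OF ext(1)[OF L(1)]] ext(3,4)[OF L(1)] vL y(1)] by blast
    have "z \<in> Jc" using univalent_Jc[OF s(3) z(2)] z(3) y(2) by simp
    moreover have "z \<noteq> v" using z(3) n(1) xy(3) by auto
    ultimately show "\<exists>y\<in>Jc \<inter> L. y \<noteq> v \<and> absv (y - v) < r" using z(1,2) s(2) by force
  qed
  then obtain L2 where L2: "finite_ext L L2" "accumulates (Jc \<inter> L2) c"
    using accumulates_iterate[OF ext(1,3,4,2)[OF L(1)] c(1) cL] unfolding v_def by blast
  have "c \<in> L2" using L2(1) cL by (auto simp: finite_ext_iff)
  thus False using isolated[OF finite_ext_trans[OF L(1) L2(1)] c(1) _ c(2) np] L2(2) by blast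
qed

lemma subhyperbolic_iff: "subhyperbolic absv P Q \<longleftrightarrow> (\<forall>c\<in>Jc. df c = 0 \<longrightarrow> preperiodic c)"
proof -
  have eq: "critical_pt P Q (Some c) \<longleftrightarrow> df c = 0" "eventually_periodic (rat_eval P Q) (Some c) \<longleftrightarrow> preperiodic c" if "c \<in> Jc" for c
    using Jc_forward(1)[OF that] Jc_rat_eval[OF that]
    by (simp_all add: critical_pt_def df_eq_0_iff eventually_periodic_def preperiodic_def)
  have "None \<notin> Julia_set absv P Q UNIV" using infinity_Fatou by (simp add: Julia_set_def)
  hence "Julia_set absv P Q UNIV = Some ` Jc" unfolding Jc_def by (auto simp: image_iff) (metis option.exhaust)
  hence "subhyperbolic absv P Q \<longleftrightarrow> (\<forall>c\<in>Jc. critical_pt P Q (Some c) \<longrightarrow> eventually_periodic (rat_eval P Q) (Some c))"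
    by (auto simp: subhyperbolic_def)
  thus ?thesis by (simp add: eq)
qed

end

theorem theorem1p3:
  fixes absv :: "'a::field_char_0 \<Rightarrow> real" and p :: nat
    and K :: "'a set" and P Q :: "'a poly"
  assumes "is_Cp absv p"
    and "finite_ext (Qp_in absv) K"
    and "rat_map_over K P Q" and "rat_deg P Q \<ge> 2"
    and "None \<in> Fatou_set absv P Q UNIV"
  shows "subhyperbolic absv P Q \<longleftrightarrow>
         (\<forall>L. finite_ext K L \<longrightarrow> expanding_admissible absv P Q L)"
proof -
  interpret dyn absv p P Q
  proof
    fix s :: "nat \<Rightarrow> 'a" assume "\<And>e. 0 < e \<Longrightarrow> \<exists>N. \<forall>m\<ge>N. \<forall>n\<ge>N. absv (s m - s n) < e"
    thus "\<exists>l. (\<lambda>n. absv (s n - l)) \<longlonglongrightarrow> 0"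
      using assms(1) unfolding is_Cp_def absv_complete_def by blast
  qed (use assms in \<open>auto simp: is_Cp_def nonarch_absval_def alg_closed_field_def rat_map_over_def\<close>)
  have K: "heine_borel K" "is_subfield K" "over K P" "over K Q"
    using heine_borel_finite_ext[OF heine_borel_Qp assms(2)] assms(2,3) by (auto simp: finite_ext_def over_def rat_map_over_def)
  show ?thesis unfolding subhyperbolic_iff
  proof (intro iffI allI impI ballI)
    fix L assume pre: "\<forall>c\<in>Jc. df c = 0 \<longrightarrow> preperiodic c" and L: "finite_ext K L"
    interpret subhyp absv p P Q L
      using L pre heine_borel_finite_ext[OF K(1) L] over_finite_ext[OF L] K
      by unfold_locales (auto simp: finite_ext_iff preperiodic_def)
    show "expanding_admissible absv P Q L" by (rule expanding_metric)
  next
    fix c assume "\<forall>L. finite_ext K L \<longrightarrow> expanding_admissible absv P Q L" "c \<in> Jc" "df c = 0"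
    thus "preperiodic c" using critical_preperiodic[OF K] by blast
  qed
qed

end
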